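(* Let $(\mathcal{T}_1,\dots,\mathcal{T}_n)$, $\mathcal{T}_j=(T_{j,t})_{t\ge0}$, be a tuple of commuting normal contractive semigroups on a Hilbert space $\mathcal{H}$. Then it is jointly unitarily equivalent to a model $n$-normal contractive semigroup; that is, there exist a semifinite measure space $(X,\mu)$, functions $\psi_1,\dots,\psi_n\in L^\infty(X,\mu)$ with $\|\psi_j\|_\infty\le1$ and $\mu(\{x:\psi_j(x)=1\})=0$ for each $j$, and a unitary $\gamma:\mathcal{H}\to L^2(X,\mu)$ such that $T_{j,t}=\gamma^*M_{\varphi_t\circ\psi_j}\gamma$ for all $t\ge0$ and $j=1,\dots,n$.
   Context: A contractive semigroup is a strongly continuous one-parameter semigroup $(T_t)_{t\ge0}$ of contractions with $T_0=I$; it is normal if each $T_t$ is normal. Semigroups $(T_{i,t})$ and $(T_{j,t})$ commute if $T_{i,t}T_{j,t}=T_{j,t}T_{i,t}$ for all $t\ge0$. $\varphi_t(w)=e^{t\frac{w+1}{w-1}}$ for $w\in\overline{\mathbb{D}}\setminus\{1\}$, $(\varphi_t\circ\psi)(x)=\varphi_t(\psi(x))$, and $M_f$ is multiplication by $f$ on $L^2(X,\mu)$. *)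

theory Defs
  imports "HOL-Analysis.Analysis"
begin

text \<open>A complex Hilbert space is given by a carrier type 'h with its additive group
structure, a complex scalar multiplication sc and an inner product ip
(linear in the first argument, conjugate linear in the second).\<close>

definition hnorm :: "('h \<Rightarrow> 'h \<Rightarrow> complex) \<Rightarrow> 'h \<Rightarrow> real" where
  "hnorm ip x = sqrt (Re (ip x x))"

definition complex_hilbert_space ::
  "(complex \<Rightarrow> 'h::ab_group_add \<Rightarrow> 'h) \<Rightarrow> ('h \<Rightarrow> 'h \<Rightarrow> complex) \<Rightarrow> bool" where
  "complex_hilbert_space sc ip \<longleftrightarrow>
     vector_space sc \<and>
     (\<forall>x y z. ip (x + y) z = ip x z + ip y z) \<and>
     (\<forall>a x y. ip (sc a x) y = a * ip x y) \<and>
     (\<forall>x y. ip y x = cnj (ip x y)) \<and>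
     (\<forall>x. 0 \<le> Re (ip x x)) \<and>
     (\<forall>x. ip x x = 0 \<longrightarrow> x = 0) \<and>
     (\<forall>X :: nat \<Rightarrow> 'h. (\<forall>e>0. \<exists>N. \<forall>m\<ge>N. \<forall>k\<ge>N. hnorm ip (X m - X k) < e)
        \<longrightarrow> (\<exists>L. (\<lambda>k. hnorm ip (X k - L)) \<longlonglongrightarrow> 0))"

definition clinear_op :: "(complex \<Rightarrow> 'h::ab_group_add \<Rightarrow> 'h) \<Rightarrow> ('h \<Rightarrow> 'h) \<Rightarrow> bool" where
  "clinear_op sc A \<longleftrightarrow> (\<forall>a x y. A (sc a x + y) = sc a (A x) + A y)"

definition contraction :: "(complex \<Rightarrow> 'h::ab_group_add \<Rightarrow> 'h) \<Rightarrow> ('h \<Rightarrow> 'h \<Rightarrow> complex) \<Rightarrow> ('h \<Rightarrow> 'h) \<Rightarrow> bool" where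
  "contraction sc ip A \<longleftrightarrow> clinear_op sc A \<and> (\<forall>x. hnorm ip (A x) \<le> hnorm ip x)"

definition is_adjoint :: "('h \<Rightarrow> 'h \<Rightarrow> complex) \<Rightarrow> ('h \<Rightarrow> 'h) \<Rightarrow> ('h \<Rightarrow> 'h) \<Rightarrow> bool" where
  "is_adjoint ip A S \<longleftrightarrow> (\<forall>x y. ip (A x) y = ip x (S y))"

definition normal_op :: "('h \<Rightarrow> 'h \<Rightarrow> complex) \<Rightarrow> ('h \<Rightarrow> 'h) \<Rightarrow> bool" where
  "normal_op ip A \<longleftrightarrow> (\<exists>S. is_adjoint ip A S \<and> A \<circ> S = S \<circ> A)"

definition contractive_semigroup ::
  "(complex \<Rightarrow> 'h::ab_group_add \<Rightarrow> 'h) \<Rightarrow> ('h \<Rightarrow> 'h \<Rightarrow> complex) \<Rightarrow> (real \<Rightarrow> 'h \<Rightarrow> 'h) \<Rightarrow> bool" where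
  "contractive_semigroup sc ip T \<longleftrightarrow>
     T 0 = id \<and>
     (\<forall>s\<ge>0. \<forall>t\<ge>0. T (s + t) = T s \<circ> T t) \<and>
     (\<forall>t\<ge>0. contraction sc ip (T t)) \<and>
     (\<forall>x. ((\<lambda>t. hnorm ip (T t x - x)) \<longlongrightarrow> 0) (at_right 0))"

definition normal_contractive_semigroup ::
  "(complex \<Rightarrow> 'h::ab_group_add \<Rightarrow> 'h) \<Rightarrow> ('h \<Rightarrow> 'h \<Rightarrow> complex) \<Rightarrow> (real \<Rightarrow> 'h \<Rightarrow> 'h) \<Rightarrow> bool" where
  "normal_contractive_semigroup sc ip T \<longleftrightarrow>
     contractive_semigroup sc ip T \<and> (\<forall>t\<ge>0. normal_op ip (T t))"

definition phi :: "real \<Rightarrow> complex \<Rightarrow> complex" where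
  "phi t w = exp (complex_of_real t * ((w + 1) / (w - 1)))"

definition semifinite :: "'x measure \<Rightarrow> bool" where
  "semifinite M \<longleftrightarrow> (\<forall>A\<in>sets M. emeasure M A = \<infinity> \<longrightarrow>
      (\<exists>B\<in>sets M. B \<subseteq> A \<and> 0 < emeasure M B \<and> emeasure M B < \<infinity>))"

text \<open>Elements of L^2(X,mu), represented by functions (equality a.e.).\<close>
definition square_integrable :: "'x measure \<Rightarrow> ('x \<Rightarrow> complex) \<Rightarrow> bool" where
  "square_integrable M f \<longleftrightarrow> f \<in> borel_measurable M \<and> integrable M (\<lambda>x. (cmod (f x))\<^sup>2)"

definition L2_inner :: "'x measure \<Rightarrow> ('x \<Rightarrow> complex) \<Rightarrow> ('x \<Rightarrow> complex) \<Rightarrow> complex" where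
  "L2_inner M f g = (LINT x|M. f x * cnj (g x))"

definition unitary_to_L2 ::
  "('h \<Rightarrow> 'h \<Rightarrow> complex) \<Rightarrow> 'x measure \<Rightarrow> ('h \<Rightarrow> 'x \<Rightarrow> complex) \<Rightarrow> bool" where
  "unitary_to_L2 ip M \<gamma> \<longleftrightarrow>
     (\<forall>h. square_integrable M (\<gamma> h)) \<and>
     (\<forall>h k. L2_inner M (\<gamma> h) (\<gamma> k) = ip h k) \<and>
     (\<forall>f. square_integrable M f \<longrightarrow> (\<exists>h. AE x in M. \<gamma> h x = f x))"

end

theory Submission
  imports Defs
begin

text \<open>For a normal operator \<open>A\<close> the vectors with \<open>\<parallel>(A - \<lambda>)\<^sup>k x\<parallel> \<le> r\<^sup>k \<parallel>x\<parallel>\<close> for all \<open>k\<close> form a closed subspace,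
  the spectral subspace of the closed disc of radius \<open>r\<close> around \<open>\<lambda>\<close>. It reduces every operator that commutes
  with \<open>A\<close>, so the projections \<open>P\<^sub>k\<close> onto the disc subspaces of the operators \<open>T\<^sub>j\<close> at dyadic times (with
  centres in a countable dense set and radii \<open>1/p\<close>) commute, and since finitely many small discs cover the
  spectrum, the \<open>P\<^sub>k\<close> determine these operators. A vector \<open>v\<close> defines a measure on sequences \<open>w\<close> giving the
  cylinder \<open>w\<^sub>k = 1\<close> for \<open>k\<close> in a finite set the mass \<open>\<parallel>P\<^sub>k\<^sub>1 \<dots> P\<^sub>k\<^sub>m v\<parallel>\<^sup>2\<close>; the cyclic subspace of \<open>v\<close> is then \<open>L\<^sup>2\<close>
  of that measure, and a maximal family of orthogonal cyclic subspaces gives the measure space.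
  In this model \<open>T\<^sub>j\<close> at time \<open>2\<^sup>-\<^sup>m\<close> is multiplication by a function \<open>z\<^sub>m\<close>. Strong continuity makes the averages
  of the powers of \<open>z\<^sub>m\<close> converge, which forces \<open>z\<^sub>m = exp (g / 2\<^sup>m)\<close> for a function \<open>g\<close> with \<open>Re g \<le> 0\<close>, and
  \<open>\<psi>\<^sub>j = (g + 1) / (g - 1)\<close>.\<close>

section \<open>Hilbert spaces\<close>

text \<open>No separability is assumed, so there may be uncountably many cyclic subspaces. The model
  space is then a disjoint union of uncountably many finite slices, in general semifinite but not
  sigma-finite, and every statement almost everywhere has to be proved slice by slice and glued
  through measurability. Null sets also explain the restriction to dyadic times: exceptional sets
  depending on the time can only be united countably often, so the remaining times are reached by a
  limit at the very end. The disc subspaces are defined by growth of powers alone. This makes the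
  argument independent of a functional calculus: spectral measures never occur, and a point of the
  model is merely a record of answers to countably many questions whether a projection applies.
  Square roots alone would leave branches \<open>exp (2 * pi * i * n / 2^m)\<close> open, with
  \<open>n\<close> an arbitrary dyadic integer; continuity in time has to enter pointwise, where it
  is available only almost everywhere along subsequences. The map
  \<open>g \<mapsto> (g + 1) / (g - 1)\<close> is its own inverse and sends the closed left half
  plane onto the closed unit disc without 1.\<close>

lemma of_real_cmod_sq: "(complex_of_real (cmod z))\<^sup>2 = z * cnj z"
  by (metis complex_norm_square of_real_power)

locale hilbert_space =
  fixes sc :: "complex \<Rightarrow> 'h::ab_group_add \<Rightarrow> 'h"
    and ip :: "'h \<Rightarrow> 'h \<Rightarrow> complex"
  assumes hilbert: "complex_hilbert_space sc ip"
begin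

sublocale vector_space sc
  using hilbert by (simp add: complex_hilbert_space_def)

abbreviation nm :: "'h \<Rightarrow> real" where "nm \<equiv> hnorm ip"

lemma ip_add_left: "ip (x + y) z = ip x z + ip y z"
  by (rule hilbert[unfolded complex_hilbert_space_def, THEN conjunct2, THEN conjunct1, rule_format])

lemma ip_sc_left: "ip (sc a x) y = a * ip x y"
  by (rule hilbert[unfolded complex_hilbert_space_def, THEN conjunct2, THEN conjunct2, THEN conjunct1,
        rule_format])

lemma ip_commute: "ip y x = cnj (ip x y)"
  by (rule hilbert[unfolded complex_hilbert_space_def, THEN conjunct2, THEN conjunct2, THEN conjunct2,
        THEN conjunct1, rule_format])

lemma ip_self_nonneg: "0 \<le> Re (ip x x)"
  by (rule hilbert[unfolded complex_hilbert_space_def, THEN conjunct2, THEN conjunct2, THEN conjunct2,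
        THEN conjunct2, THEN conjunct1, rule_format])

lemma ip_self_eq_0D: "ip x x = 0 \<Longrightarrow> x = 0"
  by (rule hilbert[unfolded complex_hilbert_space_def, THEN conjunct2, THEN conjunct2, THEN conjunct2,
        THEN conjunct2, THEN conjunct2, THEN conjunct1, rule_format])

lemma complete:
  fixes X :: "nat \<Rightarrow> 'h"
  assumes "\<And>e. e > 0 \<Longrightarrow> \<exists>N. \<forall>m\<ge>N. \<forall>k\<ge>N. nm (X m - X k) < e"
  shows "\<exists>L. (\<lambda>k. nm (X k - L)) \<longlonglongrightarrow> 0"
  by (rule hilbert[unfolded complex_hilbert_space_def, THEN conjunct2, THEN conjunct2, THEN conjunct2,
        THEN conjunct2, THEN conjunct2, THEN conjunct2, rule_format]) (rule assms)

lemma ip_add_right: "ip x (y + z) = ip x y + ip x z"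
  by (metis complex_cnj_add ip_add_left ip_commute)

lemma ip_sc_right: "ip x (sc a y) = cnj a * ip x y"
  by (metis complex_cnj_mult ip_commute ip_sc_left)

lemma ip_zero_left [simp]: "ip 0 y = 0"
  using ip_add_left[of 0 0 y] by simp

lemma ip_zero_right [simp]: "ip y 0 = 0"
  using ip_add_right[of y 0 0] by simp

lemma ip_minus_left: "ip (- x) y = - ip x y"
  using ip_add_left[of x "- x" y] by (simp add: add_eq_0_iff)

lemma ip_minus_right: "ip x (- y) = - ip x y"
  using ip_add_right[of x y "- y"] by (simp add: add_eq_0_iff)

lemma ip_diff_left: "ip (x - y) z = ip x z - ip y z"
  using ip_add_left[of x "- y" z] by (simp add: ip_minus_left)

lemma ip_diff_right: "ip x (y - z) = ip x y - ip x z"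
  using ip_add_right[of x y "- z"] by (simp add: ip_minus_right)

lemmas ip_simps = ip_add_left ip_add_right ip_sc_left ip_sc_right ip_diff_left ip_diff_right
  ip_minus_left ip_minus_right

lemma nm_nonneg [simp]: "0 \<le> nm x"
  by (simp add: hnorm_def ip_self_nonneg)

lemma nm_sq: "(nm x)\<^sup>2 = Re (ip x x)"
  by (simp add: hnorm_def ip_self_nonneg)

lemma ip_self: "ip x x = complex_of_real ((nm x)\<^sup>2)"
proof -
  have "Im (ip x x) = 0"
    using arg_cong[OF ip_commute[of x x], of Im] by simp
  then show ?thesis by (simp add: nm_sq complex_eq_iff)
qed

lemma nm_zero [simp]: "nm 0 = 0"
  by (simp add: hnorm_def)

lemma nm_eq_0 [simp]: "nm x = 0 \<longleftrightarrow> x = 0"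
  using ip_self_eq_0D[of x] by (auto simp: ip_self)

lemma nm_pos_iff [simp]: "0 < nm x \<longleftrightarrow> x \<noteq> 0"
  using nm_eq_0[of x] nm_nonneg[of x] by linarith

lemma nm_sc: "nm (sc a x) = cmod a * nm x"
proof -
  have "ip (sc a x) (sc a x) = of_real ((cmod a)\<^sup>2) * ip x x"
    by (simp only: ip_simps complex_norm_square mult_ac)
  then have "(nm (sc a x))\<^sup>2 = (cmod a * nm x)\<^sup>2"
    by (simp add: nm_sq power_mult_distrib)
  then show ?thesis by simp
qed

lemma nm_minus [simp]: "nm (- x) = nm x"
  by (simp add: hnorm_def ip_simps)

lemma nm_minus_commute: "nm (x - y) = nm (y - x)"
  using nm_minus[of "x - y"] by simp

lemma nm_add_sq: "(nm (x + y))\<^sup>2 = (nm x)\<^sup>2 + (nm y)\<^sup>2 + 2 * Re (ip x y)"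
proof -
  have "Re (ip y x) = Re (ip x y)" by (simp add: ip_commute[of y x])
  then show ?thesis by (simp add: nm_sq ip_simps)
qed

lemma nm_diff_sq: "(nm (x - y))\<^sup>2 = (nm x)\<^sup>2 + (nm y)\<^sup>2 - 2 * Re (ip x y)"
  using nm_add_sq[of x "- y"] by (simp add: ip_simps)

lemma cauchy_schwarz: "cmod (ip x y) \<le> nm x * nm y"
proof (cases "y = 0")
  case False
  define b where "b = ip x y / ip y y"
  have yy: "ip y y \<noteq> 0" using False by (simp add: ip_self)
  have "0 \<le> (nm (x - sc b y))\<^sup>2" by simp
  also have "\<dots> = (nm x)\<^sup>2 + (cmod b)\<^sup>2 * (nm y)\<^sup>2 - 2 * Re (cnj b * ip x y)"
    by (simp add: nm_diff_sq ip_simps nm_sc power_mult_distrib)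
  also have "cnj b * ip x y = of_real ((cmod (ip x y))\<^sup>2 / (nm y)\<^sup>2)"
    unfolding b_def by (simp add: ip_self of_real_cmod_sq mult.commute)
  also have "(cmod b)\<^sup>2 * (nm y)\<^sup>2 = (cmod (ip x y))\<^sup>2 / (nm y)\<^sup>2"
    using False unfolding b_def by (simp add: ip_self norm_divide power_divide norm_power norm_mult field_simps flip: of_real_power)
  finally have "0 \<le> (nm x)\<^sup>2 - (cmod (ip x y))\<^sup>2 / (nm y)\<^sup>2"
    unfolding Re_complex_of_real by linarith
  then have "(cmod (ip x y))\<^sup>2 \<le> (nm x * nm y)\<^sup>2"
    using False by (simp add: field_simps power_mult_distrib)
  then show ?thesis by (rule power2_le_imp_le) simp
qed simp

lemma Re_ip_le: "Re (ip x y) \<le> nm x * nm y"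
  using cauchy_schwarz[of x y] complex_Re_le_cmod[of "ip x y"] by linarith

lemma nm_triangle: "nm (x + y) \<le> nm x + nm y"
proof (rule power2_le_imp_le)
  show "(nm (x + y))\<^sup>2 \<le> (nm x + nm y)\<^sup>2"
    using Re_ip_le[of x y] by (simp add: nm_add_sq power2_sum)
qed simp

lemma nm_triangle_diff: "nm (x - z) \<le> nm (x - y) + nm (y - z)"
  using nm_triangle[of "x - y" "y - z"] by simp

lemma nm_diff_le: "nm (x - y) \<le> nm x + nm y"
  using nm_triangle[of x "- y"] by simp

lemma nm_diff_abs: "\<bar>nm x - nm y\<bar> \<le> nm (x - y)"
  using nm_triangle[of "x - y" y] nm_triangle[of "y - x" x] by (simp add: nm_minus_commute)

lemma nm_sum_le: "nm (sum f A) \<le> (\<Sum>a\<in>A. nm (f a))"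
proof (induction A rule: infinite_finite_induct)
  case (insert a A)
  then show ?case using nm_triangle[of "f a" "sum f A"] by simp
qed auto

text \<open>The type \<open>'h\<close> is only an abelian group; its norm comes from
  \<open>ip\<close>, so norm convergence is expressed through a real sequence.\<close>

definition hlim :: "(nat \<Rightarrow> 'h) \<Rightarrow> 'h \<Rightarrow> bool" where
  "hlim X L \<longleftrightarrow> (\<lambda>k. nm (X k - L)) \<longlonglongrightarrow> 0"

lemma hlim_sandwich:
  assumes "\<And>k. nm (X k - L) \<le> e k" "e \<longlonglongrightarrow> 0"
  shows "hlim X L"
  unfolding hlim_def by (rule tendsto_sandwich[OF _ _ tendsto_const assms(2)]) (auto simp: assms(1))

lemma hlim_add: "hlim X L \<Longrightarrow> hlim Y K \<Longrightarrow> hlim (\<lambda>k. X k + Y k) (L + K)"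
  unfolding hlim_def[of X] hlim_def[of Y]
proof (rule hlim_sandwich)
  show "nm (X k + Y k - (L + K)) \<le> nm (X k - L) + nm (Y k - K)" for k
    using nm_triangle[of "X k - L" "Y k - K"] by (simp add: algebra_simps)
  show "(\<lambda>k. nm (X k - L)) \<longlonglongrightarrow> 0 \<Longrightarrow> (\<lambda>k. nm (Y k - K)) \<longlonglongrightarrow> 0 \<Longrightarrow>
    (\<lambda>k. nm (X k - L) + nm (Y k - K)) \<longlonglongrightarrow> 0"
    using tendsto_add[of _ 0 _ _ 0] by auto
qed

lemma hlim_const [simp]: "hlim (\<lambda>k. L) L"
  by (simp add: hlim_def)

lemma hlim_ip_left:
  assumes "hlim X L"
  shows "(\<lambda>k. ip (X k) y) \<longlonglongrightarrow> ip L y"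
proof (rule LIM_zero_cancel, rule tendsto_norm_zero_cancel, rule tendsto_sandwich[OF _ _ tendsto_const])
  show "\<forall>\<^sub>F k in sequentially. cmod (ip (X k) y - ip L y) \<le> nm (X k - L) * nm y"
    using cauchy_schwarz[of "X _ - L" y] by (simp add: ip_diff_left)
  show "(\<lambda>k. nm (X k - L) * nm y) \<longlonglongrightarrow> 0"
    using assms tendsto_mult_left_zero unfolding hlim_def by blast
qed auto

lemma hlim_ip_right:
  assumes "hlim X L"
  shows "(\<lambda>k. ip y (X k)) \<longlonglongrightarrow> ip y L"
  using tendsto_cnj[OF hlim_ip_left[OF assms, of y]] by (simp add: ip_commute[symmetric])

lemma hlim_nm:
  assumes "hlim X L"
  shows "(\<lambda>k. nm (X k)) \<longlonglongrightarrow> nm L"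
proof (rule LIM_zero_cancel, rule tendsto_rabs_zero_cancel, rule tendsto_sandwich[OF _ _ tendsto_const])
  show "\<forall>\<^sub>F k in sequentially. \<bar>nm (X k) - nm L\<bar> \<le> nm (X k - L)"
    using nm_diff_abs by simp
qed (use assms in \<open>auto simp: hlim_def\<close>)

lemma hlim_unique: "hlim X L \<Longrightarrow> hlim X K \<Longrightarrow> L = K"
proof -
  assume a: "hlim X L" "hlim X K"
  have "hlim (\<lambda>k. - X k) (- K)"
    using a(2) by (simp add: hlim_def nm_minus_commute)
  from hlim_nm[OF hlim_add[OF a(1) this]] have "(\<lambda>k. 0) \<longlonglongrightarrow> nm (L - K)" by simp
  then have "nm (L - K) = 0" using LIMSEQ_unique tendsto_const by blast
  then show ?thesis by simp
qed

lemma hlim_bounded_linear: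
  assumes "hlim X L" "\<And>x y. A (x - y) = A x - A y" "\<And>x. nm (A x) \<le> c * nm x"
  shows "hlim (\<lambda>k. A (X k)) (A L)"
proof (rule hlim_sandwich)
  show "nm (A (X k) - A L) \<le> c * nm (X k - L)" for k
    using assms(2,3) by metis
  show "(\<lambda>k. c * nm (X k - L)) \<longlonglongrightarrow> 0"
    using assms(1) tendsto_mult_right_zero unfolding hlim_def by blast
qed

lemma hlim_sc: "hlim X L \<Longrightarrow> hlim (\<lambda>k. sc a (X k)) (sc a L)"
  by (rule hlim_bounded_linear[where c = "cmod a"]) (auto simp: scale_right_diff_distrib nm_sc)

lemma hlim_diff: "hlim X L \<Longrightarrow> hlim Y K \<Longrightarrow> hlim (\<lambda>k. X k - Y k) (L - K)"
  using hlim_add[of X L "\<lambda>k. - Y k" "- K"] by (simp add: hlim_def nm_minus_commute)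

lemma hlim_Suc: "hlim X L \<Longrightarrow> hlim (\<lambda>k. X (Suc k)) L"
  unfolding hlim_def by (rule LIMSEQ_Suc)

section \<open>Closed subspaces, orthogonal projections and the Riesz representation\<close>

definition csub :: "'h set \<Rightarrow> bool" where
  "csub K \<longleftrightarrow> 0 \<in> K \<and> (\<forall>x\<in>K. \<forall>y\<in>K. x + y \<in> K) \<and> (\<forall>a. \<forall>x\<in>K. sc a x \<in> K) \<and>
     (\<forall>X L. (\<forall>k. X k \<in> K) \<longrightarrow> hlim X L \<longrightarrow> L \<in> K)"

lemma csub_0: "csub K \<Longrightarrow> 0 \<in> K"
  and csub_add: "csub K \<Longrightarrow> x \<in> K \<Longrightarrow> y \<in> K \<Longrightarrow> x + y \<in> K"
  and csub_sc: "csub K \<Longrightarrow> x \<in> K \<Longrightarrow> sc a x \<in> K"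
  and csub_lim: "csub K \<Longrightarrow> (\<And>k. X k \<in> K) \<Longrightarrow> hlim X L \<Longrightarrow> L \<in> K"
  unfolding csub_def by blast+

lemma csub_diff: "csub K \<Longrightarrow> x \<in> K \<Longrightarrow> y \<in> K \<Longrightarrow> x - y \<in> K"
  using csub_add[of K x "sc (- 1) y"] csub_sc[of K y "- 1"] by simp

lemma csub_Int: "csub K \<Longrightarrow> csub L \<Longrightarrow> csub (K \<inter> L)"
  unfolding csub_def by blast

lemma csub_orthogonal: "csub {x. \<forall>y\<in>A. ip x y = 0}"
  unfolding csub_def
proof (intro conjI allI impI)
  fix X L assume X: "\<forall>k. X k \<in> {x. \<forall>y\<in>A. ip x y = 0}" "hlim X L"
  have "ip L y = 0" if "y \<in> A" for y
    using hlim_ip_left[OF X(2), of y] X(1) that LIMSEQ_unique[OF _ tendsto_const] by simp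
  then show "L \<in> {x. \<forall>y\<in>A. ip x y = 0}" by simp
qed (auto simp: ip_simps)

lemma nm_add_orthogonal: "ip x y = 0 \<Longrightarrow> (nm (x + y))\<^sup>2 = (nm x)\<^sup>2 + (nm y)\<^sup>2"
  by (simp add: nm_add_sq)

lemma parallelogram: "(nm (x + y))\<^sup>2 + (nm (x - y))\<^sup>2 = 2 * (nm x)\<^sup>2 + 2 * (nm y)\<^sup>2"
  by (simp add: nm_add_sq nm_diff_sq)

text \<open>The midpoint of two nearly minimising points lies in \<open>K\<close>, hence is at
  distance at least \<open>d\<close> from \<open>x\<close>; the parallelogram law then forces the
  two points together, so a minimising sequence is Cauchy.\<close>

lemma nearest_point_exists:
  assumes K: "csub K"
  shows "\<exists>p\<in>K. \<forall>y\<in>K. nm (x - p) \<le> nm (x - y)"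
proof -
  define d where "d = (INF y\<in>K. nm (x - y))"
  have bdd: "bdd_below ((\<lambda>y. nm (x - y)) ` K)" by (rule bdd_belowI[of _ 0]) auto
  have ne: "K \<noteq> {}" using csub_0[OF K] by auto
  have d_le: "d \<le> nm (x - y)" if "y \<in> K" for y
    unfolding d_def by (rule cINF_lower[OF bdd that])
  have d0: "0 \<le> d" unfolding d_def by (rule cINF_greatest[OF ne]) simp
  have "\<exists>y\<in>K. nm (x - y) < d + 1 / real (Suc k)" for k
    using cINF_less_iff[OF ne bdd] unfolding d_def by (metis less_add_same_cancel1 of_nat_0_less_iff zero_less_Suc zero_less_divide_1_iff)
  then obtain Y where Y: "\<And>k. Y k \<in> K" "\<And>k. nm (x - Y k) < d + 1 / real (Suc k)"
    by metis
  \<comment> \<open>The factor is \<open>2 * (2 * d + 1)\<close>: squaring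
    \<open>d + 1 / Suc k\<close> costs \<open>(2 * d + 1) / Suc k\<close>, and the parallelogram law
    doubles each error.\<close>
  have est: "(nm (Y m - Y k))\<^sup>2 \<le> (4 * d + 2) * (1 / real (Suc m)) + (4 * d + 2) * (1 / real (Suc k))" for m k
  proof -
    have sq: "(nm (x - Y k))\<^sup>2 \<le> d\<^sup>2 + (2 * d + 1) * (1 / real (Suc k))" for k
    proof -
      have "(nm (x - Y k))\<^sup>2 \<le> (d + 1 / real (Suc k))\<^sup>2"
        by (rule power_mono) (use Y(2)[of k] in auto)
      also have "(1 / real (Suc k))\<^sup>2 \<le> 1 / real (Suc k)"
        by (simp add: power2_eq_square divide_le_eq)
      then have "(d + 1 / real (Suc k))\<^sup>2 \<le> d\<^sup>2 + (2 * d + 1) * (1 / real (Suc k))"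
        by (simp add: power2_sum distrib_right add_divide_distrib)
      finally show ?thesis .
    qed
    have "sc (1/2) (Y m + Y k) \<in> K" by (intro csub_sc csub_add K Y)
    from d_le[OF this] have "2 * d \<le> nm (sc 2 (x - sc (1/2) (Y m + Y k)))" by (simp add: nm_sc)
    also have "sc 2 (x - sc (1/2) (Y m + Y k)) = (x - Y m) + (x - Y k)"
    proof -
      have "sc 2 x = x + x" using scale_left_distrib[of 1 1 x] by simp
      then show ?thesis by (simp add: scale_right_diff_distrib)
    qed
    finally have "(2 * d)\<^sup>2 \<le> (nm ((x - Y m) + (x - Y k)))\<^sup>2"
      using d0 by (intro power_mono) auto
    moreover have "nm ((x - Y m) - (x - Y k)) = nm (Y m - Y k)"
      by (simp add: nm_minus_commute)
    ultimately show ?thesis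
      using parallelogram[of "x - Y m" "x - Y k"] sq[of m] sq[of k] by (simp add: power2_eq_square add_divide_distrib)
  qed
  have "\<exists>L. hlim Y L" unfolding hlim_def
  proof (rule complete)
    fix e :: real assume e: "e > 0"
    have "(\<lambda>k. (4 * d + 2) * (1 / real (Suc k))) \<longlonglongrightarrow> (4 * d + 2) * 0"
      by (intro tendsto_mult tendsto_const LIMSEQ_Suc[OF lim_1_over_n])
    then have "\<forall>\<^sub>F k in sequentially. (4 * d + 2) * (1 / real (Suc k)) < e\<^sup>2 / 2"
      using e by (intro order_tendstoD(2)[of _ "(4 * d + 2) * 0"]) auto
    then obtain N where N: "\<And>k. k \<ge> N \<Longrightarrow> (4 * d + 2) * (1 / real (Suc k)) < e\<^sup>2 / 2"
      by (auto simp: eventually_sequentially)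
    have "nm (Y m - Y k) < e" if "m \<ge> N" "k \<ge> N" for m k
    proof (rule power2_less_imp_less)
      show "(nm (Y m - Y k))\<^sup>2 < e\<^sup>2" using est[of m k] N[OF that(1)] N[OF that(2)] by linarith
    qed (use e in simp)
    then show "\<exists>N. \<forall>m\<ge>N. \<forall>k\<ge>N. nm (Y m - Y k) < e" by blast
  qed
  then obtain p where p: "hlim Y p" by blast
  have pK: "p \<in> K" using csub_lim[OF K Y(1) p] .
  have "nm (x - p) \<le> d"
  proof (rule LIMSEQ_le)
    show "(\<lambda>k. nm (x - Y k)) \<longlonglongrightarrow> nm (x - p)" by (intro hlim_nm hlim_diff hlim_const p)
    show "(\<lambda>k. d + 1 / real (Suc k)) \<longlonglongrightarrow> d"
      using tendsto_add[OF tendsto_const LIMSEQ_Suc[OF lim_1_over_n]] by simp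
  qed (use Y(2) less_imp_le in blast)
  then show ?thesis using pK d_le order_trans by blast
qed

lemma projection_exists:
  assumes K: "csub K"
  shows "\<exists>p\<in>K. \<forall>y\<in>K. ip (x - p) y = 0"
proof -
  obtain p where p: "p \<in> K" "\<And>y. y \<in> K \<Longrightarrow> nm (x - p) \<le> nm (x - y)"
    using nearest_point_exists[OF K] by blast
  have "ip (x - p) y = 0" if y: "y \<in> K" for y
  proof (cases "y = 0")
    case False
    define b where "b = ip (x - p) y / ip y y"
    have "nm (x - p) \<le> nm (x - (p + sc b y))" by (intro p csub_add csub_sc K y)
    then have "(nm (x - p))\<^sup>2 \<le> (nm ((x - p) - sc b y))\<^sup>2"
      by (intro power_mono) (auto simp: algebra_simps)
    also have "\<dots> = (nm (x - p))\<^sup>2 + (cmod b)\<^sup>2 * (nm y)\<^sup>2 - 2 * Re (cnj b * ip (x - p) y)"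
      unfolding nm_diff_sq[of "x - p"] by (simp add: ip_sc_right nm_sc power_mult_distrib)
    also have "ip (x - p) y = b * of_real ((nm y)\<^sup>2)"
      using False by (simp add: b_def ip_self)
    then have "cnj b * ip (x - p) y = of_real ((cmod b)\<^sup>2 * (nm y)\<^sup>2)"
      by (simp add: of_real_cmod_sq mult_ac)
    finally have "(cmod b)\<^sup>2 * (nm y)\<^sup>2 \<le> 0" unfolding Re_complex_of_real by linarith
    then have "b = 0" using False by (auto simp: mult_le_0_iff)
    then show ?thesis using False by (simp add: b_def ip_self)
  qed simp
  with p show ?thesis by blast
qed

definition proj :: "'h set \<Rightarrow> 'h \<Rightarrow> 'h" where
  "proj K x = (SOME p. p \<in> K \<and> (\<forall>y\<in>K. ip (x - p) y = 0))"

lemma proj_in: "csub K \<Longrightarrow> proj K x \<in> K"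
  and proj_orthogonal: "csub K \<Longrightarrow> y \<in> K \<Longrightarrow> ip (x - proj K x) y = 0"
proof -
  have "proj K x \<in> K \<and> (\<forall>y\<in>K. ip (x - proj K x) y = 0)" if "csub K"
    unfolding proj_def by (rule someI_ex) (use projection_exists[OF that] in blast)
  then show "csub K \<Longrightarrow> proj K x \<in> K" "csub K \<Longrightarrow> y \<in> K \<Longrightarrow> ip (x - proj K x) y = 0"
    by auto
qed

lemma proj_eqI:
  assumes K: "csub K" and p: "p \<in> K" "\<And>y. y \<in> K \<Longrightarrow> ip (x - p) y = 0"
  shows "proj K x = p"
proof -
  let ?q = "proj K x"
  have "p - ?q \<in> K" by (intro csub_diff K p proj_in)
  then have "ip (x - ?q) (p - ?q) = 0" "ip (x - p) (p - ?q) = 0"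
    by (auto intro: p(2) proj_orthogonal[OF K])
  then have "ip (p - ?q) (p - ?q) = 0"
    using ip_diff_left[of "x - ?q" "x - p" "p - ?q"] by simp
  from ip_self_eq_0D[OF this] show ?thesis by simp
qed

lemma proj_self: "csub K \<Longrightarrow> x \<in> K \<Longrightarrow> proj K x = x"
  by (rule proj_eqI) auto

lemma proj_linear: "csub K \<Longrightarrow> clinear_op sc (proj K)"
  unfolding clinear_op_def
proof (intro allI)
  fix a x y assume K: "csub K"
  show "proj K (sc a x + y) = sc a (proj K x) + proj K y"
  proof (rule proj_eqI[OF K])
    show "sc a (proj K x) + proj K y \<in> K" by (intro csub_add csub_sc K proj_in)
    fix z assume z: "z \<in> K"
    show "ip (sc a x + y - (sc a (proj K x) + proj K y)) z = 0"
      using proj_orthogonal[OF K z, of x] proj_orthogonal[OF K z, of y]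
      by (simp add: ip_diff_left ip_add_left ip_sc_left)
  qed
qed

lemma proj_selfadjoint: "csub K \<Longrightarrow> ip (proj K x) y = ip x (proj K y)"
proof -
  assume K: "csub K"
  have "ip (x - proj K x) (proj K y) = 0" by (rule proj_orthogonal[OF K proj_in[OF K]])
  moreover have "ip (proj K x) (y - proj K y) = 0"
    using proj_orthogonal[OF K proj_in[OF K], of y x] by (simp add: ip_commute[of "proj K x"])
  ultimately show ?thesis by (simp add: ip_simps)
qed

lemma proj_nm_le:
  assumes K: "csub K"
  shows "nm (proj K x) \<le> nm x"
proof (rule power2_le_imp_le)
  have "ip (x - proj K x) (proj K x) = 0" using proj_orthogonal[OF K proj_in[OF K]] .
  from nm_add_orthogonal[OF this] show "(nm (proj K x))\<^sup>2 \<le> (nm x)\<^sup>2" by simp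
qed simp

lemma csub_eq_UNIV:
  assumes K: "csub K" and "\<And>x. (\<And>y. y \<in> K \<Longrightarrow> ip x y = 0) \<Longrightarrow> x = 0"
  shows "K = UNIV"
proof -
  have "x \<in> K" for x
  proof -
    have "x - proj K x = 0" using assms proj_orthogonal by blast
    then show ?thesis using proj_in[OF K, of x] by simp
  qed
  then show ?thesis by blast
qed

text \<open>Serves the surjectivity of the unitary: a square integrable function is first turned
  into a functional on the Hilbert space and then into a vector.\<close>

lemma riesz_representation:
  fixes \<phi> :: "'h \<Rightarrow> complex"
  assumes lin: "\<And>a x y. \<phi> (sc a x + y) = a * \<phi> x + \<phi> y"
    and bdd: "\<And>x. cmod (\<phi> x) \<le> c * nm x"
  shows "\<exists>k. \<forall>h. \<phi> h = ip h k"
proof -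
  have add: "\<phi> (x + y) = \<phi> x + \<phi> y" for x y using lin[of 1 x y] by simp
  have z: "\<phi> 0 = 0" using add[of 0 0] by simp
  have s: "\<phi> (sc a x) = a * \<phi> x" for a x using lin[of a x 0] z by simp
  have d: "\<phi> (x - y) = \<phi> x - \<phi> y" for x y using add[of "x - y" y] by simp
  define K where "K = {x. \<phi> x = 0}"
  have K: "csub K" unfolding csub_def K_def
  proof (intro conjI allI impI)
    fix X L assume X: "\<forall>k. X k \<in> {x. \<phi> x = 0}" "hlim X L"
    have "(\<lambda>k. c * nm (X k - L)) \<longlonglongrightarrow> 0"
      using X(2) tendsto_mult_right_zero unfolding hlim_def by blast
    moreover have "cmod (\<phi> L) \<le> c * nm (X k - L)" for k
      using bdd[of "X k - L"] X(1) by (simp add: d)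
    ultimately have "cmod (\<phi> L) \<le> 0" by (meson LIMSEQ_le_const)
    then show "L \<in> {x. \<phi> x = 0}" by simp
  qed (auto simp: add s z)
  show ?thesis
  proof (cases "K = UNIV")
    case True
    then show ?thesis by (intro exI[of _ 0]) (auto simp: K_def)
  next
    case False
    then obtain x where x: "x \<noteq> 0" "\<And>y. y \<in> K \<Longrightarrow> ip x y = 0"
      using csub_eq_UNIV[OF K] by blast
    have "\<phi> h = ip h (sc (cnj (\<phi> x) / of_real ((nm x)\<^sup>2)) x)" for h
    proof -
      have "sc (\<phi> x) h - sc (\<phi> h) x \<in> K" by (simp add: K_def d s)
      from x(2)[OF this] have "ip (sc (\<phi> x) h - sc (\<phi> h) x) x = 0"
        by (metis complex_cnj_zero ip_commute)
      then have "\<phi> x * ip h x = \<phi> h * of_real ((nm x)\<^sup>2)"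
        by (simp add: ip_diff_left ip_sc_left ip_self)
      then show ?thesis using x(1) by (simp add: ip_sc_right field_simps)
    qed
    then show ?thesis by blast
  qed
qed

section \<open>Bounded operators with an adjoint\<close>

text \<open>Asking linearity and boundedness of both operators makes the relation symmetric, so each
  fact about \<open>A\<close> is also one about its adjoint.\<close>

definition adjp :: "('h \<Rightarrow> 'h) \<Rightarrow> ('h \<Rightarrow> 'h) \<Rightarrow> bool" where
  "adjp A S \<longleftrightarrow> clinear_op sc A \<and> clinear_op sc S \<and> (\<exists>c. \<forall>x. nm (A x) \<le> c * nm x) \<and>
     (\<exists>c. \<forall>x. nm (S x) \<le> c * nm x) \<and> is_adjoint ip A S"

lemma clinear_add: "clinear_op sc A \<Longrightarrow> A (x + y) = A x + A y"
  unfolding clinear_op_def by (metis scale_one)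

lemma clinear_zero: "clinear_op sc A \<Longrightarrow> A 0 = 0"
  using clinear_add[of A 0 0] by simp

lemma clinear_sc: "clinear_op sc A \<Longrightarrow> A (sc a x) = sc a (A x)"
  using clinear_zero[of A] unfolding clinear_op_def by (metis add.right_neutral)

lemma clinear_diff: "clinear_op sc A \<Longrightarrow> A (x - y) = A x - A y"
  using clinear_add[of A "x - y" y] by simp

lemma adjp_add: "adjp A S \<Longrightarrow> A (x + y) = A x + A y"
  and adjp_zero: "adjp A S \<Longrightarrow> A 0 = 0"
  and adjp_sc: "adjp A S \<Longrightarrow> A (sc a x) = sc a (A x)"
  and adjp_diff: "adjp A S \<Longrightarrow> A (x - y) = A x - A y"
  by (simp_all add: adjp_def clinear_add clinear_zero clinear_sc clinear_diff)

lemma adjp_ip: "adjp A S \<Longrightarrow> ip (A x) y = ip x (S y)"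
  by (simp add: adjp_def is_adjoint_def)

lemma adjp_sym: "adjp A S \<Longrightarrow> adjp S A"
  unfolding adjp_def is_adjoint_def by (metis ip_commute)

lemma adjp_bound:
  assumes "adjp A S"
  obtains c where "c \<ge> 0" "\<And>x. nm (A x) \<le> c * nm x"
proof -
  obtain c where c: "\<And>x. nm (A x) \<le> c * nm x" using assms by (auto simp: adjp_def)
  have "nm (A x) \<le> max c 0 * nm x" for x
    using c[of x] mult_right_mono[of c "max c 0" "nm x"] by simp
  then show thesis using that[of "max c 0"] by simp
qed

lemma adjp_hlim: "adjp A S \<Longrightarrow> hlim X L \<Longrightarrow> hlim (\<lambda>k. A (X k)) (A L)"
  by (metis adjp_bound adjp_diff hlim_bounded_linear)

lemma adjp_id: "adjp (\<lambda>x. x) (\<lambda>x. x)"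
  by (auto simp: adjp_def clinear_op_def is_adjoint_def intro!: exI[of _ 1])

text \<open>In \<open>normal_op\<close> the adjoint is a bare function. Its linearity follows by
  testing against all vectors, its bound from
  \<open>nm (S y) * nm (S y) = Re (ip (A (S y)) y)\<close>.\<close>

lemma adjpI:
  assumes lin: "clinear_op sc A" and bd: "\<And>x. nm (A x) \<le> c * nm x" and adj: "\<And>x y. ip (A x) y = ip x (S y)"
  shows "adjp A S"
proof -
  have "clinear_op sc S" unfolding clinear_op_def
  proof (intro allI)
    fix a x y
    have "ip z (S (sc a x + y) - (sc a (S x) + S y)) = 0" for z
      using adj[of z x] adj[of z y] adj[of z "sc a x + y"] by (simp add: ip_simps)
    from ip_self_eq_0D[OF this] show "S (sc a x + y) = sc a (S x) + S y" by simp
  qed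
  moreover have "nm (S y) \<le> c * nm y" for y
  proof (cases "S y = 0")
    case True
    then show ?thesis using bd[of y] nm_nonneg[of "A y"] by (simp only: nm_zero)
  next
    case False
    have "nm (S y) * nm (S y) = Re (ip (A (S y)) y)" by (simp add: adj nm_sq[symmetric] power2_eq_square)
    also have "\<dots> \<le> (c * nm (S y)) * nm y"
      using Re_ip_le[of "A (S y)" y] mult_right_mono[OF bd[of "S y"], of "nm y"] by simp
    finally have "nm (S y) * nm (S y) \<le> nm (S y) * (c * nm y)" by (simp add: mult_ac)
    then show ?thesis using False by (simp add: mult_le_cancel_left)
  qed
  ultimately show ?thesis using lin bd adj unfolding adjp_def is_adjoint_def by blast
qed

lemma adjp_scaled:
  assumes A: "adjp A S"
  shows "adjp (\<lambda>x. sc a (A x)) (\<lambda>x. sc (cnj a) (S x))"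
proof -
  obtain c where c: "\<And>x. nm (A x) \<le> c * nm x" using A by (rule adjp_bound) blast
  show ?thesis
  proof (rule adjpI)
    show "nm (sc a (A x)) \<le> (cmod a * c) * nm x" for x
      using mult_left_mono[OF c[of x], of "cmod a"] by (simp add: nm_sc mult.assoc)
  qed (simp_all add: clinear_op_def adjp_add[OF A] adjp_sc[OF A] scale_right_distrib mult.commute ip_simps adjp_ip[OF A])
qed

lemma adjp_plus:
  assumes A: "adjp A S" and B: "adjp B T"
  shows "adjp (\<lambda>x. A x + B x) (\<lambda>x. S x + T x)"
proof -
  obtain c where c: "\<And>x. nm (A x) \<le> c * nm x" using A by (rule adjp_bound) blast
  obtain d where d: "\<And>x. nm (B x) \<le> d * nm x" using B by (rule adjp_bound) blast
  show ?thesis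
  proof (rule adjpI)
    show "nm (A x + B x) \<le> (c + d) * nm x" for x
      using c[of x] d[of x] nm_triangle[of "A x" "B x"] by (simp add: distrib_right)
  qed (simp_all add: clinear_op_def adjp_add[OF B] adjp_sc[OF B] adjp_add[OF A] adjp_sc[OF A] scale_right_distrib
      ip_simps adjp_ip[OF A] adjp_ip[OF B])
qed

lemma adjp_minus: "adjp A S \<Longrightarrow> adjp B T \<Longrightarrow> adjp (\<lambda>x. A x - B x) (\<lambda>x. S x - T x)"
  using adjp_plus[of A S "\<lambda>x. sc (- 1) (B x)" "\<lambda>x. sc (- 1) (T x)"] adjp_scaled[of B T "- 1"] by simp

lemma adjp_comp:
  assumes A: "adjp A S" and B: "adjp B T"
  shows "adjp (\<lambda>x. A (B x)) (\<lambda>x. T (S x))"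
proof -
  obtain c where c: "c \<ge> 0" "\<And>x. nm (A x) \<le> c * nm x" using A by (rule adjp_bound) blast
  obtain d where d: "\<And>x. nm (B x) \<le> d * nm x" using B by (rule adjp_bound) blast
  show ?thesis
  proof (rule adjpI)
    show "nm (A (B x)) \<le> (c * d) * nm x" for x
      using c(2)[of "B x"] mult_left_mono[OF d[of x] c(1)] by (simp add: mult.assoc)
  qed (simp_all add: clinear_op_def adjp_add[OF B] adjp_sc[OF B] adjp_add[OF A] adjp_sc[OF A] adjp_ip[OF A] adjp_ip[OF B])
qed

lemma adjp_funpow: "adjp A S \<Longrightarrow> adjp (A ^^ k) (S ^^ k)"
proof (induction k)
  case 0
  then show ?case using adjp_id by (simp add: id_def)
next
  case (Suc k)
  have "adjp (\<lambda>x. A ((A ^^ k) x)) (\<lambda>x. (S ^^ k) (S x))" by (rule adjp_comp[OF Suc.prems Suc.IH[OF Suc.prems]])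
  then show ?case by (simp add: comp_def funpow_swap1)
qed

lemma adjp_proj:
  assumes K: "csub K"
  shows "adjp (proj K) (proj K)"
  using proj_nm_le[OF K] proj_linear[OF K] proj_selfadjoint[OF K]
  by (auto simp: adjp_def is_adjoint_def intro!: exI[of _ 1])

text \<open>Invariance under \<open>D\<close> keeps \<open>D (proj K x)\<close> in \<open>K\<close>;
  invariance under the adjoint keeps \<open>D\<close> of the complementary part orthogonal to
  \<open>K\<close>.\<close>

lemma proj_commute:
  assumes K: "csub K" and D: "adjp D D'" "\<And>x. x \<in> K \<Longrightarrow> D x \<in> K" "\<And>x. x \<in> K \<Longrightarrow> D' x \<in> K"
  shows "proj K (D x) = D (proj K x)"
proof (rule proj_eqI[OF K])
  show "D (proj K x) \<in> K" by (intro D proj_in K)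
  fix y assume "y \<in> K"
  then show "ip (D x - D (proj K x)) y = 0"
    using proj_orthogonal[OF K D(3), of y x] by (simp add: adjp_diff[OF D(1), symmetric] adjp_ip[OF D(1)])
qed

text \<open>The iteration \<open>Y \<mapsto> (X + Y\<^sup>2) / 2\<close> with \<open>X = 1 - B\<^sup>2\<close> is dominated by the same iteration on
  scalars with \<open>X = 1\<close>, so it converges in operator norm; its limit is \<open>1 - \<bar>B\<bar>\<close>.\<close>

lemma operator_abs_exists:
  assumes B: "adjp B B" and B1: "\<And>x. nm (B x) \<le> nm x"
  shows "\<exists>S. adjp S S \<and> (\<forall>x. S (S x) = B (B x)) \<and> (\<forall>x. 0 \<le> Re (ip (S x) x)) \<and>
    (\<forall>D D'. adjp D D' \<longrightarrow> (\<forall>x. D (B x) = B (D x)) \<longrightarrow> (\<forall>x. D (S x) = S (D x))) \<and>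
    (\<forall>K. csub K \<longrightarrow> (\<forall>x\<in>K. B x \<in> K) \<longrightarrow> (\<forall>x\<in>K. S x \<in> K))"
proof -
  define X where "X x = x - B (B x)" for x
  have X: "adjp X X" using adjp_minus[OF adjp_id adjp_comp[OF B B]] by (simp add: X_def[abs_def])
  have X1: "nm (X x) \<le> nm x" for x
  proof (rule power2_le_imp_le)
    have "ip x (B (B x)) = ip (B x) (B x)" by (simp add: adjp_ip[OF B])
    then have "(nm (X x))\<^sup>2 = (nm x)\<^sup>2 + (nm (B (B x)))\<^sup>2 - 2 * (nm (B x))\<^sup>2"
      unfolding X_def nm_diff_sq by (simp add: nm_sq)
    moreover have "(nm (B (B x)))\<^sup>2 \<le> (nm (B x))\<^sup>2" by (intro power_mono B1) simp
    ultimately show "(nm (X x))\<^sup>2 \<le> (nm x)\<^sup>2" using zero_le_power2[of "nm (B x)"] by linarith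
  qed simp
  define Y where "Y k = ((\<lambda>f x. sc (1/2) (X x + f (f x))) ^^ k) (\<lambda>x. 0)" for k
  define y :: "nat \<Rightarrow> real" where "y k = ((\<lambda>t. (1 + t\<^sup>2) / 2) ^^ k) 0" for k
  have Y0: "Y 0 x = 0" and YS: "Y (Suc k) x = sc (1/2) (X x + Y k (Y k x))" for k x
    by (simp_all add: Y_def)
  have y0: "y 0 = 0" and yS: "y (Suc k) = (1 + (y k)\<^sup>2) / 2" for k by (simp_all add: y_def)
  have YA: "adjp (Y k) (Y k)" for k
  proof (induction k)
    case 0
    show ?case using adjp_scaled[OF adjp_id, of 0] by (simp add: Y_def)
  next
    case (Suc k)
    have "adjp (\<lambda>x. sc (1/2) (X x + Y k (Y k x))) (\<lambda>x. sc (cnj (1/2)) (X x + Y k (Y k x)))"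
      by (rule adjp_scaled[OF adjp_plus[OF X adjp_comp[OF Suc Suc]]])
    then show ?case by (simp add: Y_def)
  qed
  have y01: "0 \<le> y k \<and> y k \<le> 1" for k
  proof (induction k)
    case (Suc k)
    then have "(y k)\<^sup>2 \<le> 1" by (simp add: power_le_one)
    then show ?case by (simp add: yS)
  qed (simp add: y0)
  have Yb: "nm (Y k x) \<le> y k * nm x" for k x
  proof (induction k arbitrary: x)
    case (Suc k)
    have "nm (Y (Suc k) x) \<le> 1/2 * (nm (X x) + nm (Y k (Y k x)))"
      using nm_triangle[of "X x" "Y k (Y k x)"] by (simp add: YS nm_sc)
    also have "nm (Y k (Y k x)) \<le> y k * (y k * nm x)"
      using Suc[of "Y k x"] mult_left_mono[OF Suc[of x], of "y k"] y01[of k] by linarith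
    finally show ?case using X1[of x] by (simp add: yS power2_eq_square field_simps)
  qed (simp add: Y0 y0)
  have Yd: "y k \<le> y (Suc k) \<and> nm (Y (Suc k) x - Y k x) \<le> (y (Suc k) - y k) * nm x" for k x
  proof (induction k arbitrary: x)
    case 0
    show ?case using X1[of x] by (simp add: YS Y0 yS y0 nm_sc)
  next
    case (Suc k)
    let ?U = "Y (Suc k)" and ?V = "Y k" and ?u = "y (Suc k)" and ?v = "y k"
    have le: "?v \<le> ?u" using Suc by blast
    \<comment> \<open>Writing \<open>U U - V V\<close> as \<open>(U - V) U + V (U - V)\<close> needs
      no commutation of \<open>U\<close> and \<open>V\<close>, and the resulting bound is exactly
      the increment of the scalar iteration.\<close>
    have "Y (Suc (Suc k)) x - ?U x = sc (1/2) ((?U (?U x) - ?V (?U x)) + ?V (?U x - ?V x))"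
      unfolding YS[of "Suc k" x] YS[of k x]
      by (simp add: adjp_diff[OF YA] scale_right_diff_distrib[symmetric])
    then have "nm (Y (Suc (Suc k)) x - ?U x) \<le> 1/2 * (nm (?U (?U x) - ?V (?U x)) + nm (?V (?U x - ?V x)))"
      using nm_triangle by (simp add: nm_sc)
    also have "nm (?U (?U x) - ?V (?U x)) \<le> (?u - ?v) * (?u * nm x)"
      using Suc[of "?U x"] mult_left_mono[OF Yb[of "Suc k" x], of "?u - ?v"] le by linarith
    also have "nm (?V (?U x - ?V x)) \<le> ?v * ((?u - ?v) * nm x)"
      using Yb[of k "?U x - ?V x"] Suc[of x] mult_left_mono[of "nm (?U x - ?V x)" "(?u - ?v) * nm x" ?v] y01[of k]
      by linarith
    also have "1/2 * ((?u - ?v) * (?u * nm x) + ?v * ((?u - ?v) * nm x)) = (y (Suc (Suc k)) - ?u) * nm x"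
      unfolding yS[of "Suc k"] yS[of k] by (simp add: power2_eq_square field_simps)
    finally have "nm (Y (Suc (Suc k)) x - ?U x) \<le> (y (Suc (Suc k)) - ?u) * nm x" by simp
    moreover have "?v\<^sup>2 \<le> ?u\<^sup>2" using le y01[of k] by (intro power_mono) auto
    then have "?u \<le> y (Suc (Suc k))" unfolding yS[of "Suc k"] yS[of k] by simp
    ultimately show ?case by blast
  qed
  have Yd2: "nm (Y (k + m) x - Y k x) \<le> (y (k + m) - y k) * nm x" for k m x
  proof (induction m)
    case (Suc m)
    have "nm (Y (k + Suc m) x - Y k x) \<le> nm (Y (Suc (k + m)) x - Y (k + m) x) + nm (Y (k + m) x - Y k x)"
      using nm_triangle_diff by simp
    with Suc Yd[of "k + m" x] show ?case by (simp add: algebra_simps)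
  qed simp
  have "incseq y" using Yd by (intro incseq_SucI) blast
  then have "convergent y" using y01 by (intro Bseq_mono_convergent BseqI'[of _ 1]) (auto simp: incseq_def)
  then have yC: "Cauchy y" by (rule convergent_Cauchy)
  have "\<exists>L. hlim (\<lambda>k. Y k x) L" for x
    unfolding hlim_def
  proof (rule complete)
    fix e :: real assume e: "e > 0"
    have "e / (nm x + 1) > 0" using e by (intro divide_pos_pos) (auto intro: add_nonneg_pos)
    from CauchyD[OF yC this] obtain N where N: "\<And>m k. m \<ge> N \<Longrightarrow> k \<ge> N \<Longrightarrow> \<bar>y m - y k\<bar> < e / (nm x + 1)"
      by (auto simp: real_norm_def)
    have "nm (Y m x - Y k x) < e" if "k \<ge> N" "m \<ge> k" for m k
    proof -
      have "nm (Y m x - Y k x) \<le> (y m - y k) * nm x" using Yd2[of k "m - k" x] that by simp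
      also have "\<dots> \<le> e / (nm x + 1) * nm x"
        using N[of m k] that by (intro mult_right_mono) auto
      also have "\<dots> < e" using e by (simp add: divide_less_eq add_nonneg_pos)
      finally show ?thesis .
    qed
    then have "nm (Y m x - Y k x) < e" if "k \<ge> N" "m \<ge> N" for m k
      using that nm_minus_commute[of "Y m x" "Y k x"] by (metis nle_le)
    then show "\<exists>N. \<forall>m\<ge>N. \<forall>k\<ge>N. nm (Y m x - Y k x) < e" by blast
  qed
  then obtain Z where Z: "\<And>x. hlim (\<lambda>k. Y k x) (Z x)" by metis
  have Z1: "nm (Z x) \<le> nm x" for x
  proof (rule LIMSEQ_le_const2[OF hlim_nm[OF Z]])
    show "\<exists>N. \<forall>n\<ge>N. nm (Y n x) \<le> nm x"
      using Yb[of _ x] y01 mult_right_mono[of "y _" 1 "nm x"] by (meson nm_nonneg order_trans mult_left_le_one_le)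
  qed
  have Zlin: "clinear_op sc Z"
    unfolding clinear_op_def
  proof (intro allI)
    fix a x y
    have "hlim (\<lambda>k. sc a (Y k x) + Y k y) (sc a (Z x) + Z y)" by (intro hlim_add hlim_sc Z)
    then show "Z (sc a x + y) = sc a (Z x) + Z y"
      using Z[of "sc a x + y"] hlim_unique by (simp add: adjp_add[OF YA] adjp_sc[OF YA])
  qed
  have "ip (Z x) w = ip x (Z w)" for x w
    using LIMSEQ_unique[OF hlim_ip_left[OF Z[of x], of w]] hlim_ip_right[OF Z[of w], of x]
    by (simp add: adjp_ip[OF YA])
  then have ZA: "adjp Z Z" using Zlin Z1 by (auto simp: adjp_def is_adjoint_def intro!: exI[of _ 1])
  have YY: "hlim (\<lambda>k. Y k (Y k x)) (Z (Z x))" for x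
  proof (rule hlim_sandwich)
    show "nm (Y k (Y k x) - Z (Z x)) \<le> nm (Y k x - Z x) + nm (Y k (Z x) - Z (Z x))" for k
    proof -
      have "nm (Y k (Y k x) - Y k (Z x)) \<le> 1 * nm (Y k x - Z x)"
        unfolding adjp_diff[OF YA, symmetric]
        using Yb[of k "Y k x - Z x"] y01[of k] mult_right_mono[of "y k" 1 "nm (Y k x - Z x)"] by auto
      then show ?thesis using nm_triangle_diff[of "Y k (Y k x)" "Z (Z x)" "Y k (Z x)"] by simp
    qed
    show "(\<lambda>k. nm (Y k x - Z x) + nm (Y k (Z x) - Z (Z x))) \<longlonglongrightarrow> 0"
      using tendsto_add[OF Z[of x, unfolded hlim_def] Z[of "Z x", unfolded hlim_def]] by simp
  qed
  \<comment> \<open>The fixed point equation \<open>2 Z = X + Z Z\<close> says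
    \<open>(1 - Z) (1 - Z) = 1 - X = B B\<close>, so \<open>1 - Z\<close> is a square root of
    \<open>B B\<close>; it is positive because \<open>Z\<close> is a contraction.\<close>
  have fp: "Z x = sc (1/2) (X x + Z (Z x))" for x
  proof (rule hlim_unique[OF hlim_Suc[OF Z]])
    show "hlim (\<lambda>k. Y (Suc k) x) (sc (1/2) (X x + Z (Z x)))"
      unfolding YS by (intro hlim_sc hlim_add hlim_const YY)
  qed
  define S where "S x = x - Z x" for x
  have SA: "adjp S S" using adjp_minus[OF adjp_id ZA] by (simp add: S_def[abs_def])
  have "S (S x) = B (B x)" for x
  proof -
    have "sc 2 (Z x) = X x + Z (Z x)" by (subst fp) (simp)
    moreover have "sc 2 (Z x) = Z x + Z x" using scale_left_distrib[of 1 1 "Z x"] by simp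
    ultimately show ?thesis by (simp add: S_def adjp_diff[OF ZA] X_def algebra_simps)
  qed
  moreover have "0 \<le> Re (ip (S x) x)" for x
  proof -
    have "Re (ip (Z x) x) \<le> nm x * nm x"
      using Re_ip_le[of "Z x" x] mult_right_mono[OF Z1[of x], of "nm x"] by simp
    then show ?thesis by (simp add: S_def ip_diff_left nm_sq[symmetric] power2_eq_square)
  qed
  moreover have "D (S x) = S (D x)" if D: "adjp D D'" and c: "\<And>x. D (B x) = B (D x)" for D D' x
  proof -
    have "D (Y k x) = Y k (D x)" for k x
    proof (induction k arbitrary: x)
      case 0
      show ?case by (simp add: Y0 adjp_zero[OF D])
    next
      case (Suc k)
      then show ?case by (simp add: YS X_def adjp_sc[OF D] adjp_add[OF D] adjp_diff[OF D] c)
    qed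
    then have "D (Z x) = Z (D x)"
      using adjp_hlim[OF D Z[of x]] Z[of "D x"] hlim_unique by simp
    then show ?thesis by (simp add: S_def adjp_diff[OF D])
  qed
  moreover have "S x \<in> K" if K: "csub K" and inv: "\<And>x. x \<in> K \<Longrightarrow> B x \<in> K" and x: "x \<in> K" for K x
  proof -
    have "Y k x \<in> K" if "x \<in> K" for k x
      using that
    proof (induction k arbitrary: x)
      case (Suc k)
      then show ?case unfolding YS X_def by (intro csub_sc csub_add csub_diff K inv Suc)
    qed (simp add: Y0 csub_0[OF K])
    then have "Z x \<in> K" using csub_lim[OF K _ Z[of x]] x by blast
    then show ?thesis unfolding S_def by (intro csub_diff K x)
  qed
  ultimately show ?thesis using SA by blast
qed

section \<open>Spectral subspaces of normal operators\<close>

definition nrm :: "('h \<Rightarrow> 'h) \<Rightarrow> ('h \<Rightarrow> 'h) \<Rightarrow> bool" where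
  "nrm A S \<longleftrightarrow> adjp A S \<and> (\<forall>x. A (S x) = S (A x))"

lemma nrm_adjp: "nrm A S \<Longrightarrow> adjp A S" and nrm_commute: "nrm A S \<Longrightarrow> A (S x) = S (A x)"
  by (auto simp: nrm_def)

lemma nrm_nm: "nrm A S \<Longrightarrow> nm (S x) = nm (A x)"
proof -
  assume a: "nrm A S"
  have "ip (S x) (S x) = ip (A x) (A x)"
    by (metis adjp_ip adjp_sym nrm_adjp[OF a] nrm_commute[OF a])
  then show ?thesis by (simp add: hnorm_def)
qed

lemma funpow_commute:
  assumes "\<And>x. D (A x) = A (D x)"
  shows "D ((A ^^ k) x) = (A ^^ k) (D x)"
  by (induction k arbitrary: x) (auto simp: assms)

lemma nrm_funpow: "nrm A S \<Longrightarrow> nrm (A ^^ k) (S ^^ k)"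
proof -
  assume a: "nrm A S"
  have "A ((S ^^ k) x) = (S ^^ k) (A x)" for x
    by (rule funpow_commute) (rule nrm_commute[OF a])
  then have "(S ^^ k) ((A ^^ k) x) = (A ^^ k) ((S ^^ k) x)" for x
    by (intro funpow_commute) simp
  then show ?thesis using adjp_funpow[OF nrm_adjp[OF a]] by (simp add: nrm_def)
qed

definition disc_space :: "('h \<Rightarrow> 'h) \<Rightarrow> real \<Rightarrow> 'h set" where
  "disc_space A r = {x. \<forall>k. nm ((A ^^ k) x) \<le> r ^ k * nm x}"

text \<open>A bound \<open>c r\<^sup>k\<close> improves itself to \<open>r\<^sup>k \<parallel>x\<parallel>\<close> because
  \<open>\<parallel>A\<^sup>k x\<parallel>\<^sup>2 \<le> \<parallel>A\<^sup>2\<^sup>k x\<parallel> \<parallel>x\<parallel>\<close> for normal \<open>A\<close>.\<close>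

lemma disc_spaceI:
  assumes A: "nrm A S" and r: "r > 0" and c: "\<And>k. nm ((A ^^ k) x) \<le> c * r ^ k"
  shows "x \<in> disc_space A r"
proof -
  define a where "a k = nm ((A ^^ k) x) / r ^ k" for k
  have a0: "a k \<ge> 0" for k using r by (simp add: a_def)
  have bdd: "bdd_above (range a)"
    using c r by (intro bdd_aboveI[of _ c]) (auto simp: a_def divide_le_eq)
  \<comment> \<open>The crude constant \<open>c\<close> is used only to make this supremum finite;
    afterwards \<open>(a k)^2 \<le> s * nm x\<close> for all \<open>k\<close> gives
    \<open>s^2 \<le> s * nm x\<close>.\<close>
  define s where "s = (SUP k. a k)"
  have as: "a k \<le> s" for k unfolding s_def by (rule cSUP_upper[OF _ bdd]) simp
  have s0: "s \<ge> 0" using a0[of 0] as[of 0] by linarith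
  have "(a k)\<^sup>2 \<le> s * nm x" for k
  proof -
    have nk: "nrm (A ^^ k) (S ^^ k)" by (rule nrm_funpow[OF A])
    have "(nm ((A ^^ k) x))\<^sup>2 = Re (ip x ((S ^^ k) ((A ^^ k) x)))"
      by (simp add: nm_sq adjp_ip[OF nrm_adjp[OF nk]])
    also have "\<dots> \<le> nm x * nm ((S ^^ k) ((A ^^ k) x))" by (rule Re_ip_le)
    also have "nm ((S ^^ k) ((A ^^ k) x)) = nm ((A ^^ (k + k)) x)"
      by (simp add: nrm_nm[OF nk] funpow_add)
    finally have "(a k)\<^sup>2 \<le> nm x * nm ((A ^^ (k + k)) x) / (r ^ k)\<^sup>2"
      using r by (simp add: a_def power_divide divide_right_mono)
    also have "\<dots> = nm x * a (k + k)" by (simp add: a_def power_add power2_eq_square)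
    also have "\<dots> \<le> nm x * s" by (intro mult_left_mono as) simp
    finally show ?thesis by (simp add: mult.commute)
  qed
  then have "a k \<le> sqrt (s * nm x)" for k by (rule real_le_rsqrt)
  then have "s \<le> sqrt (s * nm x)" unfolding s_def by (intro cSUP_least) auto
  then have "s\<^sup>2 \<le> s * nm x" using s0 by (metis abs_of_nonneg mult_nonneg_nonneg nm_nonneg real_sqrt_abs real_sqrt_le_iff)
  then have "s \<le> nm x" using s0 by (cases "s = 0") (auto simp: power2_eq_square)
  then have "a k \<le> nm x" for k using as[of k] by linarith
  then show ?thesis using r by (auto simp: disc_space_def a_def divide_le_eq mult.commute)
qed

lemma disc_space_bound: "x \<in> disc_space A r \<Longrightarrow> nm (A x) \<le> r * nm x"
  unfolding disc_space_def using funpow_0 by (auto dest: spec[of _ 1])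

text \<open>Sums are the delicate point: the triangle inequality only yields the constant
  \<open>nm x + nm y\<close>, which \<open>disc_spaceI\<close> sharpens to
  \<open>nm (x + y)\<close>.\<close>

lemma csub_disc_space:
  assumes A: "nrm A S" and r: "r > 0"
  shows "csub (disc_space A r)"
  unfolding csub_def
proof (intro conjI ballI allI impI)
  have Ak: "adjp (A ^^ k) (S ^^ k)" for k by (intro adjp_funpow nrm_adjp A)
  show "0 \<in> disc_space A r" by (simp add: disc_space_def adjp_zero[OF Ak])
  show "x + y \<in> disc_space A r" if "x \<in> disc_space A r" "y \<in> disc_space A r" for x y
  proof (rule disc_spaceI[OF A r])
    fix k
    have "nm ((A ^^ k) (x + y)) \<le> nm ((A ^^ k) x) + nm ((A ^^ k) y)"
      by (simp add: adjp_add[OF Ak] nm_triangle)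
    also have "\<dots> \<le> r ^ k * nm x + r ^ k * nm y"
      using that by (intro add_mono) (auto simp: disc_space_def)
    finally show "nm ((A ^^ k) (x + y)) \<le> (nm x + nm y) * r ^ k" by (simp add: algebra_simps)
  qed
  show "sc a x \<in> disc_space A r" if "x \<in> disc_space A r" for a x
    using that mult_left_mono[of _ _ "cmod a"]
    by (auto simp: disc_space_def adjp_sc[OF Ak] nm_sc mult.left_commute)
  show "L \<in> disc_space A r" if X: "\<forall>k. X k \<in> disc_space A r" "hlim X L" for X L
    unfolding disc_space_def
  proof (intro CollectI allI)
    fix k
    show "nm ((A ^^ k) L) \<le> r ^ k * nm L"
    proof (rule LIMSEQ_le)
      show "(\<lambda>i. nm ((A ^^ k) (X i))) \<longlonglongrightarrow> nm ((A ^^ k) L)" by (intro hlim_nm adjp_hlim[OF Ak] X)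
      show "(\<lambda>i. r ^ k * nm (X i)) \<longlonglongrightarrow> r ^ k * nm L" by (intro tendsto_intros hlim_nm X)
    qed (use X in \<open>auto simp: disc_space_def\<close>)
  qed
qed

text \<open>A commuting operator worsens the growth bound by a constant factor, and
  \<open>disc_spaceI\<close> absorbs constants.\<close>

lemma disc_space_invariant:
  assumes A: "nrm A S" and r: "r > 0" and D: "adjp D D'" "\<And>x. D (A x) = A (D x)" and x: "x \<in> disc_space A r"
  shows "D x \<in> disc_space A r"
proof -
  obtain c where c: "c \<ge> 0" "\<And>x. nm (D x) \<le> c * nm x" using D(1) by (rule adjp_bound) blast
  show ?thesis
  proof (rule disc_spaceI[OF A r])
    fix k
    have "nm ((A ^^ k) (D x)) \<le> c * nm ((A ^^ k) x)"
      using c(2)[of "(A ^^ k) x"] by (simp add: funpow_commute[of D A, OF D(2)])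
    also have "\<dots> \<le> c * (r ^ k * nm x)" using x c(1) by (intro mult_left_mono) (auto simp: disc_space_def)
    finally show "nm ((A ^^ k) (D x)) \<le> c * nm x * r ^ k" by (simp add: mult_ac)
  qed
qed

lemma nrm_sym: "nrm A S \<Longrightarrow> nrm S A"
  by (simp add: nrm_def adjp_sym)

lemma disc_space_adjoint: "nrm A S \<Longrightarrow> disc_space S r = disc_space A r"
  by (simp add: disc_space_def nrm_nm[OF nrm_funpow])

lemma adjoint_commute:
  assumes D: "adjp D D'" and A: "adjp A S" and c: "\<And>x. D (A x) = A (D x)"
  shows "D' (S x) = S (D' x)"
proof -
  have "ip y (D' (S x) - S (D' x)) = 0" for y
    using c[of y] by (simp add: ip_diff_right adjp_ip[OF D, symmetric] adjp_ip[OF A, symmetric])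
  from ip_self_eq_0D[OF this] show ?thesis by simp
qed

text \<open>Since \<open>A\<close> and \<open>A\<^sup>*\<close> have the same disc spaces, these reduce every operator commuting with \<open>A\<close>.
  This takes the place of Fuglede's theorem.\<close>

lemma disc_space_invariant_adjoint:
  assumes A: "nrm A S" and r: "r > 0" and D: "adjp D D'" "\<And>x. D (A x) = A (D x)" and x: "x \<in> disc_space A r"
  shows "D' x \<in> disc_space A r"
  using disc_space_invariant[OF nrm_sym[OF A] r adjp_sym[OF D(1)], of x]
    adjoint_commute[OF D(1) nrm_adjp[OF A] D(2)] x
  by (simp add: disc_space_adjoint[OF A])

lemma proj_disc_space_commute:
  assumes A: "nrm A S" and r: "r > 0" and D: "adjp D D'" "\<And>x. D (A x) = A (D x)"
  shows "proj (disc_space A r) (D x) = D (proj (disc_space A r) x)"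
  by (rule proj_commute[OF csub_disc_space[OF A r] D(1)])
    (auto intro: disc_space_invariant[OF A r D] disc_space_invariant_adjoint[OF A r D])

text \<open>The vector is \<open>y = (\<bar>B\<bar> + B) x\<close> for \<open>B\<close> a positive multiple of \<open>r\<^sup>2 - A\<^sup>* A\<close>:
  then \<open>B = \<bar>B\<bar> \<ge> 0\<close> on all \<open>A\<^sup>k y\<close>.\<close>

lemma disc_space_nontrivial:
  assumes A: "nrm A S" and r: "r > 0" and K: "csub K"
    and inv: "\<And>x. x \<in> K \<Longrightarrow> A x \<in> K" "\<And>x. x \<in> K \<Longrightarrow> S x \<in> K"
    and x: "x \<in> K" "nm (A x) < r * nm x"
  shows "\<exists>y\<in>K. y \<in> disc_space A r \<and> y \<noteq> 0"
proof -
  note AS = nrm_adjp[OF A]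
  obtain c where c: "c \<ge> 0" "\<And>x. nm (A x) \<le> c * nm x" using AS by (rule adjp_bound) blast
  \<comment> \<open>\<open>r^2 + c^2\<close> bounds the norm of \<open>r^2 - S A\<close>, so this
    factor makes \<open>B\<close> a contraction, as \<open>operator_abs_exists\<close>
    demands.\<close>
  define \<kappa> where "\<kappa> = 1 / (r\<^sup>2 + c\<^sup>2)"
  have k0: "\<kappa> > 0" using r by (simp add: \<kappa>_def add_pos_nonneg)
  define B where "B x = sc (of_real \<kappa>) (sc (of_real (r\<^sup>2)) x - S (A x))" for x
  have "adjp (\<lambda>x. sc (of_real \<kappa>) (sc (of_real (r\<^sup>2)) x - S (A x)))
     (\<lambda>x. sc (cnj (of_real \<kappa>)) (sc (cnj (of_real (r\<^sup>2))) x - S (A x)))"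
    by (rule adjp_scaled[OF adjp_minus[OF adjp_scaled[OF adjp_id] adjp_comp[OF adjp_sym[OF AS] AS]]])
  then have BA: "adjp B B" by (simp add: B_def[abs_def])
  have B1: "nm (B x) \<le> nm x" for x
  proof -
    have "nm (sc (of_real (r\<^sup>2)) x - S (A x)) \<le> r\<^sup>2 * nm x + nm (A (A x))"
      using nm_diff_le[of "sc (of_real (r\<^sup>2)) x" "S (A x)"] by (simp add: nm_sc nrm_nm[OF A] norm_power)
    also have "nm (A (A x)) \<le> c\<^sup>2 * nm x"
      using c(2)[of "A x"] mult_left_mono[OF c(2)[of x] c(1)] by (simp add: power2_eq_square mult.assoc)
    finally have "nm (B x) \<le> \<kappa> * ((r\<^sup>2 + c\<^sup>2) * nm x)"
      unfolding B_def nm_sc using k0 by (simp add: distrib_right)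
    then show ?thesis using r by (simp add: \<kappa>_def add_pos_nonneg less_imp_neq[THEN not_sym])
  qed
  have ipB: "Re (ip (B z) z) = \<kappa> * (r\<^sup>2 * (nm z)\<^sup>2 - (nm (A z))\<^sup>2)" for z
  proof -
    have "ip (S (A z)) z = ip (A z) (A z)" by (simp add: adjp_ip[OF adjp_sym[OF AS]])
    then show ?thesis by (simp add: B_def ip_sc_left ip_diff_left nm_sq)
  qed
  obtain P where P: "adjp P P" "\<And>x. P (P x) = B (B x)" "\<And>x. 0 \<le> Re (ip (P x) x)"
    "\<And>D D' x. adjp D D' \<Longrightarrow> (\<And>x. D (B x) = B (D x)) \<Longrightarrow> D (P x) = P (D x)"
    "\<And>K x. csub K \<Longrightarrow> (\<And>x. x \<in> K \<Longrightarrow> B x \<in> K) \<Longrightarrow> x \<in> K \<Longrightarrow> P x \<in> K"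
    using operator_abs_exists[OF BA B1] by metis
  have PB: "B (P z) = P (B z)" for z by (rule P(4)[OF BA refl])
  have BK: "B z \<in> K" if "z \<in> K" for z
    unfolding B_def by (intro csub_sc csub_diff K inv that)
  define y where "y = P x + B x"
  have yK: "y \<in> K" unfolding y_def by (intro csub_add K BK P(5) x)
  \<comment> \<open>The strict inequality for \<open>x\<close> makes \<open>Re (ip (B x) x)\<close>
    positive, and the positive operator \<open>P\<close> can only add to it.\<close>
  have y0: "y \<noteq> 0"
  proof
    assume "y = 0"
    then have "Re (ip (P x + B x) x) = 0" by (simp add: y_def)
    then have "Re (ip (P x) x) + Re (ip (B x) x) = 0" by (simp only: ip_add_left plus_complex.simps)
    moreover have "(nm (A x))\<^sup>2 < (r * nm x)\<^sup>2" using x(2) by (intro power_strict_mono) auto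
    then have "Re (ip (B x) x) > 0" using k0 by (simp add: ipB power_mult_distrib)
    ultimately show False using P(3)[of x] by linarith
  qed
  have "B y = P y" by (simp add: y_def adjp_add[OF BA] adjp_add[OF P(1)] P(2) PB add.commute)
  have AB: "A (B z) = B (A z)" for z
    by (simp add: B_def adjp_sc[OF AS] adjp_diff[OF AS] nrm_commute[OF A])
  have step: "nm (A z) \<le> r * nm z" if "B z = P z" for z
  proof -
    have "0 \<le> \<kappa> * (r\<^sup>2 * (nm z)\<^sup>2 - (nm (A z))\<^sup>2)" using P(3)[of z] that ipB[of z] by simp
    then have "(nm (A z))\<^sup>2 \<le> (r * nm z)\<^sup>2" using k0 by (simp add: zero_le_mult_iff power_mult_distrib)
    then show ?thesis by (rule power2_le_imp_le) (use r in simp)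
  qed
  have BP: "B ((A ^^ k) y) = P ((A ^^ k) y)" for k
  proof (induction k)
    case (Suc k)
    then show ?case using AB[of "(A ^^ k) y"] P(4)[OF AS AB, of "(A ^^ k) y"] by simp
  qed (simp add: \<open>B y = P y\<close>)
  have "nm ((A ^^ k) y) \<le> r ^ k * nm y" for k
  proof (induction k)
    case (Suc k)
    have "nm ((A ^^ Suc k) y) \<le> r * nm ((A ^^ k) y)" using step[OF BP] by simp
    also have "\<dots> \<le> r * (r ^ k * nm y)" using Suc r by (intro mult_left_mono) auto
    finally show ?case by (simp add: mult.assoc)
  qed simp
  then show ?thesis using yK y0 by (auto simp: disc_space_def)
qed

text \<open>For \<open>a\<close> the norm of \<open>A\<close> on \<open>K\<close>, a unit vector
  nearly attaining it is almost an eigenvector of \<open>A A\<close> for \<open>a^2\<close>. As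
  \<open>A A - a^2 = (A - a) (A + a)\<close>, either \<open>y = (A + a) x\<close> is small and
  \<open>x\<close> serves for \<open>- a\<close>, or \<open>y\<close> itself serves for
  \<open>a\<close>.\<close>

lemma approx_eigenvalue_selfadjoint:
  assumes A: "adjp A A" and A1: "\<And>x. nm (A x) \<le> nm x"
    and K: "csub K" "\<And>x. x \<in> K \<Longrightarrow> A x \<in> K" and x0: "x0 \<in> K" "x0 \<noteq> 0" and e: "e > 0"
  shows "\<exists>\<alpha>::real. \<exists>x\<in>K. x \<noteq> 0 \<and> nm (A x - sc (of_real \<alpha>) x) < e * nm x"
proof -
  define U where "U = {x \<in> K. nm x = 1}"
  define a where "a = (SUP x\<in>U. nm (A x))"
  have "sc (of_real (1 / nm x0)) x0 \<in> U"
    unfolding U_def using x0 by (auto simp: nm_sc norm_divide intro!: csub_sc K)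
  then have ne: "U \<noteq> {}" by blast
  have U1: "nm (A x) \<le> 1" if "x \<in> U" for x using A1[of x] that by (simp add: U_def)
  then have bdd: "bdd_above ((\<lambda>x. nm (A x)) ` U)" by (intro bdd_aboveI[of _ 1]) auto
  have aU: "nm (A x) \<le> a" if "x \<in> U" for x unfolding a_def by (rule cSUP_upper[OF that bdd])
  have a0: "a \<ge> 0" using ne aU nm_nonneg order_trans by blast
  have a1: "a \<le> 1" unfolding a_def by (intro cSUP_least ne U1)
  have aK: "nm (A x) \<le> a * nm x" if x: "x \<in> K" for x
  proof (cases "x = 0")
    case False
    then have "sc (of_real (1 / nm x)) x \<in> U"
      unfolding U_def using x by (auto simp: nm_sc norm_divide intro!: csub_sc K)
    from aU[OF this] False show ?thesis by (simp add: adjp_sc[OF A] nm_sc norm_divide divide_le_eq)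
  qed (simp add: adjp_zero[OF A])
  \<comment> \<open>The fourth power is needed because the squared error of
    \<open>A A x - a^2 x\<close> has to be below \<open>(e * e)^2\<close>: one \<open>e\<close> is
    the final precision, the other the lower bound for \<open>nm y\<close>. The case distinction
    only keeps the square root meaningful.\<close>
  obtain x where x: "x \<in> U" "a\<^sup>2 - (nm (A x))\<^sup>2 < e ^ 4"
  proof (cases "a\<^sup>2 < e ^ 4")
    case True
    obtain x where "x \<in> U" using ne by blast
    moreover have "a\<^sup>2 - (nm (A x))\<^sup>2 < e ^ 4" using True zero_le_power2[of "nm (A x)"] by linarith
    ultimately show thesis using that by blast
  next
    case False
    have "sqrt (a\<^sup>2 - e ^ 4) < a"
      using a0 e False by (intro real_less_lsqrt) auto
    then obtain x where x: "x \<in> U" "sqrt (a\<^sup>2 - e ^ 4) < nm (A x)"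
      unfolding a_def using less_cSUP_iff[OF ne bdd] by blast
    then have "a\<^sup>2 - e ^ 4 < (nm (A x))\<^sup>2" by (metis not_le nm_nonneg real_le_lsqrt real_le_rsqrt)
    with x(1) show thesis by (intro that[of x]) auto
  qed
  have xK: "x \<in> K" and x1: "nm x = 1" using x by (auto simp: U_def)
  have "(nm (A (A x) - sc (of_real (a\<^sup>2)) x))\<^sup>2 = (nm (A (A x)))\<^sup>2 + (a\<^sup>2)\<^sup>2 - 2 * (a\<^sup>2 * (nm (A x))\<^sup>2)"
  proof -
    have "ip (A (A x)) x = of_real ((nm (A x))\<^sup>2)" by (simp add: adjp_ip[OF A] ip_self)
    then show ?thesis unfolding nm_diff_sq by (simp add: nm_sc x1 ip_sc_right norm_power flip: of_real_power of_real_mult)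
  qed
  also have "(nm (A (A x)))\<^sup>2 \<le> (a * nm (A x))\<^sup>2" by (intro power_mono aK K xK) simp
  also have "(a * nm (A x))\<^sup>2 + (a\<^sup>2)\<^sup>2 - 2 * (a\<^sup>2 * (nm (A x))\<^sup>2) = a\<^sup>2 * (a\<^sup>2 - (nm (A x))\<^sup>2)"
    by (simp add: power_mult_distrib power2_eq_square algebra_simps)
  also have "\<dots> < e ^ 4"
  proof -
    have "a\<^sup>2 \<le> 1" using a0 a1 by (simp add: power_le_one)
    moreover have "0 \<le> a\<^sup>2 - (nm (A x))\<^sup>2" using aU[OF x(1)] by (simp add: power_mono)
    ultimately have "a\<^sup>2 * (a\<^sup>2 - (nm (A x))\<^sup>2) \<le> a\<^sup>2 - (nm (A x))\<^sup>2" by (rule mult_left_le_one_le[rotated 2]) simp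
    then show ?thesis using x(2) by linarith
  qed
  finally have "(nm (A (A x) - sc (of_real (a\<^sup>2)) x))\<^sup>2 < (e\<^sup>2)\<^sup>2" by simp
  then have small: "nm (A (A x) - sc (of_real (a\<^sup>2)) x) < e\<^sup>2" by (rule power2_less_imp_less) simp
  define y where "y = A x + sc (of_real a) x"
  show ?thesis
  proof (cases "nm y < e")
    case True
    then have "nm (A x - sc (of_real (- a)) x) < e * nm x" by (simp add: y_def x1)
    moreover have "x \<noteq> 0" using x1 by auto
    ultimately show ?thesis using xK by blast
  next
    case False
    have "A y - sc (of_real a) y = A (A x) - sc (of_real (a\<^sup>2)) x"
      by (simp add: y_def adjp_add[OF A] adjp_sc[OF A] scale_right_distrib power2_eq_square)
    then have "nm (A y - sc (of_real a) y) < e * e" using small by (simp add: power2_eq_square)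
    also have "\<dots> \<le> e * nm y" using False e by (intro mult_left_mono) auto
    finally have "nm (A y - sc (of_real a) y) < e * nm y" .
    moreover have "y \<in> K" unfolding y_def by (intro csub_add csub_sc K xK)
    moreover have "y \<noteq> 0" using False e by auto
    ultimately show ?thesis by blast
  qed
qed

section \<open>Approximate eigenvectors of normal operators and totality of the disc spaces\<close>

definition shift :: "('h \<Rightarrow> 'h) \<Rightarrow> complex \<Rightarrow> 'h \<Rightarrow> 'h" where
  "shift A l x = A x - sc l x"

lemma nrm_shift: "nrm A S \<Longrightarrow> nrm (shift A l) (shift S (cnj l))"
proof -
  assume A: "nrm A S"
  have "adjp (\<lambda>x. A x - sc l x) (\<lambda>x. S x - sc (cnj l) x)"
    by (rule adjp_minus[OF nrm_adjp[OF A] adjp_scaled[OF adjp_id]])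
  moreover note AS = nrm_adjp[OF A]
  ultimately show ?thesis using nrm_commute[OF A]
    by (auto simp: nrm_def shift_def[abs_def] adjp_diff[OF AS] adjp_sc[OF AS] adjp_diff[OF adjp_sym[OF AS]]
        adjp_sc[OF adjp_sym[OF AS]] scale_right_diff_distrib mult.commute)
qed

lemma commute_shift:
  assumes "adjp D D'" "\<And>x. D (A x) = A (D x)"
  shows "D (shift A l x) = shift A l (D x)"
  by (simp add: shift_def adjp_diff[OF assms(1)] adjp_sc[OF assms(1)] assms(2))

text \<open>\<open>N = A + i B\<close> with commuting self-adjoint \<open>A\<close> and
  \<open>B\<close>. A single approximate eigenvector of \<open>A\<close> says nothing about
  \<open>B\<close>, so it is replaced by the whole space \<open>K1\<close> of vectors on which
  \<open>A - \<alpha>\<close> is small. \<open>B\<close> preserves this space, and an approximate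
  eigenvector of \<open>B\<close> inside it works for both parts.\<close>

lemma approx_eigenvalue_normal:
  assumes N: "nrm N S" and N1: "\<And>x. nm (N x) \<le> nm x" and K: "csub K"
    and inv: "\<And>x. x \<in> K \<Longrightarrow> N x \<in> K" "\<And>x. x \<in> K \<Longrightarrow> S x \<in> K"
    and x0: "x0 \<in> K" "x0 \<noteq> 0" and e: "e > 0"
  shows "\<exists>l. \<exists>x\<in>K. x \<noteq> 0 \<and> nm (shift N l x) < e * nm x"
proof -
  note NS = nrm_adjp[OF N] and SN = adjp_sym[OF nrm_adjp[OF N]]
  define A where "A x = sc (1/2) (N x + S x)" for x
  define B where "B x = sc (- \<i>/2) (N x - S x)" for x
  have AA: "adjp A A"
    using adjp_scaled[OF adjp_plus[OF NS SN], of "1/2"] by (simp add: A_def[abs_def] add.commute)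
  have BB: "adjp B B"
  proof -
    have "sc (\<i>/2) (S x - N x) = sc (- \<i>/2) (N x - S x)" for x
      by (metis (no_types) minus_diff_eq minus_divide_left scale_minus_left scale_minus_right)
    then show ?thesis using adjp_scaled[OF adjp_minus[OF NS SN], of "- \<i>/2"] by (simp add: B_def[abs_def])
  qed
  have A1: "nm (A x) \<le> nm x" for x
    using nm_triangle[of "N x" "S x"] N1[of x] by (simp add: A_def nm_sc nrm_nm[OF N])
  have B1: "nm (B x) \<le> nm x" for x
    using nm_diff_le[of "N x" "S x"] N1[of x] by (simp add: B_def nm_sc nrm_nm[OF N] norm_mult)
  have AN: "N (A x) = A (N x)" and AS: "S (A x) = A (S x)" for x
    by (simp_all add: A_def adjp_sc[OF NS] adjp_add[OF NS] adjp_sc[OF SN] adjp_add[OF SN] nrm_commute[OF N])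
  have AK: "x \<in> K \<Longrightarrow> A x \<in> K" for x unfolding A_def by (intro csub_sc csub_add K inv)
  obtain \<alpha> :: real and x1 where x1: "x1 \<in> K" "x1 \<noteq> 0" "nm (shift A (of_real \<alpha>) x1) < e/2 * nm x1"
    using approx_eigenvalue_selfadjoint[OF AA A1 K AK x0, of "e/2"] e unfolding shift_def by auto
  define A' where "A' = shift A (of_real \<alpha>)"
  have A'n: "nrm A' A'"
    using nrm_shift[of A A "of_real \<alpha>"] AA unfolding A'_def by (simp add: nrm_def)
  define K1 where "K1 = K \<inter> disc_space A' (e/2)"
  have "\<exists>y\<in>K. y \<in> disc_space A' (e/2) \<and> y \<noteq> 0"
  proof (rule disc_space_nontrivial[OF A'n _ K _ _ x1(1)])
    show "A' x \<in> K" if "x \<in> K" for x unfolding A'_def shift_def by (intro csub_diff csub_sc K AK that)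
    then show "A' x \<in> K" if "x \<in> K" for x using that .
  qed (use e x1 in \<open>auto simp: A'_def\<close>)
  then obtain x2 where x2: "x2 \<in> K1" "x2 \<noteq> 0" unfolding K1_def by blast
  have e2: "e/2 > 0" using e by simp
  have K1: "csub K1" unfolding K1_def by (intro csub_Int K csub_disc_space[OF A'n e2])
  have "N x \<in> K1 \<and> S x \<in> K1" if "x \<in> K1" for x
    unfolding K1_def A'_def using that inv
      disc_space_invariant[OF A'n e2 NS, of x] disc_space_invariant[OF A'n e2 SN, of x]
      commute_shift[of N S A, OF NS AN] commute_shift[of S N A, OF SN AS] unfolding K1_def A'_def by blast
  then have BK1: "x \<in> K1 \<Longrightarrow> B x \<in> K1" for x
    unfolding B_def by (intro csub_sc csub_diff K1) auto
  obtain \<beta> :: real and x where x: "x \<in> K1" "x \<noteq> 0" "nm (B x - sc (of_real \<beta>) x) < e/2 * nm x"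
    using approx_eigenvalue_selfadjoint[OF BB B1 K1 BK1 x2 e2] by auto
  have "N x = A x + sc \<i> (B x)"
  proof -
    have "A x + sc \<i> (B x) = sc (1/2) (N x + S x) + sc (1/2) (N x - S x)"
      by (simp add: A_def B_def)
    also have "\<dots> = sc (1/2 + 1/2) (N x)"
      unfolding scale_left_distrib by (simp add: scale_right_distrib scale_right_diff_distrib)
    finally show ?thesis by simp
  qed
  then have "shift N (of_real \<alpha> + \<i> * of_real \<beta>) x = A' x + sc \<i> (B x - sc (of_real \<beta>) x)"
    by (simp add: shift_def A'_def scale_left_distrib scale_right_diff_distrib)
  then have "nm (shift N (of_real \<alpha> + \<i> * of_real \<beta>) x) \<le> nm (A' x) + nm (B x - sc (of_real \<beta>) x)"
    using nm_triangle[of "A' x" "sc \<i> (B x - sc (of_real \<beta>) x)"] by (simp add: nm_sc)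
  also have "nm (A' x) \<le> e/2 * nm x" using x(1) disc_space_bound[of x A' "e/2"] by (simp add: K1_def)
  finally have "nm (shift N (of_real \<alpha> + \<i> * of_real \<beta>) x) < e * nm x" using x(3) by (simp add: field_simps)
  then show ?thesis using x unfolding K1_def by blast
qed

text \<open>The orthogonal complement of the disc spaces is invariant under \<open>N\<close> and
  \<open>S\<close>. Were it nonzero, it would contain an approximate eigenvector, and by
  \<open>disc_space_nontrivial\<close> a nonzero vector of one of the disc spaces, orthogonal to
  itself.\<close>

lemma disc_spaces_total:
  assumes N: "nrm N S" and N1: "\<And>x. nm (N x) \<le> nm x" and e: "0 < e" "e \<le> 1"
    and net: "\<And>l. cmod l \<le> 2 \<Longrightarrow> \<exists>l'\<in>L. cmod (l - l') < e/2"
    and x: "\<And>l y. l \<in> L \<Longrightarrow> y \<in> disc_space (shift N l) e \<Longrightarrow> ip x y = 0"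
  shows "x = 0"
proof (rule ccontr)
  assume x0: "x \<noteq> 0"
  note NS = nrm_adjp[OF N] and SN = adjp_sym[OF nrm_adjp[OF N]]
  define K where "K = {x. \<forall>y\<in>(\<Union>l\<in>L. disc_space (shift N l) e). ip x y = 0}"
  have K: "csub K" unfolding K_def by (rule csub_orthogonal)
  have xK: "x \<in> K" using x by (auto simp: K_def)
  have inv: "N z \<in> K" "S z \<in> K" if z: "z \<in> K" for z
  proof -
    have "S y \<in> disc_space (shift N l) e \<and> N y \<in> disc_space (shift N l) e" if "y \<in> disc_space (shift N l) e" for y l
      using disc_space_invariant[OF nrm_shift[OF N] e(1) NS commute_shift[of N S N, OF NS refl] that]
        disc_space_invariant_adjoint[OF nrm_shift[OF N] e(1) NS commute_shift[of N S N, OF NS refl] that] by blast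
    then show "N z \<in> K" "S z \<in> K" using z unfolding K_def by (auto simp: adjp_ip[OF NS] adjp_ip[OF SN])
  qed
  obtain l z where z: "z \<in> K" "z \<noteq> 0" "nm (shift N l z) < e/2 * nm z"
    using approx_eigenvalue_normal[OF N N1 K inv xK x0, of "e/2"] e by auto
  \<comment> \<open>For a contraction an approximate eigenvalue with error at most 1 has modulus at
    most 2, which fixes the region the net covers. The error \<open>e\<close> is shared equally
    between the eigenvector and the move to a centre in \<open>L\<close>.\<close>
  have "cmod l * nm z \<le> nm (N z) + nm (shift N l z)"
    using nm_diff_le[of "N z" "shift N l z"] by (simp add: shift_def nm_sc)
  also have "\<dots> \<le> 2 * nm z" using N1[of z] z(3) mult_right_mono[of "e/2" 1 "nm z"] e by auto
  finally have "cmod l \<le> 2" using z(2) by simp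
  then obtain l' where l': "l' \<in> L" "cmod (l - l') < e/2" using net by blast
  have "shift N l' z = shift N l z + sc (l - l') z" by (simp add: shift_def scale_left_diff_distrib)
  then have "nm (shift N l' z) \<le> nm (shift N l z) + cmod (l - l') * nm z"
    using nm_triangle[of "shift N l z" "sc (l - l') z"] by (simp add: nm_sc)
  also have "\<dots> < e/2 * nm z + e/2 * nm z"
    using z l' by (intro add_strict_mono mult_strict_right_mono) auto
  finally have "nm (shift N l' z) < e * nm z" by (simp add: field_simps)
  then obtain y where y: "y \<in> K" "y \<in> disc_space (shift N l') e" "y \<noteq> 0"
    using disc_space_nontrivial[OF nrm_shift[OF N] e(1) K _ _ z(1)] inv
    unfolding shift_def by (metis K csub_diff csub_sc)
  then have "ip y y = 0" using l'(1) unfolding K_def by blast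
  then show False using ip_self_eq_0D y(3) by blast
qed

text \<open>Each step splits \<open>x\<close> orthogonally into its part in \<open>K\<close> and a
  remainder; \<open>D\<close> respects the splitting, so the squared norms add. The subspaces may
  overlap, since the next projection acts on the remainder only, and the fold being 0 says that
  nothing is left over.\<close>

lemma bound_by_pieces:
  assumes "\<And>K. K \<in> set Ks \<Longrightarrow> csub K" "\<And>K x. K \<in> set Ks \<Longrightarrow> proj K (D x) = D (proj K x)"
    "\<And>K x. K \<in> set Ks \<Longrightarrow> x \<in> K \<Longrightarrow> nm (D x) \<le> c * nm x"
    and D: "clinear_op sc D" and c: "c \<ge> 0" and "fold (\<lambda>K x. x - proj K x) Ks x = 0"
  shows "nm (D x) \<le> c * nm x"
  using assms(1-3,6)
proof (induction Ks arbitrary: x)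
  case Nil
  then show ?case by (simp add: clinear_zero[OF D])
next
  case (Cons K Ks)
  have K: "csub K" using Cons.prems by simp
  let ?p = "proj K x" and ?q = "x - proj K x"
  have 1: "nm (D ?p) \<le> c * nm ?p" using Cons.prems(3)[of K ?p] proj_in[OF K] by simp
  have 2: "nm (D ?q) \<le> c * nm ?q"
  proof (rule Cons.IH)
    show "csub J" if "J \<in> set Ks" for J using Cons.prems(1)[of J] that by simp
    show "proj J (D x) = D (proj J x)" if "J \<in> set Ks" for J x using Cons.prems(2)[of J x] that by simp
    show "nm (D x) \<le> c * nm x" if "J \<in> set Ks" "x \<in> J" for J x using Cons.prems(3)[of J x] that by simp
    show "fold (\<lambda>K x. x - proj K x) Ks ?q = 0" using Cons.prems(4) by simp
  qed
  have "ip ?q ?p = 0" by (rule proj_orthogonal[OF K proj_in[OF K]])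
  from nm_add_orthogonal[OF this] have n: "(nm x)\<^sup>2 = (nm ?q)\<^sup>2 + (nm ?p)\<^sup>2" by simp
  have "D ?q = D x - proj K (D x)" "D ?p = proj K (D x)" using Cons.prems(2)[of K x] by (auto simp: clinear_diff[OF D])
  then have "ip (D ?q) (D ?p) = 0" using proj_orthogonal[OF K proj_in[OF K]] by simp
  from nm_add_orthogonal[OF this] have "(nm (D x))\<^sup>2 = (nm (D ?q))\<^sup>2 + (nm (D ?p))\<^sup>2"
    by (simp add: clinear_diff[OF D])
  also have "\<dots> \<le> (c * nm ?q)\<^sup>2 + (c * nm ?p)\<^sup>2" by (intro add_mono power_mono 1 2) auto
  also have "\<dots> = (c * nm x)\<^sup>2" by (simp add: power_mult_distrib n distrib_left)
  finally show ?case by (rule power2_le_imp_le) (use c in simp)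
qed

text \<open>Since the projections commute, a component once removed is not brought back by later
  steps.\<close>

lemma fold_complement_proj_orthogonal:
  assumes "\<And>K. K \<in> set Ks \<Longrightarrow> csub K"
    "\<And>K K' x. K \<in> set Ks \<Longrightarrow> K' \<in> set Ks \<Longrightarrow> proj K (proj K' x) = proj K' (proj K x)"
    and "K \<in> set Ks" "y \<in> K"
  shows "ip (fold (\<lambda>K x. x - proj K x) Ks x) y = 0"
proof -
  have keep: "proj K (fold (\<lambda>K x. x - proj K x) Js x) = 0"
    if "set Js \<subseteq> set Ks" "proj K x = 0" "K \<in> set Ks" for Js x K
    using that
  proof (induction Js arbitrary: x)
    case (Cons J Js)
    have K: "csub K" and J: "csub J" using Cons.prems assms(1) by auto
    have "proj K (x - proj J x) = 0"
      using Cons.prems assms(2)[of K J x] by (simp add: clinear_diff[OF proj_linear[OF K]] clinear_zero[OF proj_linear[OF J]])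
    then show ?case using Cons by simp
  qed simp
  obtain Is Js where split: "Ks = Is @ K # Js" using assms(3) split_list by metis
  have K: "csub K" using assms by blast
  let ?z = "fold (\<lambda>K x. x - proj K x) Is x"
  have "proj K (?z - proj K ?z) = 0"
    by (simp add: clinear_diff[OF proj_linear[OF K]] proj_self[OF K proj_in[OF K]])
  then have "proj K (fold (\<lambda>K x. x - proj K x) Js (?z - proj K ?z)) = 0"
    by (intro keep) (auto simp: split)
  then have "proj K (fold (\<lambda>K x. x - proj K x) Ks x) = 0" by (simp add: split)
  then show ?thesis using proj_orthogonal[OF K assms(4)] by (metis diff_zero)
qed

text \<open>The commutator \<open>D\<close> of \<open>E\<close> and \<open>N\<close> is unchanged
  when \<open>N\<close> is replaced by \<open>N - l\<close>. On the disc space around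
  \<open>l\<close>, which \<open>E\<close> preserves, it is therefore bounded by twice the radius;
  small discs whose spaces exhaust everything make it arbitrarily small.\<close>

lemma commute_of_disc_projections:
  fixes Dn :: "complex set"
  assumes N: "nrm N S" and N1: "\<And>x. nm (N x) \<le> nm x" and dense: "closure Dn = UNIV"
    and E: "adjp E E'" "\<And>x. nm (E x) \<le> nm x"
    and comm: "\<And>l p x. l \<in> Dn \<Longrightarrow> E (proj (disc_space (shift N l) (1 / real (Suc p))) x) =
        proj (disc_space (shift N l) (1 / real (Suc p))) (E x)"
  shows "E (N x) = N (E x)"
proof -
  note NS = nrm_adjp[OF N]
  define D where "D x = E (N x) - N (E x)" for x
  have Dadj: "\<exists>D'. adjp D D'"
    using adjp_minus[OF adjp_comp[OF E(1) NS] adjp_comp[OF NS E(1)]] unfolding D_def[abs_def] by blast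
  have "nm (D x) \<le> 2 * (1 / real (Suc p)) * nm x" for p
  proof -
    define e where "e = 1 / real (Suc p)"
    have e: "0 < e" "e \<le> 1" by (auto simp: e_def)
    \<comment> \<open>Compactness selects finitely many centres, so that the pieces can be split off
      one after another along a list.\<close>
    have "cball (0::complex) 2 \<subseteq> (\<Union>l\<in>Dn. ball l (e/2))"
    proof
      fix z :: complex
      have "z \<in> closure Dn" using dense by simp
      then obtain l where "l \<in> Dn" "dist l z < e/2" using e(1) by (meson closure_approachable half_gt_zero)
      then show "z \<in> (\<Union>l\<in>Dn. ball l (e/2))" by auto
    qed
    then obtain L where L: "L \<subseteq> Dn" "finite L" "cball (0::complex) 2 \<subseteq> (\<Union>l\<in>L. ball l (e/2))"
      using compactE_image[OF compact_cball, of Dn "\<lambda>l. ball l (e/2)"] by (metis open_ball)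
    have net: "\<exists>l'\<in>L. cmod (l - l') < e/2" if "cmod l \<le> 2" for l
    proof -
      have "l \<in> cball 0 2" using that by simp
      then show ?thesis using L(3) by (force simp: dist_norm norm_minus_commute)
    qed
    obtain ls where ls: "set ls = L" using L(2) finite_list by blast
    define Ks where "Ks = map (\<lambda>l. disc_space (shift N l) e) ls"
    have Kc: "csub K" if "K \<in> set Ks" for K
      using that csub_disc_space[OF nrm_shift[OF N] e(1)] by (auto simp: Ks_def)
    have Nc: "proj K (N x) = N (proj K x)" if K: "K \<in> set Ks" for K x
    proof -
      obtain l where l: "K = disc_space (shift N l) e" using K by (auto simp: Ks_def)
      show ?thesis unfolding l
      proof (rule proj_disc_space_commute[OF nrm_shift[OF N] e(1) NS])
        show "N (shift N l z) = shift N l (N z)" for z by (rule commute_shift[OF NS]) (rule refl)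
      qed
    qed
    have Ec: "proj K (E x) = E (proj K x)" if "K \<in> set Ks" for K x
      using that comm L(1) by (auto simp: Ks_def ls e_def)
    show ?thesis unfolding e_def[symmetric]
    proof (rule bound_by_pieces[OF Kc])
      show "proj K (D x) = D (proj K x)" if K: "K \<in> set Ks" for K x
        by (simp add: D_def clinear_diff[OF proj_linear[OF Kc[OF K]]] Nc[OF K] Ec[OF K])
      show "nm (D y) \<le> 2 * e * nm y" if K: "K \<in> set Ks" and y: "y \<in> K" for K y
      proof -
        obtain l where l: "K = disc_space (shift N l) e" using K by (auto simp: Ks_def)
        have "E y = proj K (E y)" using Ec[OF K, of y] proj_self[OF Kc[OF K] y] by simp
        then have Ey: "E y \<in> K" using proj_in[OF Kc[OF K], of "E y"] by simp
        have "D y = E (shift N l y) - shift N l (E y)"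
          by (simp add: D_def shift_def adjp_diff[OF E(1)] adjp_sc[OF E(1)])
        then have "nm (D y) \<le> nm (E (shift N l y)) + nm (shift N l (E y))" using nm_diff_le by simp
        also have "nm (E (shift N l y)) \<le> e * nm y"
          using E(2)[of "shift N l y"] disc_space_bound[of y "shift N l" e] y l by simp
        also have "nm (shift N l (E y)) \<le> e * nm (E y)"
          using disc_space_bound[of "E y" "shift N l" e] Ey l by simp
        also have "e * nm (E y) \<le> e * nm y" using e E(2) by (intro mult_left_mono) auto
        finally show ?thesis by simp
      qed
      show "clinear_op sc D" using Dadj by (auto simp: adjp_def)
      show "fold (\<lambda>K x. x - proj K x) Ks x = 0"
      proof (rule disc_spaces_total[OF N N1 e net])
        fix l y assume l: "l \<in> L" and y: "y \<in> disc_space (shift N l) e"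
        show "ip (fold (\<lambda>K x. x - proj K x) Ks x) y = 0"
        proof (rule fold_complement_proj_orthogonal[OF Kc _ _ y])
          show "disc_space (shift N l) e \<in> set Ks" using l by (simp add: Ks_def ls)
          fix K K' x assume K: "K \<in> set Ks" and K': "K' \<in> set Ks"
          obtain l where l: "K' = disc_space (shift N l) e" using K' by (auto simp: Ks_def)
          have "proj K (shift N l x) = shift N l (proj K x)" for x
            by (rule commute_shift[OF adjp_proj[OF Kc[OF K]]]) (rule Nc[OF K])
          then show "proj K (proj K' x) = proj K' (proj K x)"
            unfolding l by (intro proj_disc_space_commute[OF nrm_shift[OF N] e(1) adjp_proj[OF Kc[OF K]], symmetric])
        qed
      qed
    qed (use e in auto)
  qed
  moreover have "(\<lambda>p. 2 * (1 / real (Suc p)) * nm x) \<longlonglongrightarrow> 2 * 0 * nm x"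
    by (intro tendsto_intros LIMSEQ_Suc[OF lim_1_over_n])
  ultimately have "nm (D x) \<le> 2 * 0 * nm x" by (meson LIMSEQ_le_const)
  then show ?thesis using nm_nonneg[of "D x"] nm_eq_0[of "D x"] unfolding D_def by simp
qed

end

section \<open>The measure attached to a family of commuting projections\<close>

text \<open>The disjoint union of the measures \<open>\<mu> v\<close>. Measurability is tested on
  every slice separately, so the index set can be uncountable; the integral over
  \<open>count_space S\<close> is the sum over \<open>S\<close> and gives slices outside
  \<open>S\<close> no mass.\<close>

lemma sum_measure_exists:
  fixes \<mu> :: "'a \<Rightarrow> 'b measure"
  assumes sa: "sigma_algebra UNIV N" and sets: "\<And>v. sets (\<mu> v) = N"
  shows "\<exists>M :: ('a \<times> 'b) measure. space M = UNIV \<and>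
    (\<forall>A. A \<in> sets M \<longleftrightarrow> (\<forall>v. {w. (v, w) \<in> A} \<in> N)) \<and>
    (\<forall>A. A \<in> sets M \<longrightarrow> emeasure M A = (\<integral>\<^sup>+v. emeasure (\<mu> v) {w. (v, w) \<in> A} \<partial>count_space S))"
proof -
  interpret N: sigma_algebra UNIV N by (rule sa)
  define \<A> where "\<A> = {A. \<forall>v::'a. {w. (v, w) \<in> A} \<in> N}"
  have sA: "sigma_algebra UNIV \<A>"
    unfolding sigma_algebra_iff2
  proof (intro conjI ballI allI impI)
    show "{} \<in> \<A>" by (simp add: \<A>_def)
    show "UNIV - A \<in> \<A>" if "A \<in> \<A>" for A
    proof -
      have "{w. (v, w) \<in> UNIV - A} = UNIV - {w. (v, w) \<in> A}" for v by auto
      then show ?thesis using that by (simp add: \<A>_def N.compl_sets)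
    qed
    show "(\<Union>i. A i) \<in> \<A>" if "range A \<subseteq> \<A>" for A :: "nat \<Rightarrow> _"
    proof -
      have "{w. (v, w) \<in> (\<Union>i. A i)} = (\<Union>i. {w. (v, w) \<in> A i})" for v by auto
      moreover have "(\<Union>i. {w. (v, w) \<in> A i}) \<in> N" for v
        using that by (intro N.countable_UN) (auto simp: \<A>_def)
      ultimately show ?thesis unfolding \<A>_def by simp
    qed
  qed simp
  define m where "m A = (\<integral>\<^sup>+v. emeasure (\<mu> v) {w. (v, w) \<in> A} \<partial>count_space S)" for A
  have ca: "countably_additive \<A> m"
  proof (rule countably_additiveI)
    fix A :: "nat \<Rightarrow> ('a \<times> 'b) set" assume A: "range A \<subseteq> \<A>" "disjoint_family A"
    have "emeasure (\<mu> v) {w. (v, w) \<in> (\<Union>i. A i)} = (\<Sum>i. emeasure (\<mu> v) {w. (v, w) \<in> A i})" for v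
    proof -
      have "{w. (v, w) \<in> (\<Union>i. A i)} = (\<Union>i. {w. (v, w) \<in> A i})" by auto
      moreover have "(\<Sum>i. emeasure (\<mu> v) {w. (v, w) \<in> A i}) = emeasure (\<mu> v) (\<Union>i. {w. (v, w) \<in> A i})"
      proof (rule suminf_emeasure)
        show "disjoint_family (\<lambda>i. {w. (v, w) \<in> A i})" using A(2) unfolding disjoint_family_on_def by blast
      qed (use A(1) in \<open>auto simp: sets \<A>_def\<close>)
      ultimately show ?thesis by simp
    qed
    then show "(\<Sum>i. m (A i)) = m (\<Union>i. A i)"
      unfolding m_def by (simp add: nn_integral_suminf)
  qed
  define M where "M = measure_of UNIV \<A> m"
  have setsM: "sets M = \<A>"
    unfolding M_def by (rule sigma_algebra.sets_measure_of_eq[OF sA])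
  moreover have "space M = UNIV" by (simp add: M_def space_measure_of_conv)
  moreover have "emeasure M A = m A" if "A \<in> \<A>" for A
    by (rule emeasure_measure_of[OF M_def]) (use ca in \<open>auto simp: setsM that positive_def m_def\<close>)
  ultimately show ?thesis unfolding m_def by (intro exI[of _ M]) (simp add: \<A>_def)
qed

text \<open>The digits of a point \<open>x\<close> of \<open>[a, a + w u)\<close> for the successive subdivisions of the interval
  in the ratio \<open>w (P\<^sub>k y) : w (y - P\<^sub>k y)\<close>, where \<open>y\<close> is the vector attached to the current interval.\<close>

primrec digit :: "('h \<Rightarrow> real) \<Rightarrow> nat \<Rightarrow> (nat \<Rightarrow> 'h::ab_group_add \<Rightarrow> 'h) \<Rightarrow> real \<Rightarrow> 'h \<Rightarrow> real \<Rightarrow> bool" where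
  "digit w 0 P a u x = (x < a + w (P 0 u))"
| "digit w (Suc k) P a u x =
     (if x < a + w (P 0 u) then digit w k (\<lambda>i. P (Suc i)) a (P 0 u) x
      else digit w k (\<lambda>i. P (Suc i)) (a + w (P 0 u)) (u - P 0 u) x)"

text \<open>A coordinate of a sequence records by the value 1 that the projection with that index
  applies. Lists instead of finite sets of indices fit the products \<open>foldr P ks\<close>, and
  appending lists intersects cylinders.\<close>

definition cyl :: "nat list \<Rightarrow> (nat \<Rightarrow> complex) set" where
  "cyl ks = {w. \<forall>k\<in>set ks. w k = 1}"

abbreviation cyl_sets :: "(nat \<Rightarrow> complex) set set" where
  "cyl_sets \<equiv> sigma_sets UNIV (range cyl)"

lemma cyl_append: "cyl (ks @ ls) = cyl ks \<inter> cyl ls"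
  by (auto simp: cyl_def)

lemma Int_stable_cyl: "Int_stable (range cyl)"
  by (auto simp: Int_stable_def cyl_append[symmetric])

section \<open>Commuting projections and the measure attached to a vector\<close>

context hilbert_space
begin

definition pfam :: "(nat \<Rightarrow> 'h \<Rightarrow> 'h) \<Rightarrow> bool" where
  "pfam P \<longleftrightarrow> (\<forall>k. adjp (P k) (P k)) \<and> (\<forall>k x. P k (P k x) = P k x) \<and> (\<forall>k l x. P k (P l x) = P l (P k x))"

lemma pfam_adjp: "pfam P \<Longrightarrow> adjp (P k) (P k)"
  and pfam_idem: "pfam P \<Longrightarrow> P k (P k x) = P k x"
  and pfam_comm: "pfam P \<Longrightarrow> P k (P l x) = P l (P k x)"
  by (simp_all add: pfam_def)

lemma pfam_Suc: "pfam P \<Longrightarrow> pfam (\<lambda>i. P (Suc i))"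
  by (simp add: pfam_def)

lemma adjp_foldr: "pfam P \<Longrightarrow> \<exists>S. adjp (foldr P ks) S"
proof (induction ks)
  case Nil
  then show ?case using adjp_id by (auto simp: id_def)
next
  case (Cons k ks)
  then obtain S where "adjp (foldr P ks) S" by blast
  from adjp_comp[OF pfam_adjp[OF Cons.prems, of k] this] show ?case by (auto simp: comp_def)
qed

lemma foldr_commute: "(\<And>k x. D (P k x) = P k (D x)) \<Longrightarrow> D (foldr P ks x) = foldr P ks (D x)"
  by (induction ks) auto

text \<open>Moves all occurrences of the index 0 to the innermost place, where idempotence merges
  them into one. This matches the recursion of \<open>digit\<close>, which consumes
  \<open>P 0\<close> and shifts the family.\<close>

lemma foldr_shift:
  assumes P: "pfam P"
  shows "foldr P ks u = foldr (\<lambda>i. P (Suc i)) (map (\<lambda>k. k - 1) (filter (\<lambda>k. k \<noteq> 0) ks))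
    (if 0 \<in> set ks then P 0 u else u)"
proof (induction ks)
  case (Cons k ks)
  show ?case
  proof (cases k)
    case 0
    have c: "P 0 (foldr (\<lambda>i. P (Suc i)) js z) = foldr (\<lambda>i. P (Suc i)) js (P 0 z)" for js z
      by (rule foldr_commute) (rule pfam_comm[OF P])
    show ?thesis using Cons 0 by (auto simp: c pfam_idem[OF P])
  next
    case (Suc j)
    then show ?thesis using Cons by simp
  qed
qed simp

lemma nm_proj_split: "pfam P \<Longrightarrow> (nm u)\<^sup>2 = (nm (P k u))\<^sup>2 + (nm (u - P k u))\<^sup>2"
proof -
  assume P: "pfam P"
  have "ip (P k u) (u - P k u) = 0"
    using adjp_ip[OF pfam_adjp[OF P], of k u u] adjp_ip[OF pfam_adjp[OF P], of k u "P k u"]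
    by (simp add: ip_diff_right pfam_idem[OF P])
  from nm_add_orthogonal[OF this] show ?thesis by simp
qed

abbreviation "sqn x \<equiv> (nm x)\<^sup>2"

text \<open>Induction on a bound for the indices. By Pythagoras the interval splits into pieces of
  lengths \<open>sqn (P 0 u)\<close> and \<open>sqn (u - P 0 u)\<close>, each carrying the same
  problem for the shifted family. If 0 is among the indices only the left piece counts; otherwise
  the two masses add up, because \<open>P 0\<close> commutes with the other projections.\<close>

lemma digit_measure:
  assumes "pfam P" "\<forall>k\<in>set ks. k < l"
  shows "{x \<in> {a..<a + sqn u}. \<forall>k\<in>set ks. digit sqn k P a u x} \<in> sets borel \<and>
    emeasure lborel {x \<in> {a..<a + sqn u}. \<forall>k\<in>set ks. digit sqn k P a u x} = ennreal (sqn (foldr P ks u))"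
  using assms
proof (induction l arbitrary: ks P a u)
  case 0
  then have "ks = []" by auto
  then show ?case by (simp add: atLeastLessThan_def[symmetric] Collect_conj_eq del: atLeastLessThan_iff)
next
  case (Suc l)
  note P = Suc.prems(1)
  define Q where "Q i = P (Suc i)" for i
  define js where "js = map (\<lambda>k. k - 1) (filter (\<lambda>k. k \<noteq> 0) ks)"
  define p where "p = P 0 u"
  define q where "q = u - P 0 u"
  have Q: "pfam Q" unfolding Q_def[abs_def] by (rule pfam_Suc[OF P])
  have js_iff: "j \<in> set js \<longleftrightarrow> Suc j \<in> set ks" for j
    by (force simp: js_def image_iff)
  have jl: "\<forall>j\<in>set js. j < l" using Suc.prems(2) by (auto simp: js_iff)
  have split: "sqn u = sqn p + sqn q" unfolding p_def q_def by (rule nm_proj_split[OF P])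
  have u1: "x < a + sqn p \<Longrightarrow> x < a + sqn u" for x using split zero_le_power2[of "nm q"] by linarith
  have u2: "\<not> x < a + sqn p \<Longrightarrow> a \<le> x" for x using zero_le_power2[of "nm p"] by linarith
  have u3: "a + sqn p + sqn q = a + sqn u" using split by simp
  let ?D = "{x \<in> {a..<a + sqn u}. \<forall>k\<in>set ks. digit sqn k P a u x}"
  let ?D1 = "{x \<in> {a..<a + sqn p}. \<forall>k\<in>set js. digit sqn k Q a p x}"
  let ?D2 = "{x \<in> {a + sqn p..<a + sqn p + sqn q}. \<forall>k\<in>set js. digit sqn k Q (a + sqn p) q x}"
  have D1: "?D1 \<in> sets borel" "emeasure lborel ?D1 = ennreal (sqn (foldr Q js p))"
    using Suc.IH[OF Q jl, of a p] by auto
  have D2: "?D2 \<in> sets borel" "emeasure lborel ?D2 = ennreal (sqn (foldr Q js q))"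
    using Suc.IH[OF Q jl, of "a + sqn p" q] by auto
  have lo: "(\<forall>k\<in>set ks. digit sqn k P a u x) \<longleftrightarrow> (\<forall>k\<in>set js. digit sqn k Q a p x)" if "x < a + sqn p" for x
  proof -
    have "digit sqn 0 P a u x" "digit sqn (Suc j) P a u x = digit sqn j Q a p x" for j
      using that by (auto simp: p_def Q_def[abs_def])
    then show ?thesis by (metis js_iff not0_implies_Suc)
  qed
  have hi: "(\<forall>k\<in>set ks. digit sqn k P a u x) \<longleftrightarrow>
      0 \<notin> set ks \<and> (\<forall>k\<in>set js. digit sqn k Q (a + sqn p) q x)" if "\<not> x < a + sqn p" for x
  proof -
    have "\<not> digit sqn 0 P a u x" "digit sqn (Suc j) P a u x = digit sqn j Q (a + sqn p) q x" for j
      using that by (auto simp: p_def q_def Q_def[abs_def])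
    then show ?thesis by (metis js_iff not0_implies_Suc)
  qed
  have fold: "foldr P ks u = foldr Q js (if 0 \<in> set ks then p else u)"
    unfolding Q_def[abs_def] js_def p_def by (rule foldr_shift[OF P])
  show ?case
  proof (cases "0 \<in> set ks")
    case True
    have "?D = ?D1"
    proof (rule set_eqI)
      fix x show "x \<in> ?D \<longleftrightarrow> x \<in> ?D1"
        using lo[of x] hi[of x] True u1[of x] by (cases "x < a + sqn p") (auto simp del: digit.simps)
    qed
    then show ?thesis using D1 fold True by simp
  next
    case False
    have "?D = ?D1 \<union> ?D2"
    proof (rule set_eqI)
      fix x show "x \<in> ?D \<longleftrightarrow> x \<in> ?D1 \<union> ?D2"
        using lo[of x] hi[of x] False u1[of x] u2[of x] unfolding u3 by (cases "x < a + sqn p") auto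
    qed
    moreover have dis: "?D1 \<inter> ?D2 = {}" by auto
    have "emeasure lborel (?D1 \<union> ?D2) = ennreal (sqn (foldr Q js p)) + ennreal (sqn (foldr Q js q))"
      unfolding D1(2)[symmetric] D2(2)[symmetric]
      by (rule plus_emeasure[symmetric]) (simp_all only: sets_lborel D1(1) D2(1) dis)
    moreover have "sqn (foldr Q js u) = sqn (foldr Q js p) + sqn (foldr Q js q)"
    proof -
      have "foldr Q js p = P 0 (foldr Q js u)"
        unfolding p_def Q_def by (rule foldr_commute[symmetric]) (rule pfam_comm[OF P])
      moreover have "foldr Q js q = foldr Q js u - foldr Q js p"
        using adjp_foldr[OF Q, of js] adjp_diff unfolding q_def p_def by blast
      ultimately show ?thesis using nm_proj_split[OF P, of "foldr Q js u" 0] by simp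
    qed
    ultimately show ?thesis using D1(1) D2(1) fold False by (simp add: ennreal_plus[symmetric] del: ennreal_plus)
  qed
qed

text \<open>The image of Lebesgue measure on an interval of length \<open>sqn v\<close> under the
  digit map. Countable additivity is inherited, so no extension of a set function from the cylinders
  is required.\<close>

lemma cylinder_measure_exists:
  assumes P: "pfam P"
  shows "\<exists>\<mu>. sets \<mu> = cyl_sets \<and> (\<forall>ks. emeasure \<mu> (cyl ks) = ennreal (sqn (foldr P ks v)))"
proof -
  define I where "I = {0..<0 + sqn v}"
  define L where "L = restrict_space lborel I"
  define f :: "real \<Rightarrow> nat \<Rightarrow> complex" where "f x k = (if digit sqn k P 0 v x then 1 else 0)" for x k
  define N where "N = sigma (UNIV :: (nat \<Rightarrow> complex) set) (range cyl)"
  have sN: "sets N = cyl_sets" by (simp add: N_def)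
  \<comment> \<open>The sum of the indices serves as a bound for each of them.\<close>
  have D: "{x \<in> I. \<forall>k\<in>set ks. digit sqn k P 0 v x} \<in> sets borel \<and>
    emeasure lborel {x \<in> I. \<forall>k\<in>set ks. digit sqn k P 0 v x} = ennreal (sqn (foldr P ks v))" for ks
    unfolding I_def by (rule digit_measure[OF P, of ks "Suc (sum_list ks)"]) (auto simp: member_le_sum_list less_Suc_eq_le)
  have vim: "f -` cyl ks \<inter> space L = {x \<in> I. \<forall>k\<in>set ks. digit sqn k P 0 v x}" for ks
    by (auto simp: L_def space_restrict_space f_def cyl_def split: if_splits)
  have IB: "I \<in> sets borel" by (simp add: I_def)
  have f: "f \<in> measurable L N" unfolding N_def
  proof (rule measurable_measure_of)
    fix y assume "y \<in> range cyl"
    then obtain ks where y: "y = cyl ks" by blast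
    show "f -` y \<inter> space L \<in> sets L"
      unfolding y vim using D[of ks] IB by (auto simp: L_def sets_restrict_space_iff)
  qed auto
  show ?thesis
  proof (intro exI[of _ "distr L N f"] conjI allI)
    fix ks
    have "emeasure (distr L N f) (cyl ks) = emeasure L (f -` cyl ks \<inter> space L)"
      by (rule emeasure_distr[OF f]) (auto simp: sN)
    also have "\<dots> = emeasure lborel {x \<in> I. \<forall>k\<in>set ks. digit sqn k P 0 v x}"
      unfolding vim unfolding L_def using IB by (intro emeasure_restrict_space) auto
    finally show "emeasure (distr L N f) (cyl ks) = ennreal (sqn (foldr P ks v))" using D[of ks] by simp
  qed (simp add: sN)
qed

text \<open>Semifiniteness: a set of infinite mass has positive mass on some slice, and the slice of
  \<open>v\<close> has the finite mass \<open>sqn v\<close>.\<close>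

lemma model_measure_exists:
  fixes P :: "nat \<Rightarrow> 'h \<Rightarrow> 'h" and S :: "'h set"
  assumes P: "pfam P"
  shows "\<exists>M :: ('h \<times> (nat \<Rightarrow> complex)) measure. space M = UNIV \<and>
    (\<forall>A. A \<in> sets M \<longleftrightarrow> (\<forall>v. {w. (v, w) \<in> A} \<in> cyl_sets)) \<and>
    (\<forall>v\<in>S. \<forall>ks. emeasure M ({v} \<times> cyl ks) = ennreal (sqn (foldr P ks v))) \<and>
    (\<forall>A\<in>sets M. (\<forall>v\<in>S. emeasure M (A \<inter> {v} \<times> UNIV) = 0) \<longrightarrow> emeasure M A = 0) \<and> semifinite M"
proof -
  have "\<forall>v. \<exists>\<mu>. sets \<mu> = cyl_sets \<and> (\<forall>ks. emeasure \<mu> (cyl ks) = ennreal (sqn (foldr P ks v)))"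
    using cylinder_measure_exists[OF P] by blast
  then obtain \<mu> where \<mu>: "\<And>v. sets (\<mu> v) = cyl_sets" "\<And>v ks. emeasure (\<mu> v) (cyl ks) = ennreal (sqn (foldr P ks v))"
    by metis
  have sN: "sigma_algebra UNIV cyl_sets" by (rule sigma_algebra_sigma_sets) simp
  obtain M :: "('h \<times> (nat \<Rightarrow> complex)) measure" where M0: "space M = UNIV \<and>
    (\<forall>A. A \<in> sets M \<longleftrightarrow> (\<forall>v. {w. (v, w) \<in> A} \<in> cyl_sets)) \<and>
    (\<forall>A. A \<in> sets M \<longrightarrow> emeasure M A = (\<integral>\<^sup>+v. emeasure (\<mu> v) {w. (v, w) \<in> A} \<partial>count_space S))"
    using sum_measure_exists[OF sN \<mu>(1), of S] by (rule exE)
  have M: "space M = UNIV" "\<And>A. A \<in> sets M \<longleftrightarrow> (\<forall>v. {w. (v, w) \<in> A} \<in> cyl_sets)"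
    "\<And>A. A \<in> sets M \<Longrightarrow> emeasure M A = (\<integral>\<^sup>+v. emeasure (\<mu> v) {w. (v, w) \<in> A} \<partial>count_space S)"
    using M0 by simp_all
  have slice_sets: "A \<inter> {v} \<times> UNIV \<in> sets M" if "A \<in> sets M" for A v
  proof -
    have "{w. (u, w) \<in> A \<inter> {v} \<times> UNIV} = (if u = v then {w. (v, w) \<in> A} else {})" for u by auto
    then show ?thesis using that by (auto simp: M(2) sigma_sets.Empty)
  qed
  have slice: "emeasure M (A \<inter> {v} \<times> UNIV) = emeasure (\<mu> v) {w. (v, w) \<in> A}" if A: "A \<in> sets M" and v: "v \<in> S" for A v
  proof -
    have "{w. (u, w) \<in> A \<inter> {v} \<times> UNIV} = (if u = v then {w. (v, w) \<in> A} else {})" for u by auto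
    then have "emeasure M (A \<inter> {v} \<times> UNIV) =
        (\<integral>\<^sup>+u. emeasure (\<mu> v) {w. (v, w) \<in> A} * indicator {v} u \<partial>count_space S)"
      unfolding M(3)[OF slice_sets[OF A]] by (intro nn_integral_cong) auto
    also have "\<dots> = emeasure (\<mu> v) {w. (v, w) \<in> A}"
      using v by (subst nn_integral_cmult_indicator) (auto simp: emeasure_count_space_finite)
    finally show ?thesis .
  qed
  have cylM: "UNIV \<times> cyl ks \<in> sets M" for ks by (simp add: M(2) sigma_sets.Basic)
  have c: "emeasure M ({v} \<times> cyl ks) = ennreal (sqn (foldr P ks v))" if "v \<in> S" for v ks
    using slice[OF cylM that, of ks] by (simp add: Times_Int_Times \<mu>(2))
  have null: "emeasure M A = 0" if A: "A \<in> sets M" and z: "\<And>v. v \<in> S \<Longrightarrow> emeasure M (A \<inter> {v} \<times> UNIV) = 0" for A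
    unfolding M(3)[OF A] by (subst nn_integral_0_iff_AE) (auto simp: AE_count_space slice[OF A, symmetric] z)
  have "semifinite M" unfolding semifinite_def
  proof (intro ballI impI)
    fix A assume A: "A \<in> sets M" and inf: "emeasure M A = \<infinity>"
    then obtain v where v: "v \<in> S" "emeasure M (A \<inter> {v} \<times> UNIV) \<noteq> 0"
      using null[OF A] by fastforce
    have "emeasure M (A \<inter> {v} \<times> UNIV) \<le> emeasure M ({v} \<times> cyl [])"
    proof (rule emeasure_mono)
      have "UNIV \<times> cyl [] \<inter> {v} \<times> UNIV = {v} \<times> cyl []" by auto
      then show "{v} \<times> cyl [] \<in> sets M" using slice_sets[OF cylM[of "[]"], of v] by simp
    qed (auto simp: cyl_def)
    also have "\<dots> < \<infinity>" by (simp add: c[OF v(1)])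
    finally show "\<exists>B\<in>sets M. B \<subseteq> A \<and> 0 < emeasure M B \<and> emeasure M B < \<infinity>"
      using v slice_sets[OF A] by (intro bexI[of _ "A \<inter> {v} \<times> UNIV"]) (auto simp: zero_less_iff_neq_zero)
  qed
  then show ?thesis using M(1,2) c null by (intro exI[of _ M] conjI) auto
qed

end

section \<open>Square integrable functions\<close>

definition L2_norm :: "'x measure \<Rightarrow> ('x \<Rightarrow> complex) \<Rightarrow> real" where
  "L2_norm M f = sqrt (LINT x|M. (cmod (f x))\<^sup>2)"

abbreviation L2_dist :: "'x measure \<Rightarrow> ('x \<Rightarrow> complex) \<Rightarrow> ('x \<Rightarrow> complex) \<Rightarrow> real" where
  "L2_dist M f g \<equiv> L2_norm M (\<lambda>x. f x - g x)"

lemma L2_norm_nonneg [simp]: "0 \<le> L2_norm M f"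
  by (simp add: L2_norm_def)

lemma L2_norm_sq: "(L2_norm M f)\<^sup>2 = (LINT x|M. (cmod (f x))\<^sup>2)"
  by (simp add: L2_norm_def)

lemma borel_measurable_cnj [measurable (raw)]:
  assumes "f \<in> borel_measurable M"
  shows "(\<lambda>x. cnj (f x)) \<in> borel_measurable M"
  by (rule measurable_compose[OF assms borel_measurable_continuous_onI]) (intro continuous_intros)

lemma sqi_measurable [measurable_dest]: "square_integrable M f \<Longrightarrow> f \<in> borel_measurable M"
  by (simp add: square_integrable_def)

lemma sqi_sq: "square_integrable M f \<Longrightarrow> integrable M (\<lambda>x. (cmod (f x))\<^sup>2)"
  by (simp add: square_integrable_def)

lemma sqi_dominated:
  assumes "square_integrable M f" "g \<in> borel_measurable M" "AE x in M. cmod (g x) \<le> cmod (f x)"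
  shows "square_integrable M g"
  unfolding square_integrable_def
proof
  note [measurable] = sqi_measurable[OF assms(1)] assms(2)
  show "integrable M (\<lambda>x. (cmod (g x))\<^sup>2)"
    by (rule Bochner_Integration.integrable_bound[OF sqi_sq[OF assms(1)]])
      (use assms(3) in \<open>auto intro: power_mono\<close>)
qed (rule assms(2))

lemma sqi_cmult:
  assumes "square_integrable M f"
  shows "square_integrable M (\<lambda>x. c * f x)"
  using assms unfolding square_integrable_def by (auto simp: norm_mult power_mult_distrib)

lemma integrable_cmod_mult:
  assumes f: "square_integrable M f" and g: "square_integrable M g"
  shows "integrable M (\<lambda>x. cmod (f x) * cmod (g x))"
proof (rule Bochner_Integration.integrable_bound)
  note [measurable] = sqi_measurable[OF f] sqi_measurable[OF g]
  show "integrable M (\<lambda>x. (cmod (f x))\<^sup>2 + (cmod (g x))\<^sup>2)"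
    by (intro Bochner_Integration.integrable_add sqi_sq f g)
  show "(\<lambda>x. cmod (f x) * cmod (g x)) \<in> borel_measurable M" by measurable
  show "AE x in M. norm (cmod (f x) * cmod (g x)) \<le> norm ((cmod (f x))\<^sup>2 + (cmod (g x))\<^sup>2)"
  proof (rule AE_I2)
    fix x
    have "cmod (f x) * cmod (g x) \<le> (cmod (f x))\<^sup>2 + (cmod (g x))\<^sup>2"
      using sum_squares_bound[of "cmod (f x)" "cmod (g x)"] mult_nonneg_nonneg[of "cmod (f x)" "cmod (g x)"]
        norm_ge_zero[of "f x"] norm_ge_zero[of "g x"] by linarith
    then show "norm (cmod (f x) * cmod (g x)) \<le> norm ((cmod (f x))\<^sup>2 + (cmod (g x))\<^sup>2)" by simp
  qed
qed

lemma sqi_add: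
  assumes f: "square_integrable M f" and g: "square_integrable M g"
  shows "square_integrable M (\<lambda>x. f x + g x)"
  unfolding square_integrable_def
proof
  note [measurable] = sqi_measurable[OF f] sqi_measurable[OF g]
  show "(\<lambda>x. f x + g x) \<in> borel_measurable M" by measurable
  show "integrable M (\<lambda>x. (cmod (f x + g x))\<^sup>2)"
  proof (rule Bochner_Integration.integrable_bound)
    show "integrable M (\<lambda>x. (cmod (f x))\<^sup>2 + (cmod (g x))\<^sup>2 + 2 * (cmod (f x) * cmod (g x)))"
      by (intro Bochner_Integration.integrable_add sqi_sq f g integrable_mult_right integrable_cmod_mult)
    show "AE x in M. norm ((cmod (f x + g x))\<^sup>2) \<le> norm ((cmod (f x))\<^sup>2 + (cmod (g x))\<^sup>2 + 2 * (cmod (f x) * cmod (g x)))"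
    proof (rule AE_I2)
      fix x
      have "(cmod (f x + g x))\<^sup>2 \<le> (cmod (f x) + cmod (g x))\<^sup>2" by (intro power_mono norm_triangle_ineq) simp
      then show "norm ((cmod (f x + g x))\<^sup>2) \<le> norm ((cmod (f x))\<^sup>2 + (cmod (g x))\<^sup>2 + 2 * (cmod (f x) * cmod (g x)))"
        by (simp add: power2_sum)
    qed
  qed measurable
qed

lemma sqi_diff:
  assumes "square_integrable M f" "square_integrable M g"
  shows "square_integrable M (\<lambda>x. f x - g x)"
  using sqi_add[OF assms(1) sqi_cmult[OF assms(2), of "-1"]] by simp

lemma integrable_L2_inner:
  assumes f: "square_integrable M f" and g: "square_integrable M g"
  shows "integrable M (\<lambda>x. f x * cnj (g x))"
proof (rule Bochner_Integration.integrable_bound[OF integrable_cmod_mult[OF f g]])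
  note [measurable] = sqi_measurable[OF f] sqi_measurable[OF g]
  show "(\<lambda>x. f x * cnj (g x)) \<in> borel_measurable M" by measurable
qed (simp add: norm_mult)

lemma L2_cauchy_schwarz_abs:
  assumes f: "square_integrable M f" and g: "square_integrable M g"
  shows "(LINT x|M. cmod (f x) * cmod (g x)) \<le> L2_norm M f * L2_norm M g"
proof -
  note [measurable] = sqi_measurable[OF f] sqi_measurable[OF g]
  let ?I = "LINT x|M. cmod (f x) * cmod (g x)"
  have I: "(\<integral>\<^sup>+x. ennreal (cmod (f x)) * ennreal (cmod (g x)) \<partial>M) = ennreal ?I"
    using nn_integral_eq_integral[OF integrable_cmod_mult[OF f g]] by (simp add: ennreal_mult)
  have sq: "(\<integral>\<^sup>+x. ennreal ((cmod (h x))\<^sup>2) \<partial>M) = ennreal ((L2_norm M h)\<^sup>2)" if "square_integrable M h" for h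
    using nn_integral_eq_integral[OF sqi_sq[OF that]] by (simp add: L2_norm_sq)
  have I0: "0 \<le> ?I" by (intro Bochner_Integration.integral_nonneg) simp
  have "ennreal (?I\<^sup>2) \<le> ennreal ((L2_norm M f)\<^sup>2 * (L2_norm M g)\<^sup>2)"
    using Cauchy_Schwarz_nn_integral[of "\<lambda>x. ennreal (cmod (f x))" M "\<lambda>x. ennreal (cmod (g x))"] I0
    by (simp add: I sq[OF f] sq[OF g] ennreal_power ennreal_mult)
  then have "?I\<^sup>2 \<le> (L2_norm M f * L2_norm M g)\<^sup>2" by (simp add: power_mult_distrib)
  then show ?thesis by (rule power2_le_imp_le) simp
qed

lemma L2_cauchy_schwarz:
  assumes f: "square_integrable M f" and g: "square_integrable M g"
  shows "cmod (L2_inner M f g) \<le> L2_norm M f * L2_norm M g"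
proof -
  have "cmod (L2_inner M f g) \<le> (LINT x|M. cmod (f x * cnj (g x)))"
    unfolding L2_inner_def by (rule integral_norm_bound)
  then show ?thesis using L2_cauchy_schwarz_abs[OF f g] by (simp add: norm_mult)
qed

lemma L2_norm_triangle:
  assumes f: "square_integrable M f" and g: "square_integrable M g"
  shows "L2_norm M (\<lambda>x. f x + g x) \<le> L2_norm M f + L2_norm M g"
proof (rule power2_le_imp_le)
  have "(L2_norm M (\<lambda>x. f x + g x))\<^sup>2 \<le> (LINT x|M. (cmod (f x))\<^sup>2 + (cmod (g x))\<^sup>2 + 2 * (cmod (f x) * cmod (g x)))"
    unfolding L2_norm_sq
  proof (rule integral_mono)
    fix x
    have "(cmod (f x + g x))\<^sup>2 \<le> (cmod (f x) + cmod (g x))\<^sup>2" by (intro power_mono norm_triangle_ineq) simp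
    then show "(cmod (f x + g x))\<^sup>2 \<le> (cmod (f x))\<^sup>2 + (cmod (g x))\<^sup>2 + 2 * (cmod (f x) * cmod (g x))"
      by (simp add: power2_sum)
  qed (intro Bochner_Integration.integrable_add sqi_sq f g integrable_mult_right integrable_cmod_mult
      sqi_add)+
  also have "\<dots> = (L2_norm M f)\<^sup>2 + (L2_norm M g)\<^sup>2 + 2 * (LINT x|M. cmod (f x) * cmod (g x))"
    using sqi_sq[OF f] sqi_sq[OF g] integrable_cmod_mult[OF f g]
    by (simp add: L2_norm_sq)
  also have "\<dots> \<le> (L2_norm M f + L2_norm M g)\<^sup>2"
    using L2_cauchy_schwarz_abs[OF f g] by (simp add: power2_sum)
  finally show "(L2_norm M (\<lambda>x. f x + g x))\<^sup>2 \<le> (L2_norm M f + L2_norm M g)\<^sup>2" .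
qed simp

lemma L2_norm_minus_commute: "L2_dist M f g = L2_dist M g f"
  by (simp add: L2_norm_def norm_minus_commute)

lemma L2_norm_cmult: "L2_norm M (\<lambda>x. c * f x) = cmod c * L2_norm M f"
  by (simp add: L2_norm_def norm_mult power_mult_distrib real_sqrt_mult)

lemma L2_norm_triangle_diff:
  assumes "square_integrable M f" "square_integrable M g" "square_integrable M h"
  shows "L2_dist M f h \<le> L2_dist M f g + L2_dist M g h"
  using L2_norm_triangle[OF sqi_diff[OF assms(1,2)] sqi_diff[OF assms(2,3)]] by simp

lemma L2_norm_eq_0:
  assumes "square_integrable M f" "L2_norm M f = 0"
  shows "AE x in M. f x = 0"
  using assms integral_nonneg_eq_0_iff_AE[OF sqi_sq[OF assms(1)]] by (simp add: L2_norm_def)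

lemma L2_inner_self: "L2_inner M f f = of_real ((L2_norm M f)\<^sup>2)"
proof -
  have "f x * cnj (f x) = complex_of_real ((cmod (f x))\<^sup>2)" for x by (simp add: of_real_cmod_sq)
  then show ?thesis unfolding L2_inner_def L2_norm_sq by (simp only: integral_complex_of_real)
qed

lemma L2_norm_cong_AE:
  assumes "f \<in> borel_measurable M" "g \<in> borel_measurable M" "AE x in M. f x = g x"
  shows "L2_norm M f = L2_norm M g"
  unfolding L2_norm_def using assms by (intro arg_cong[where f = sqrt] integral_cong_AE) auto

lemma L2_AE_subseq:
  assumes "\<And>n. square_integrable M (u n)" "(\<lambda>n. L2_norm M (u n)) \<longlonglongrightarrow> 0"
  shows "\<exists>r::nat \<Rightarrow> nat. strict_mono r \<and> (AE x in M. (\<lambda>n. u (r n) x) \<longlonglongrightarrow> 0)"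
proof -
  have "(\<lambda>n. (L2_norm M (u n))\<^sup>2) \<longlonglongrightarrow> 0\<^sup>2" by (intro tendsto_power assms)
  then have "(\<lambda>n. LINT x|M. norm ((cmod (u n x))\<^sup>2)) \<longlonglongrightarrow> 0" by (simp add: L2_norm_sq)
  from tendsto_L1_AE_subseq[OF sqi_sq[OF assms(1)] this]
  obtain r :: "nat \<Rightarrow> nat" where r: "strict_mono r" "AE x in M. (\<lambda>n. (cmod (u (r n) x))\<^sup>2) \<longlonglongrightarrow> 0" by blast
  from r(2) have "AE x in M. (\<lambda>n. u (r n) x) \<longlonglongrightarrow> 0"
  proof eventually_elim
    case (elim x)
    then have "(\<lambda>n. sqrt ((cmod (u (r n) x))\<^sup>2)) \<longlonglongrightarrow> sqrt 0" by (rule tendsto_real_sqrt)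
    then show ?case by (intro tendsto_norm_zero_cancel[of "\<lambda>n. u (r n) x"]) simp
  qed
  with r(1) show ?thesis by blast
qed

text \<open>Riesz-Fischer. A rapidly converging subsequence converges almost everywhere, and Fatou's
  lemma along it bounds the distance of the original sequence from the pointwise limit.\<close>

lemma L2_complete:
  fixes f :: "nat \<Rightarrow> 'x \<Rightarrow> complex"
  assumes f: "\<And>n. square_integrable M (f n)"
    and C: "\<And>e. e > 0 \<Longrightarrow> \<exists>N. \<forall>m\<ge>N. \<forall>k\<ge>N. L2_dist M (f m) (f k) < e"
  shows "\<exists>g. square_integrable M g \<and> (\<lambda>n. L2_dist M (f n) g) \<longlonglongrightarrow> 0"
proof -
  note [measurable] = sqi_measurable[OF f]
  have "\<forall>i. \<exists>N. \<forall>m\<ge>N. \<forall>k\<ge>N. L2_dist M (f m) (f k) < (1/2) ^ i" using C by simp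
  then obtain N where N: "\<And>i m k. m \<ge> N i \<Longrightarrow> k \<ge> N i \<Longrightarrow> L2_dist M (f m) (f k) < (1/2) ^ i"
    by metis
  \<comment> \<open>Partial sums make the indices monotone while keeping them above
    \<open>N k\<close>.\<close>
  define r where "r k = (\<Sum>i\<le>k. N i)" for k
  have rN: "N k \<le> r k" and rS: "r k \<le> r (Suc k)" for k by (simp_all add: r_def member_le_sum)
  have rmono: "r i \<le> r k" if "i \<le> k" for i k using that rS by (rule lift_Suc_mono_le[rotated])
  define d where "d k x = f (r (Suc k)) x - f (r k) x" for k x
  have [measurable]: "d k \<in> borel_measurable M" for k unfolding d_def[abs_def] by measurable
  have dsq: "square_integrable M (d k)" for k unfolding d_def[abs_def] by (intro sqi_diff f)
  have dn: "L2_norm M (d k) \<le> (1/2) ^ k" for k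
    unfolding d_def[abs_def] using N[of k "r (Suc k)" "r k"] rN[of k] rS[of k] by simp
  \<comment> \<open>The weight \<open>2 ^ k\<close> still leaves a summable bound, and finiteness of
    the weighted sum at a point forces geometric decay of \<open>cmod (d k x)\<close> there, hence
    convergence of the telescoping series.\<close>
  have dint: "(\<integral>\<^sup>+x. ennreal (2 ^ k * (cmod (d k x))\<^sup>2) \<partial>M) \<le> ennreal ((1/2) ^ k)" for k
  proof -
    have "(\<integral>\<^sup>+x. ennreal (2 ^ k * (cmod (d k x))\<^sup>2) \<partial>M) = ennreal (2 ^ k * (L2_norm M (d k))\<^sup>2)"
      using sqi_sq[OF dsq[of k]] by (subst nn_integral_eq_integral) (auto simp: L2_norm_sq)
    also have "\<dots> \<le> ennreal (2 ^ k * ((1/2) ^ k)\<^sup>2)"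
      by (intro ennreal_leI mult_left_mono power_mono dn) auto
    also have "2 ^ k * ((1/2) ^ k)\<^sup>2 = (1/2 :: real) ^ k"
      by (simp add: power2_eq_square power_mult_distrib[symmetric] mult.assoc[symmetric])
    finally show ?thesis .
  qed
  have "(\<integral>\<^sup>+x. (\<Sum>k. ennreal (2 ^ k * (cmod (d k x))\<^sup>2)) \<partial>M) = (\<Sum>k. \<integral>\<^sup>+x. ennreal (2 ^ k * (cmod (d k x))\<^sup>2) \<partial>M)"
    by (intro nn_integral_suminf) measurable
  also have "\<dots> \<le> (\<Sum>k. ennreal ((1/2) ^ k))" by (intro suminf_le dint) auto
  also have "\<dots> = ennreal (\<Sum>k. (1/2) ^ k)" by (intro suminf_ennreal2) (auto simp: summable_geometric)
  finally have "(\<integral>\<^sup>+x. (\<Sum>k. ennreal (2 ^ k * (cmod (d k x))\<^sup>2)) \<partial>M) \<noteq> \<infinity>"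
    by (auto simp: top_unique)
  then have fin: "AE x in M. (\<Sum>k. ennreal (2 ^ k * (cmod (d k x))\<^sup>2)) \<noteq> \<infinity>"
    by (intro nn_integral_noteq_infinite) measurable
  define g where "g x = lim (\<lambda>k. f (r k) x)" for x
  have [measurable]: "g \<in> borel_measurable M" unfolding g_def[abs_def] by measurable
  have conv: "AE x in M. (\<lambda>k. f (r k) x) \<longlonglongrightarrow> g x"
    using fin
  proof eventually_elim
    case (elim x)
    have "summable (\<lambda>k. 2 ^ k * (cmod (d k x))\<^sup>2)"
      using elim by (intro summable_suminf_not_top) auto
    then have "Bseq (\<lambda>k. 2 ^ k * (cmod (d k x))\<^sup>2)"
      by (intro convergent_imp_Bseq) (auto intro: convergentI summable_LIMSEQ_zero)
    then obtain B where B: "B > 0" "\<And>k. 2 ^ k * (cmod (d k x))\<^sup>2 \<le> B"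
      unfolding Bseq_def by (metis abs_le_D1 real_norm_def)
    have "summable (\<lambda>k. d k x)"
    proof (rule summable_comparison_test)
      show "\<exists>N. \<forall>k\<ge>N. norm (d k x) \<le> sqrt B * (sqrt (1/2)) ^ k"
      proof (intro exI[of _ 0] allI impI)
        fix k
        have "(cmod (d k x))\<^sup>2 \<le> B * (1/2) ^ k" using B(2)[of k] by (simp add: field_simps power_one_over)
        then have "cmod (d k x) \<le> sqrt (B * (1/2) ^ k)" by (rule real_le_rsqrt)
        then show "norm (d k x) \<le> sqrt B * (sqrt (1/2)) ^ k" by (simp add: real_sqrt_mult real_sqrt_power)
      qed
      show "summable (\<lambda>k. sqrt B * (sqrt (1/2)) ^ k)"
        by (intro summable_mult summable_geometric) (simp add: real_sqrt_lt_1_iff)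
    qed
    then have "convergent (\<lambda>n. \<Sum>k<n. d k x)" by (simp add: summable_iff_convergent)
    moreover have "(\<Sum>k<n. d k x) = f (r n) x - f (r 0) x" for n
      unfolding d_def by (rule sum_lessThan_telescope)
    ultimately have "convergent (\<lambda>n. f (r n) x - f (r 0) x)" by simp
    then have "convergent (\<lambda>n. f (r n) x)" using convergent_add[OF _ convergent_const[of "f (r 0) x"]] by fastforce
    then show ?case by (simp add: g_def convergent_LIMSEQ_iff)
  qed
  have fatou: "(\<integral>\<^sup>+x. ennreal ((cmod (f m x - g x))\<^sup>2) \<partial>M) \<le> ennreal (((1/2) ^ i)\<^sup>2)" if m: "m \<ge> N i" for m i
  proof -
    have "(\<integral>\<^sup>+x. ennreal ((cmod (f m x - g x))\<^sup>2) \<partial>M) =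
        (\<integral>\<^sup>+x. liminf (\<lambda>k. ennreal ((cmod (f m x - f (r k) x))\<^sup>2)) \<partial>M)"
    proof (rule nn_integral_cong_AE)
      show "AE x in M. ennreal ((cmod (f m x - g x))\<^sup>2) = liminf (\<lambda>k. ennreal ((cmod (f m x - f (r k) x))\<^sup>2))"
        using conv
      proof eventually_elim
        case (elim x)
        have "(\<lambda>k. ennreal ((cmod (f m x - f (r k) x))\<^sup>2)) \<longlonglongrightarrow> ennreal ((cmod (f m x - g x))\<^sup>2)"
          by (intro tendsto_ennrealI tendsto_intros elim)
        then show ?case by (rule lim_imp_Liminf[OF trivial_limit_sequentially, symmetric])
      qed
    qed
    also have "\<dots> \<le> liminf (\<lambda>k. \<integral>\<^sup>+x. ennreal ((cmod (f m x - f (r k) x))\<^sup>2) \<partial>M)"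
      by (intro nn_integral_liminf) measurable
    also have "\<dots> \<le> ennreal (((1/2) ^ i)\<^sup>2)"
    proof (rule Liminf_le)
      have "(\<integral>\<^sup>+x. ennreal ((cmod (f m x - f (r k) x))\<^sup>2) \<partial>M) \<le> ennreal (((1/2) ^ i)\<^sup>2)" if k: "k \<ge> i" for k
      proof -
        have "(\<integral>\<^sup>+x. ennreal ((cmod (f m x - f (r k) x))\<^sup>2) \<partial>M) = ennreal ((L2_dist M (f m) (f (r k)))\<^sup>2)"
          using sqi_sq[OF sqi_diff[OF f f]]
          by (subst nn_integral_eq_integral) (auto simp: L2_norm_sq)
        also have "\<dots> \<le> ennreal (((1/2) ^ i)\<^sup>2)"
          using N[OF m, of "r k"] rN[of i] rmono[OF k] by (intro ennreal_leI power_mono) auto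
        finally show ?thesis .
      qed
      then show "\<forall>\<^sub>F k in sequentially. (\<integral>\<^sup>+x. ennreal ((cmod (f m x - f (r k) x))\<^sup>2) \<partial>M) \<le> ennreal (((1/2) ^ i)\<^sup>2)"
        by (auto simp: eventually_sequentially)
    qed simp
    finally show ?thesis .
  qed
  have sq: "square_integrable M (\<lambda>x. f m x - g x)" if m: "m \<ge> N i" for m i
    unfolding square_integrable_def
  proof
    have "(\<integral>\<^sup>+x. ennreal ((cmod (f m x - g x))\<^sup>2) \<partial>M) < \<infinity>"
      using fatou[OF m] by (rule order_le_less_trans) simp
    then show "integrable M (\<lambda>x. (cmod (f m x - g x))\<^sup>2)"
      by (intro integrableI_bounded) auto
  qed measurable
  have g: "square_integrable M g"
    using sqi_diff[OF f sq[of 0 "N 0"], of "N 0"] by simp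
  have "(\<lambda>n. L2_dist M (f n) g) \<longlonglongrightarrow> 0"
  proof (rule LIMSEQ_I)
    fix e :: real assume "e > 0"
    then obtain i where i: "(1/2 :: real) ^ i < e" using real_arch_pow_inv[of e "1/2"] by auto
    have "L2_dist M (f m) g \<le> (1/2) ^ i" if m: "m \<ge> N i" for m
    proof (rule power2_le_imp_le)
      have "ennreal ((L2_dist M (f m) g)\<^sup>2) \<le> ennreal (((1/2) ^ i)\<^sup>2)"
        using fatou[OF m] nn_integral_eq_integral[OF sqi_sq[OF sq[OF m]]] by (simp add: L2_norm_sq)
      then show "(L2_dist M (f m) g)\<^sup>2 \<le> ((1/2) ^ i)\<^sup>2" by (simp del: power_mult power_one_over)
    qed simp
    then show "\<exists>no. \<forall>n\<ge>no. norm (L2_dist M (f n) g - 0) < e"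
      using i by (intro exI[of _ "N i"]) force
  qed
  with g show ?thesis by blast
qed

lemma L2_norm_add_sq:
  assumes f: "square_integrable M f" and g: "square_integrable M g"
  shows "(L2_norm M (\<lambda>x. f x + g x))\<^sup>2 = (L2_norm M f)\<^sup>2 + (L2_norm M g)\<^sup>2 + 2 * Re (L2_inner M f g)"
proof -
  have pt: "(cmod (f x + g x))\<^sup>2 = (cmod (f x))\<^sup>2 + (cmod (g x))\<^sup>2 + 2 * Re (f x * cnj (g x))" for x
    unfolding cmod_power2 by (simp add: power2_eq_square algebra_simps)
  have lin: "(LINT x|M. a x + b x + 2 * c x) = (LINT x|M. a x) + (LINT x|M. b x) + 2 * (LINT x|M. c x)"
    if "integrable M a" "integrable M b" "integrable M c" for a b c :: "'a \<Rightarrow> real"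
    using that by simp
  have "(LINT x|M. Re (f x * cnj (g x))) = Re (LINT x|M. f x * cnj (g x))"
    by (rule integral_Re[OF integrable_L2_inner[OF f g]])
  then show ?thesis
    unfolding L2_norm_sq L2_inner_def pt
    by (subst lin[OF sqi_sq[OF f] sqi_sq[OF g] integrable_Re[OF integrable_L2_inner[OF f g]]])
      (simp only:)
qed

lemma L2_inner_add_left:
  assumes "square_integrable M f" "square_integrable M g" "square_integrable M h"
  shows "L2_inner M (\<lambda>x. c * f x + g x) h = c * L2_inner M f h + L2_inner M g h"
  unfolding L2_inner_def using integrable_L2_inner[OF assms(1,3)] integrable_L2_inner[OF assms(2,3)]
  by (simp add: distrib_right mult.assoc)

lemma L2_inner_commute: "L2_inner M g f = cnj (L2_inner M f g)"
proof -
  have "cnj (L2_inner M f g) = (LINT x|M. cnj (f x * cnj (g x)))"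
    unfolding L2_inner_def by (rule Bochner_Integration.integral_cnj[symmetric])
  then show ?thesis by (simp add: L2_inner_def mult.commute)
qed

lemma L2_inner_cong_AE:
  assumes "square_integrable M f" "square_integrable M f'" "square_integrable M g" "AE x in M. f x = f' x"
  shows "L2_inner M f g = L2_inner M f' g"
  unfolding L2_inner_def using assms by (intro integral_cong_AE) (auto simp: square_integrable_def)

lemma L2_norm_mono:
  assumes "square_integrable M f" "g \<in> borel_measurable M" "AE x in M. cmod (g x) \<le> cmod (f x)"
  shows "L2_norm M g \<le> L2_norm M f"
  unfolding L2_norm_def using assms sqi_sq[OF sqi_dominated[OF assms]]
    sqi_sq[OF assms(1)]
  by (intro real_sqrt_le_mono integral_mono_AE) (auto intro: power_mono)

lemma (in hilbert_space) pfam_foldr_selfadjoint: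
  assumes P: "pfam P"
  shows "ip (foldr P ks x) y = ip x (foldr P ks y)"
proof (induction ks arbitrary: x y)
  case (Cons k ks)
  have "P k (foldr P ks y) = foldr P ks (P k y)" by (rule foldr_commute) (rule pfam_comm[OF P])
  then show ?case using Cons[of x "P k y"] by (simp add: adjp_ip[OF pfam_adjp[OF P]])
qed simp

section \<open>The unitary equivalence\<close>

text \<open>Since \<open>S\<close> may be uncountable, \<open>null_slices\<close> takes the part of
  sigma-finiteness: it is what permits conclusions on the whole space from conclusions on the
  slices.\<close>

locale spectral_model = hilbert_space sc ip
  for sc :: "complex \<Rightarrow> 'h::ab_group_add \<Rightarrow> 'h" and ip :: "'h \<Rightarrow> 'h \<Rightarrow> complex" +
  fixes P :: "nat \<Rightarrow> 'h \<Rightarrow> 'h" and S :: "'h set" and M :: "('h \<times> (nat \<Rightarrow> complex)) measure"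
  assumes P: "pfam P"
    and S_orth: "\<And>v w ks. v \<in> S \<Longrightarrow> w \<in> S \<Longrightarrow> v \<noteq> w \<Longrightarrow> ip (foldr P ks v) w = 0"
    and S_total: "\<And>x. (\<And>v ks. v \<in> S \<Longrightarrow> ip x (foldr P ks v) = 0) \<Longrightarrow> x = 0"
    and space_M: "space M = UNIV"
    and sets_M: "\<And>A. A \<in> sets M \<longleftrightarrow> (\<forall>v. {w. (v, w) \<in> A} \<in> cyl_sets)"
    and emeasure_cyl: "\<And>v ks. v \<in> S \<Longrightarrow> emeasure M ({v} \<times> cyl ks) = ennreal ((hnorm ip (foldr P ks v))\<^sup>2)"
    and null_slices: "\<And>A. A \<in> sets M \<Longrightarrow> (\<And>v. v \<in> S \<Longrightarrow> emeasure M (A \<inter> {v} \<times> UNIV) = 0) \<Longrightarrow> emeasure M A = 0"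
begin

section \<open>Slices of the model space\<close>

lemma cyl_Pow: "range cyl \<subseteq> Pow UNIV"
  by simp

lemma sets_slice: "A \<in> cyl_sets \<Longrightarrow> {v} \<times> A \<in> sets M"
proof -
  assume A: "A \<in> cyl_sets"
  have "{w. (u, w) \<in> {v} \<times> A} = (if u = v then A else {})" for u by auto
  then show ?thesis using A by (simp add: sets_M sigma_sets.Empty)
qed

lemma sets_cyl [measurable]: "{v} \<times> cyl ks \<in> sets M"
  by (rule sets_slice) (simp add: sigma_sets.Basic)

lemma cyl_Nil: "cyl [] = UNIV"
  by (simp add: cyl_def)

lemma sets_UNIV_slice [measurable]: "{v} \<times> UNIV \<in> sets M"
  using sets_cyl[of v "[]"] by (simp add: cyl_Nil)

lemma sets_UNIV_cyl [measurable]: "UNIV \<times> cyl ks \<in> sets M"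
  by (simp add: sets_M sigma_sets.Basic)

abbreviation chi :: "nat list \<Rightarrow> 'h \<times> (nat \<Rightarrow> complex) \<Rightarrow> complex" where
  "chi ks x \<equiv> of_bool (snd x \<in> cyl ks)"

lemma measurable_chi [measurable]: "(\<lambda>x. chi ks x) \<in> borel_measurable M"
proof -
  have eq: "(\<lambda>x. chi ks x) = indicator (UNIV \<times> cyl ks)"
    by (auto simp: fun_eq_iff indicator_def)
  show ?thesis unfolding eq by measurable
qed

text \<open>Uncountably many exceptional null sets are united here; this is legitimate because the
  union is assumed measurable and null on every slice.\<close>

lemma AE_slices:
  assumes Q: "{x. Q x} \<in> sets M" and s: "\<And>v. v \<in> S \<Longrightarrow> AE x in M. fst x = v \<longrightarrow> Q x"
  shows "AE x in M. Q x"
proof (rule AE_I')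
  have B: "UNIV - {x. Q x} \<in> sets M" using sets.compl_sets[OF Q] by (simp add: space_M)
  have "emeasure M (UNIV - {x. Q x}) = 0"
  proof (rule null_slices[OF B])
    fix v assume "v \<in> S"
    have "emeasure M {x \<in> space M. \<not> (fst x = v \<longrightarrow> Q x)} = 0"
    proof (rule AE_iff_measurable[THEN iffD1, OF _ refl s[OF \<open>v \<in> S\<close>]])
      have "{x \<in> space M. \<not> (fst x = v \<longrightarrow> Q x)} = (UNIV - {x. Q x}) \<inter> {v} \<times> UNIV"
        by (auto simp: space_M)
      then show "{x \<in> space M. \<not> (fst x = v \<longrightarrow> Q x)} \<in> sets M" using B by simp
    qed
    moreover have "{x \<in> space M. \<not> (fst x = v \<longrightarrow> Q x)} = (UNIV - {x. Q x}) \<inter> {v} \<times> UNIV"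
      by (auto simp: space_M)
    ultimately show "emeasure M ((UNIV - {x. Q x}) \<inter> {v} \<times> UNIV) = 0" by simp
  qed
  with B show "UNIV - {x. Q x} \<in> null_sets M" by (simp add: null_sets_def)
qed auto

lemma foldr_selfadjoint: "ip (foldr P ks x) y = ip x (foldr P ks y)"
  by (rule pfam_foldr_selfadjoint[OF P])

lemma foldr_commute_P: "P k (foldr P ks x) = foldr P ks (P k x)"
  by (rule foldr_commute) (rule pfam_comm[OF P])

lemma foldr_foldr: "foldr P ks (foldr P ls x) = foldr P ls (foldr P ks x)"
  by (rule foldr_commute) (simp add: foldr_commute_P)

lemma foldr_idem: "foldr P ks (foldr P ks x) = foldr P ks x"
proof (induction ks)
  case (Cons k ks)
  then show ?case by (simp add: foldr_commute_P[symmetric] pfam_idem[OF P])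
qed simp

text \<open>Products of the commuting projections are again projections, so the inner products of
  the vectors \<open>foldr P ks v\<close> are the masses of intersections of cylinders. This is the
  source of the isometry.\<close>

lemma gram: "ip (foldr P ks v) (foldr P ls v) = of_real (sqn (foldr P (ks @ ls) v))"
proof -
  have "foldr P (ks @ ls) v = foldr P ks (foldr P ls v)" by simp
  then have "of_real (sqn (foldr P (ks @ ls) v)) = ip (foldr P ks (foldr P ls v)) (foldr P ks (foldr P ls v))"
    by (simp only: ip_self)
  also have "\<dots> = ip (foldr P ks (foldr P ls v)) (foldr P ls v)"
    by (simp add: foldr_selfadjoint[of ks "foldr P ks (foldr P ls v)", symmetric] foldr_idem)
  also have "\<dots> = ip (foldr P ks v) (foldr P ls v)"
    by (simp add: foldr_foldr[of ks ls] foldr_selfadjoint[of ls] foldr_idem)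
  finally show ?thesis by simp
qed

section \<open>The isometry on cylinder indicators and its closure\<close>

definition ind :: "'h \<Rightarrow> nat list \<Rightarrow> 'h \<times> (nat \<Rightarrow> complex) \<Rightarrow> complex" where
  "ind v ks x = of_bool (x \<in> {v} \<times> cyl ks)"

lemma ind_eq: "ind v ks = indicator ({v} \<times> cyl ks)"
  by (auto simp: ind_def fun_eq_iff indicator_def)

lemma measurable_ind [measurable]: "ind v ks \<in> borel_measurable M"
  unfolding ind_eq by measurable

lemma finite_cyl: "v \<in> S \<Longrightarrow> emeasure M ({v} \<times> cyl ks) < \<infinity>"
  by (simp add: emeasure_cyl)

lemma ind_sqi: "v \<in> S \<Longrightarrow> square_integrable M (ind v ks)"
proof -
  assume v: "v \<in> S"
  have "(\<lambda>x. (cmod (ind v ks x))\<^sup>2) = (indicator ({v} \<times> cyl ks) :: _ \<Rightarrow> real)"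
    by (auto simp: ind_def fun_eq_iff indicator_def)
  then show ?thesis using finite_cyl[OF v] unfolding square_integrable_def by simp
qed

lemma ind_inner:
  assumes v: "v \<in> S" and w: "w \<in> S"
  shows "L2_inner M (ind v ks) (ind w ls) = ip (foldr P ks v) (foldr P ls w)"
proof (cases "v = w")
  case True
  have "ind v ks x * cnj (ind w ls x) = of_real (indicator ({v} \<times> cyl (ks @ ls)) x)" for x
    using True by (auto simp: ind_def indicator_def cyl_append)
  then have "L2_inner M (ind v ks) (ind w ls) = of_real (LINT x|M. indicator ({v} \<times> cyl (ks @ ls)) x)"
    unfolding L2_inner_def by (simp only: integral_complex_of_real)
  also have "\<dots> = of_real (measure M ({v} \<times> cyl (ks @ ls)))" by (simp add: space_M)
  also have "\<dots> = ip (foldr P ks v) (foldr P ls w)"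
    using emeasure_cyl[OF v, of "ks @ ls"] gram[of ks v ls] True by (simp add: measure_def)
  finally show ?thesis .
next
  case False
  have z: "ind v ks x * cnj (ind w ls x) = 0" for x using False by (auto simp: ind_def)
  have "L2_inner M (ind v ks) (ind w ls) = 0" unfolding L2_inner_def z by simp
  moreover have "ip (foldr P ks v) (foldr P ls w) = ip (foldr P (ls @ ks) v) w"
    by (simp add: foldr_selfadjoint)
  ultimately show ?thesis using S_orth[OF v w False, of "ls @ ks"] by simp
qed

text \<open>A relation and not a function, because a vector can be a combination of generators in
  many ways; that all of them give the same function almost everywhere comes out later from the
  preservation of norms.\<close>

inductive V :: "'h \<Rightarrow> ('h \<times> (nat \<Rightarrow> complex) \<Rightarrow> complex) \<Rightarrow> bool" where
  zero: "V 0 (\<lambda>x. 0)"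
| step: "V h f \<Longrightarrow> v \<in> S \<Longrightarrow> V (sc a (foldr P ks v) + h) (\<lambda>x. a * ind v ks x + f x)"

lemma sqi_zero: "square_integrable M (\<lambda>x. 0)"
  by (simp add: square_integrable_def)

lemma V_sqi: "V h f \<Longrightarrow> square_integrable M f"
proof (induction rule: V.induct)
  case zero
  show ?case by (rule sqi_zero)
next
  case (step h f v a ks)
  then show ?case by (intro sqi_add sqi_cmult ind_sqi)
qed

lemma V_inner:
  assumes "V h f" "V h' f'"
  shows "L2_inner M f f' = ip h h'"
  using assms
proof (induction rule: V.induct)
  case zero
  then show ?case by (simp add: L2_inner_def)
next
  case (step h f v a ks)
  have b: "L2_inner M (ind v ks) f' = ip (foldr P ks v) h'"
    using \<open>V h' f'\<close>
  proof (induction rule: V.induct)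
    case zero
    then show ?case by (simp add: L2_inner_def)
  next
    case (step h' f' w b ls)
    have "L2_inner M (\<lambda>x. b * ind w ls x + f' x) (ind v ks) = b * L2_inner M (ind w ls) (ind v ks) + L2_inner M f' (ind v ks)"
      by (intro L2_inner_add_left ind_sqi V_sqi[OF step(1)] step \<open>v \<in> S\<close>)
    from arg_cong[OF this, of cnj] have "L2_inner M (ind v ks) (\<lambda>x. b * ind w ls x + f' x)
        = cnj b * L2_inner M (ind v ks) (ind w ls) + L2_inner M (ind v ks) f'"
      by (simp add: L2_inner_commute[of M _ "ind v ks"])
    then show ?case using step \<open>v \<in> S\<close> by (simp add: ind_inner ip_simps)
  qed
  have "L2_inner M (\<lambda>x. a * ind v ks x + f x) f' = a * L2_inner M (ind v ks) f' + L2_inner M f f'"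
    by (intro L2_inner_add_left ind_sqi V_sqi[OF step(1)]
        V_sqi[OF \<open>V h' f'\<close>] step)
  then show ?case using step b by (simp add: ip_simps)
qed

lemma V_add: "V h f \<Longrightarrow> V k g \<Longrightarrow> V (h + k) (\<lambda>x. f x + g x)"
proof (induction rule: V.induct)
  case (step h f v a ks)
  then show ?case using V.step[of "h + k" "\<lambda>x. f x + g x" v a ks] by (simp add: add.assoc)
qed simp

lemma V_sc: "V h f \<Longrightarrow> V (sc b h) (\<lambda>x. b * f x)"
proof (induction rule: V.induct)
  case (step h f v a ks)
  then show ?case using V.step[of "sc b h" "\<lambda>x. b * f x" v "b * a" ks]
    by (simp add: scale_right_distrib distrib_left mult.assoc)
qed (simp add: V.zero)

lemma V_base: "v \<in> S \<Longrightarrow> V (foldr P ks v) (ind v ks)"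
  using V.step[OF V.zero, of v 1 ks] by simp

text \<open>\<open>R\<close> is the closure of \<open>V\<close>, and will be the graph of the unitary (modulo equality almost everywhere).\<close>

definition R :: "'h \<Rightarrow> ('h \<times> (nat \<Rightarrow> complex) \<Rightarrow> complex) \<Rightarrow> bool" where
  "R h f \<longleftrightarrow> square_integrable M f \<and>
    (\<forall>e>0. \<exists>k g. V k g \<and> nm (h - k) < e \<and> L2_dist M f g < e)"

lemma R_sqi: "R h f \<Longrightarrow> square_integrable M f"
  by (simp add: R_def)

lemma R_approx:
  assumes "R h f" "e > 0"
  obtains k g where "V k g" "nm (h - k) < e" "L2_dist M f g < e"
  using assms by (auto simp: R_def)

lemma L2_norm_0 [simp]: "L2_norm M (\<lambda>x. 0) = 0"
  by (simp add: L2_norm_def)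

lemma V_R: "V h f \<Longrightarrow> R h f"
  unfolding R_def by (auto intro!: exI[of _ h] exI[of _ f] simp: V_sqi)

lemma R_add:
  assumes "R h f" "R k g"
  shows "R (h + k) (\<lambda>x. f x + g x)"
  unfolding R_def
proof (intro conjI allI impI)
  show "square_integrable M (\<lambda>x. f x + g x)" using assms by (intro sqi_add R_sqi)
  fix e :: real assume "e > 0"
  then have e: "e/2 > 0" by simp
  obtain h' f' where 1: "V h' f'" "nm (h - h') < e/2" "L2_dist M f f' < e/2"
    using R_approx[OF assms(1) e] .
  obtain k' g' where 2: "V k' g'" "nm (k - k') < e/2" "L2_dist M g g' < e/2"
    using R_approx[OF assms(2) e] .
  have "nm (h + k - (h' + k')) \<le> nm (h - h') + nm (k - k')"
    using nm_triangle[of "h - h'" "k - k'"] by (simp add: algebra_simps)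
  moreover have "L2_norm M (\<lambda>x. (f x - f' x) + (g x - g' x)) \<le> L2_dist M f f' + L2_dist M g g'"
    using assms 1 2 by (intro L2_norm_triangle sqi_diff R_sqi V_sqi)
  then have "L2_norm M (\<lambda>x. f x + g x - (f' x + g' x)) \<le> L2_dist M f f' + L2_dist M g g'"
    by (simp add: algebra_simps)
  ultimately show "\<exists>k' g'. V k' g' \<and> nm (h + k - k') < e \<and> L2_norm M (\<lambda>x. f x + g x - g' x) < e"
    using 1 2 V_add[OF 1(1) 2(1)] by (intro exI[of _ "h' + k'"] exI[of _ "\<lambda>x. f' x + g' x"]) auto
qed

lemma R_sc:
  assumes "R h f"
  shows "R (sc b h) (\<lambda>x. b * f x)"
  unfolding R_def
proof (intro conjI allI impI)
  show "square_integrable M (\<lambda>x. b * f x)" using assms by (intro sqi_cmult R_sqi)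
  fix e :: real assume e: "e > 0"
  define e' where "e' = e / (cmod b + 1)"
  have b1: "cmod b + 1 > 0" by (simp add: add_nonneg_pos)
  have e': "e' > 0" using e b1 by (simp add: e'_def)
  obtain k g where 1: "V k g" "nm (h - k) < e'" "L2_dist M f g < e'"
    using R_approx[OF assms e'] .
  have lt: "cmod b * t < e" if "t < e'" "t \<ge> 0" for t
  proof -
    have "cmod b * t \<le> (cmod b + 1) * t" using that by (intro mult_right_mono) auto
    also have "\<dots> < (cmod b + 1) * e'" using that b1 by (intro mult_strict_left_mono)
    also have "\<dots> = e" using b1 by (simp add: e'_def)
    finally show ?thesis .
  qed
  have "nm (sc b h - sc b k) < e" using lt[OF 1(2)] by (simp add: scale_right_diff_distrib[symmetric] nm_sc)
  moreover have "L2_norm M (\<lambda>x. b * f x - b * g x) < e"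
    using lt[OF 1(3)] by (simp add: right_diff_distrib[symmetric] L2_norm_cmult)
  ultimately show "\<exists>k g. V k g \<and> nm (sc b h - k) < e \<and> L2_norm M (\<lambda>x. b * f x - g x) < e"
    using V_sc[OF 1(1)] by blast
qed

lemma R_diff: "R h f \<Longrightarrow> R k g \<Longrightarrow> R (h - k) (\<lambda>x. f x - g x)"
  using R_add[of h f "sc (-1) k" "\<lambda>x. (-1) * g x"] R_sc[of k g "-1"] by simp

lemma R_norm:
  assumes "R h f"
  shows "L2_norm M f = nm h"
proof -
  have "\<bar>L2_norm M f - nm h\<bar> \<le> 2 * e" if e: "e > 0" for e
  proof -
    obtain k g where 1: "V k g" "nm (h - k) < e" "L2_dist M f g < e"
      using R_approx[OF assms e] .
    have sf: "square_integrable M f" and sg: "square_integrable M g"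
      using R_sqi[OF assms] V_sqi[OF 1(1)] .
    have "complex_of_real ((L2_norm M g)\<^sup>2) = of_real ((nm k)\<^sup>2)"
      using V_inner[OF 1(1) 1(1)] by (simp only: L2_inner_self ip_self)
    then have "L2_norm M g = nm k" by (simp del: of_real_power)
    moreover have "L2_norm M f \<le> L2_dist M f g + L2_norm M g"
      using L2_norm_triangle[OF sqi_diff[OF sf sg] sg] by simp
    moreover have "L2_norm M g \<le> L2_dist M f g + L2_norm M f"
      using L2_norm_triangle[OF sqi_diff[OF sg sf] sf] L2_norm_minus_commute[of M f g] by simp
    moreover have "\<bar>nm h - nm k\<bar> \<le> nm (h - k)" by (rule nm_diff_abs)
    ultimately show ?thesis using 1(2,3) by linarith
  qed
  then have "\<bar>L2_norm M f - nm h\<bar> \<le> 0 + e" if "e > 0" for e using that[THEN half_gt_zero] by fastforce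
  then have "\<bar>L2_norm M f - nm h\<bar> \<le> 0" by (rule field_le_epsilon)
  then show ?thesis by simp
qed

text \<open>Polarisation: preservation of norms for sums gives the real parts, and multiplying
  \<open>h\<close> by the imaginary unit gives the imaginary parts.\<close>

lemma R_inner:
  assumes "R h f" "R k g"
  shows "L2_inner M f g = ip h k"
proof -
  have re: "Re (L2_inner M f g) = Re (ip h k)" if 1: "R h f" for h f
  proof -
    have "(L2_norm M (\<lambda>x. f x + g x))\<^sup>2 = (nm (h + k))\<^sup>2" using R_norm[OF R_add[OF 1 assms(2)]] by simp
    then show ?thesis
      unfolding L2_norm_add_sq[OF R_sqi[OF 1] R_sqi[OF assms(2)]] nm_add_sq
      using R_norm[OF 1] R_norm[OF assms(2)] by simp
  qed
  have "L2_inner M (\<lambda>x. \<i> * f x) g = \<i> * L2_inner M f g"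
    unfolding L2_inner_def by (simp add: mult.assoc)
  then have "Im (L2_inner M f g) = Im (ip h k)"
    using re[OF R_sc[OF assms(1), of \<i>]] by (simp add: ip_sc_left)
  then show ?thesis using re[OF assms(1)] by (simp add: complex_eq_iff)
qed

text \<open>The difference of two images of \<open>h\<close> is an image of 0 and so has norm
  0.\<close>

lemma R_unique:
  assumes "R h f" "R h g"
  shows "AE x in M. f x = g x"
proof -
  have "R 0 (\<lambda>x. f x - g x)" using R_diff[OF assms] by simp
  from L2_norm_eq_0[OF R_sqi[OF this]] R_norm[OF this] show ?thesis by simp
qed

lemma R_closed:
  assumes R: "\<And>n. R (hs n) (fs n)" and h: "hlim hs h" and f: "square_integrable M f"
    and l: "(\<lambda>n. L2_dist M (fs n) f) \<longlonglongrightarrow> 0"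
  shows "R h f"
  unfolding R_def
proof (intro conjI allI impI f)
  fix e :: real assume "e > 0"
  then have e: "e/2 > 0" by simp
  have "\<forall>\<^sub>F n in sequentially. nm (hs n - h) < e/2" using h e unfolding hlim_def by (rule order_tendstoD)
  moreover have "\<forall>\<^sub>F n in sequentially. L2_dist M (fs n) f < e/2" using l e by (rule order_tendstoD)
  ultimately have "\<forall>\<^sub>F n in sequentially. nm (hs n - h) < e/2 \<and> L2_dist M (fs n) f < e/2"
    by (rule eventually_conj)
  then obtain n where n: "nm (hs n - h) < e/2" "L2_dist M (fs n) f < e/2"
    by (auto simp: eventually_sequentially)
  obtain k g where 1: "V k g" "nm (hs n - k) < e/2" "L2_dist M (fs n) g < e/2"
    using R_approx[OF R e] .
  have "nm (h - k) < e" using nm_triangle_diff[of h k "hs n"] nm_minus_commute[of h "hs n"] n 1 by linarith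
  moreover have "L2_dist M f g < e"
    using L2_norm_triangle_diff[OF f R_sqi[OF R[of n]] V_sqi[OF 1(1)]]
      L2_norm_minus_commute[of M f "fs n"] n 1 by linarith
  ultimately show "\<exists>k g. V k g \<and> nm (h - k) < e \<and> L2_dist M f g < e" using 1(1) by blast
qed

text \<open>The domain of \<open>R\<close> is closed, because images of a convergent sequence are
  Cauchy and L2 is complete; it contains all vectors \<open>foldr P ks v\<close>, and these are
  total.\<close>

lemma R_total: "\<exists>f. R h f"
proof -
  define K where "K = {h. \<exists>f. R h f}"
  have K: "csub K" unfolding csub_def
  proof (intro conjI ballI allI impI)
    show "0 \<in> K" using V_R[OF V.zero] by (auto simp: K_def)
    show "x + y \<in> K" if "x \<in> K" "y \<in> K" for x y using that unfolding K_def by (blast intro: R_add)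
    show "sc a x \<in> K" if "x \<in> K" for a x using that unfolding K_def by (blast intro: R_sc)
    fix X L assume X: "\<forall>k. X k \<in> K" "hlim X L"
    then have "\<forall>k. \<exists>f. R (X k) f" by (simp add: K_def)
    from choice[OF this] obtain fs where fs: "\<And>k. R (X k) (fs k)" by blast
    have "\<exists>N. \<forall>m\<ge>N. \<forall>k\<ge>N. L2_dist M (fs m) (fs k) < e" if "e > 0" for e
    proof -
      have "\<forall>\<^sub>F n in sequentially. nm (X n - L) < e/2"
        using X(2) half_gt_zero[OF that] unfolding hlim_def by (rule order_tendstoD)
      then obtain N where N: "\<And>n. n \<ge> N \<Longrightarrow> nm (X n - L) < e/2" by (auto simp: eventually_sequentially)
      have "L2_dist M (fs m) (fs k) < e" if "m \<ge> N" "k \<ge> N" for m k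
        using R_norm[OF R_diff[OF fs[of m] fs[of k]]] N[OF that(1)] N[OF that(2)]
          nm_triangle_diff[of "X m" "X k" L] nm_minus_commute[of L "X k"] by linarith
      then show ?thesis by blast
    qed
    from L2_complete[OF R_sqi[OF fs] this] obtain g where
      g: "square_integrable M g" "(\<lambda>n. L2_dist M (fs n) g) \<longlonglongrightarrow> 0" by blast
    from R_closed[OF fs X(2) g] show "L \<in> K" by (auto simp: K_def)
  qed
  have "K = UNIV"
  proof (rule csub_eq_UNIV[OF K])
    fix x assume "\<And>y. y \<in> K \<Longrightarrow> ip x y = 0"
    moreover have "foldr P ks v \<in> K" if "v \<in> S" for ks v using V_R[OF V_base[OF that]] by (auto simp: K_def)
    ultimately show "x = 0" by (intro S_total) auto
  qed
  then show ?thesis by (auto simp: K_def)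
qed

text \<open>A representative is chosen for each vector on its own, so linearity holds only up to
  null sets that depend on the vectors.\<close>

definition \<gamma> :: "'h \<Rightarrow> 'h \<times> (nat \<Rightarrow> complex) \<Rightarrow> complex" where
  "\<gamma> h = (SOME f. R h f)"

lemma \<gamma>_R: "R h (\<gamma> h)"
  unfolding \<gamma>_def using R_total by (rule someI_ex)

lemma \<gamma>_sqi: "square_integrable M (\<gamma> h)"
  by (rule R_sqi[OF \<gamma>_R])

lemma \<gamma>_measurable [measurable]: "\<gamma> h \<in> borel_measurable M"
  using \<gamma>_sqi by (simp add: square_integrable_def)

lemma \<gamma>_linear: "AE x in M. \<gamma> (sc a h + k) x = a * \<gamma> h x + \<gamma> k x"
  by (rule R_unique[OF \<gamma>_R R_add[OF R_sc[OF \<gamma>_R] \<gamma>_R]])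

lemma \<gamma>_base: "v \<in> S \<Longrightarrow> AE x in M. \<gamma> (foldr P ks v) x = ind v ks x"
  by (rule R_unique[OF \<gamma>_R V_R[OF V_base]])

text \<open>The slice has finite mass, so \<open>f\<close> is integrable on it. Its integral
  vanishes over cylinders, hence over all of \<open>cyl_sets\<close>, the cylinders being stable
  under intersection.\<close>

lemma zero_on_slice:
  assumes f: "square_integrable M f" and v: "v \<in> S" and z: "\<And>ks. L2_inner M f (ind v ks) = 0"
  shows "AE x in M. fst x = v \<longrightarrow> f x = 0"
proof -
  note [measurable] = sqi_measurable[OF f]
  have f0: "integrable M (\<lambda>x. f x * cnj (ind v ks x))" for ks by (intro integrable_L2_inner f ind_sqi v)
  have eqind: "f x * cnj (ind v ks x) = indicator ({v} \<times> cyl ks) x *\<^sub>R f x" for ks x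
    by (auto simp: ind_def indicator_def)
  have fint: "set_integrable M ({v} \<times> UNIV) f"
    using f0[of "[]"] unfolding eqind set_integrable_def by (simp add: cyl_Nil)
  have sub: "set_integrable M ({v} \<times> A) f" if "A \<in> cyl_sets" for A
    by (rule set_integrable_subset[OF fint sets_slice[OF that]]) auto
  have zA: "(LINT x:{v} \<times> A|M. f x) = 0" if "A \<in> cyl_sets" for A
    using Int_stable_cyl cyl_Pow that
  proof (induction rule: sigma_sets_induct_disjoint)
    case (basic A)
    then show ?case using z unfolding L2_inner_def eqind set_lebesgue_integral_def by auto
  next
    case empty
    then show ?case by (simp add: set_lebesgue_integral_def)
  next
    case (compl A)
    have "{v} \<times> UNIV = {v} \<times> A \<union> {v} \<times> (UNIV - A)" by auto
    moreover have "(LINT x:{v} \<times> A \<union> {v} \<times> (UNIV - A)|M. f x) = (LINT x:{v} \<times> A|M. f x) + (LINT x:{v} \<times> (UNIV - A)|M. f x)"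
      using compl by (intro set_integral_Un sub sigma_sets.Compl) auto
    moreover have "(LINT x:{v} \<times> UNIV|M. f x) = 0"
      using z[of "[]"] unfolding L2_inner_def eqind set_lebesgue_integral_def by (simp add: cyl_Nil)
    ultimately show ?case using compl by simp
  next
    case (union A)
    have A: "A i \<in> cyl_sets" for i using union by auto
    have eq: "{v} \<times> (\<Union>i. A i) = (\<Union>i. {v} \<times> A i)" by auto
    have "(LINT x:(\<Union>i. {v} \<times> A i)|M. f x) = (\<Sum>i. LINT x:{v} \<times> A i|M. f x)"
    proof (rule lebesgue_integral_countable_add)
      show "{v} \<times> A i \<in> sets M" for i by (rule sets_slice[OF A])
      show "({v} \<times> A i) \<inter> ({v} \<times> A j) = {}" if "i \<noteq> j" for i j
        using union(1) that by (auto simp: disjoint_family_on_def)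
      show "set_integrable M (\<Union>i. {v} \<times> A i) f"
        unfolding eq[symmetric] by (intro sub sigma_sets.Union A)
    qed
    then show ?case unfolding eq by (simp add: union)
  qed
  \<comment> \<open>Integrating \<open>c * f\<close> over the set where its real part is positive
    shows that this set is null; the four choices of \<open>c\<close> at the end are the signs of
    the real and the imaginary part.\<close>
  have pos: "AE x in M. fst x = v \<longrightarrow> Re (c * f x) \<le> 0" for c
  proof -
    define B where "B = {x. fst x = v \<and> Re (c * f x) > 0}"
    have "{x \<in> space M. Re (c * f x) > 0} \<in> sets M" by measurable
    then have A: "{w. Re (c * f (v, w)) > 0} \<in> cyl_sets"
      unfolding sets_M space_M by simp
    have B: "B = {v} \<times> {w. Re (c * f (v, w)) > 0}" by (auto simp: B_def)
    have BM [measurable]: "B \<in> sets M" unfolding B by (rule sets_slice[OF A])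
    have "integrable M (\<lambda>x. indicator B x *\<^sub>R f x)" using sub[OF A] unfolding B set_integrable_def .
    then have int: "integrable M (\<lambda>x. c * (indicator B x *\<^sub>R f x))" by (rule integrable_mult_right)
    have "(LINT x|M. c * (indicator B x *\<^sub>R f x)) = 0"
      unfolding integral_mult_right_zero using zA[OF A] unfolding B set_lebesgue_integral_def by (simp only: mult_zero_right)
    then have 0: "(LINT x|M. Re (c * (indicator B x *\<^sub>R f x))) = 0"
      using integral_Re[OF int] by simp
    have "AE x in M. Re (c * (indicator B x *\<^sub>R f x)) = 0"
      using integral_nonneg_eq_0_iff_AE[OF integrable_Re[OF int]] 0
      by (auto simp: B_def indicator_def)
    then show ?thesis
    proof eventually_elim
      case (elim x)
      then show ?case by (cases "x \<in> B") (auto simp: B_def indicator_def split: if_splits)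
    qed
  qed
  show ?thesis
    using pos[of 1] pos[of "-1"] pos[of \<i>] pos[of "-\<i>"]
    by eventually_elim (auto simp: complex_eq_iff)
qed

text \<open>The Riesz vector \<open>k\<close> of the functional
  \<open>h \<mapsto> L2_inner M (\<gamma> h) f\<close> makes \<open>\<gamma> k - f\<close>
  orthogonal to all cylinder indicators, so it vanishes on every slice.\<close>

lemma \<gamma>_surj:
  assumes f: "square_integrable M f"
  shows "\<exists>h. AE x in M. \<gamma> h x = f x"
proof -
  note [measurable] = sqi_measurable[OF f]
  have "L2_inner M (\<gamma> (sc a x + y)) f = a * L2_inner M (\<gamma> x) f + L2_inner M (\<gamma> y) f" for a x y
  proof -
    have "square_integrable M (\<lambda>z. a * \<gamma> x z + \<gamma> y z)"
      by (intro sqi_add sqi_cmult \<gamma>_sqi)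
    from L2_inner_cong_AE[OF \<gamma>_sqi this f \<gamma>_linear] show ?thesis
      by (simp add: L2_inner_add_left[OF \<gamma>_sqi \<gamma>_sqi f])
  qed
  moreover have "cmod (L2_inner M (\<gamma> x) f) \<le> L2_norm M f * nm x" for x
    using L2_cauchy_schwarz[OF \<gamma>_sqi f, of x] R_norm[OF \<gamma>_R, of x] by (simp add: mult.commute)
  ultimately obtain k where k: "\<And>h. L2_inner M (\<gamma> h) f = ip h k"
    using riesz_representation[of "\<lambda>h. L2_inner M (\<gamma> h) f" "L2_norm M f"] by blast
  have sd: "square_integrable M (\<lambda>x. \<gamma> k x - f x)" by (intro sqi_diff \<gamma>_sqi f)
  have "AE x in M. \<gamma> k x - f x = 0"
  proof (rule AE_slices)
    have "{x \<in> space M. \<gamma> k x - f x = 0} \<in> sets M" by measurable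
    then show "{x. \<gamma> k x - f x = 0} \<in> sets M" by (simp add: space_M)
    fix v assume v: "v \<in> S"
    show "AE x in M. fst x = v \<longrightarrow> \<gamma> k x - f x = 0"
    proof (rule zero_on_slice[OF sd v])
      fix ks
      have "L2_inner M (ind v ks) f = ip (foldr P ks v) k"
        using k[of "foldr P ks v"] L2_inner_cong_AE[OF \<gamma>_sqi ind_sqi[OF v] f \<gamma>_base[OF v]] by simp
      moreover have "L2_inner M (\<gamma> k) (ind v ks) = ip k (foldr P ks v)"
        by (rule R_inner[OF \<gamma>_R V_R[OF V_base[OF v]]])
      moreover have "L2_inner M (\<lambda>x. (-1) * f x + \<gamma> k x) (ind v ks) = (-1) * L2_inner M f (ind v ks) + L2_inner M (\<gamma> k) (ind v ks)"
        by (intro L2_inner_add_left f \<gamma>_sqi ind_sqi v)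
      ultimately show "L2_inner M (\<lambda>x. \<gamma> k x - f x) (ind v ks) = 0"
        by (simp add: L2_inner_commute[of M f "ind v ks"] ip_commute[of k])
    qed
  qed
  then show ?thesis by (intro exI[of _ k]) simp
qed

lemma \<gamma>_unitary: "unitary_to_L2 ip M \<gamma>"
  unfolding unitary_to_L2_def using \<gamma>_sqi R_inner[OF \<gamma>_R \<gamma>_R] \<gamma>_surj by blast

section \<open>Pointwise limits and multiplication operators\<close>

lemma \<gamma>_AE_subseq:
  assumes "hlim hs h"
  shows "\<exists>r::nat \<Rightarrow> nat. strict_mono r \<and> (AE x in M. (\<lambda>n. \<gamma> (hs (r n)) x) \<longlonglongrightarrow> \<gamma> h x)"
proof -
  have "(\<lambda>n. L2_dist M (\<gamma> (hs n)) (\<gamma> h)) \<longlonglongrightarrow> 0"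
    using assms R_norm[OF R_diff[OF \<gamma>_R \<gamma>_R]] by (simp add: hlim_def)
  from L2_AE_subseq[OF sqi_diff[OF \<gamma>_sqi \<gamma>_sqi] this]
  obtain r :: "nat \<Rightarrow> nat" where r: "strict_mono r" "AE x in M. (\<lambda>n. \<gamma> (hs (r n)) x - \<gamma> h x) \<longlonglongrightarrow> 0" by blast
  from r(2) have "AE x in M. (\<lambda>n. \<gamma> (hs (r n)) x) \<longlonglongrightarrow> \<gamma> h x" by eventually_elim (rule LIM_zero_cancel)
  with r(1) show ?thesis by blast
qed

lemma \<gamma>_lim:
  assumes h: "hlim hs h" and f: "AE x in M. (\<lambda>n. \<gamma> (hs n) x) \<longlonglongrightarrow> f x"
  shows "AE x in M. \<gamma> h x = f x"
proof -
  obtain r :: "nat \<Rightarrow> nat" where r: "strict_mono r" "AE x in M. (\<lambda>n. \<gamma> (hs (r n)) x) \<longlonglongrightarrow> \<gamma> h x"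
    using \<gamma>_AE_subseq[OF h] by blast
  from r(2) f show ?thesis
  proof eventually_elim
    case (elim x)
    have "(\<lambda>n. \<gamma> (hs (r n)) x) \<longlonglongrightarrow> f x"
      using LIMSEQ_subseq_LIMSEQ[OF elim(2) r(1)] by (simp add: comp_def)
    then show ?case using elim(1) by (rule LIMSEQ_unique[rotated])
  qed
qed

text \<open>On the generators a product of projections appends to the list of indices, which
  multiplies the indicator by \<open>chi ks\<close>. Both sides are contractive, so this passes to
  the closure.\<close>

lemma R_P:
  assumes "R h f"
  shows "R (foldr P ks h) (\<lambda>x. chi ks x * f x)"
proof -
  have VP: "V (foldr P ks h) (\<lambda>x. chi ks x * f x)" if "V h f" for h f
    using that
  proof (induction rule: V.induct)
    case zero
    obtain A where "adjp (foldr P ks) A" using adjp_foldr[OF P] by blast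
    then show ?case using V.zero by (simp add: adjp_zero)
  next
    case (step h f v a ls)
    obtain A where A: "adjp (foldr P ks) A" using adjp_foldr[OF P] by blast
    have "(\<lambda>x. chi ks x * (a * ind v ls x + f x)) =
        (\<lambda>x. a * ind v (ks @ ls) x + chi ks x * f x)"
      by (auto simp: fun_eq_iff ind_def cyl_append)
    then show ?case using V.step[OF step(3,2), of a "ks @ ls"] by (simp add: adjp_add[OF A] adjp_sc[OF A])
  qed
  have c1: "nm (foldr P ks x) \<le> nm x" for x
  proof (induction ks)
    case (Cons k ks)
    have "(nm (P k y))\<^sup>2 \<le> (nm y)\<^sup>2" for y using nm_proj_split[OF P, of y k] by simp
    then have "nm (P k y) \<le> nm y" for y by (rule power2_le_imp_le) simp
    then show ?case using Cons order_trans by fastforce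
  qed simp
  obtain A where A: "adjp (foldr P ks) A" using adjp_foldr[OF P] by blast
  show ?thesis unfolding R_def
  proof (intro conjI allI impI)
    have sf: "square_integrable M f" by (rule R_sqi[OF assms])
    note [measurable] = sqi_measurable[OF sf]
    show "square_integrable M (\<lambda>x. chi ks x * f x)"
      by (rule sqi_dominated[OF sf]) (auto simp: norm_mult)
    fix e :: real assume "e > 0"
    then obtain k g where 1: "V k g" "nm (h - k) < e" "L2_dist M f g < e"
      using R_approx[OF assms] by blast
    have sg: "square_integrable M g" by (rule V_sqi[OF 1(1)])
    note [measurable] = sqi_measurable[OF sg]
    have "nm (foldr P ks h - foldr P ks k) < e"
      using c1[of "h - k"] 1(2) by (simp add: adjp_diff[OF A])
    moreover have "L2_norm M (\<lambda>x. chi ks x * f x - chi ks x * g x) \<le> L2_dist M f g"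
      by (rule L2_norm_mono[OF sqi_diff[OF sf sg]]) (auto simp: norm_mult)
    ultimately show "\<exists>k g. V k g \<and> nm (foldr P ks h - k) < e \<and> L2_norm M (\<lambda>x. chi ks x * f x - g x) < e"
      using VP[OF 1(1)] 1(3) by (intro exI[of _ "foldr P ks k"] exI[of _ "\<lambda>x. chi ks x * g x"]) auto
  qed
qed

text \<open>On the slice of \<open>v\<close> the vector \<open>v\<close> is represented by the constant 1, so the symbol of an operator
  preserving the cyclic subspaces can be read off from its values on \<open>S\<close>.\<close>

definition symbol :: "('h \<Rightarrow> 'h) \<Rightarrow> 'h \<times> (nat \<Rightarrow> complex) \<Rightarrow> complex" where
  "symbol N x = \<gamma> (N (fst x)) x"

lemma symbol_measurable [measurable]: "symbol N \<in> borel_measurable M"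
proof (rule measurableI)
  fix B :: "complex set" assume B: "B \<in> sets borel"
  have "{w. (v, w) \<in> symbol N -` B \<inter> space M} \<in> cyl_sets" for v
  proof -
    have "\<gamma> (N v) -` B \<inter> space M \<in> sets M" by (rule measurable_sets[OF \<gamma>_measurable B])
    then have "{w. (v, w) \<in> \<gamma> (N v) -` B \<inter> space M} \<in> cyl_sets" unfolding sets_M by blast
    then show ?thesis by (simp add: symbol_def)
  qed
  then show "symbol N -` B \<inter> space M \<in> sets M" unfolding sets_M by blast
qed simp

text \<open>Commuting with the projections settles the slice of the generator \<open>v\<close>, and
  \<open>orth\<close> makes the image of \<open>v\<close> vanish on the other slices. The extension
  to all vectors takes limits pointwise along a subsequence, so no bound on the symbol
  enters.\<close>

lemma symbol_multiplication:
  assumes N: "adjp N N'" and comm: "\<And>k x. N (P k x) = P k (N x)"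
    and orth: "\<And>v w ks. v \<in> S \<Longrightarrow> w \<in> S \<Longrightarrow> v \<noteq> w \<Longrightarrow> ip (N v) (foldr P ks w) = 0"
  shows "AE x in M. \<gamma> (N h) x = symbol N x * \<gamma> h x"
proof -
  have base: "AE x in M. \<gamma> (N (foldr P ks v)) x = symbol N x * ind v ks x" if v: "v \<in> S" for v ks
  proof -
    have "N (foldr P ks v) = foldr P ks (N v)" by (rule foldr_commute) (rule comm)
    then have 1: "AE x in M. \<gamma> (N (foldr P ks v)) x = chi ks x * \<gamma> (N v) x"
      using R_unique[OF \<gamma>_R R_P[OF \<gamma>_R]] by simp
    have "AE x in M. chi ks x * \<gamma> (N v) x = symbol N x * ind v ks x"
    proof (rule AE_slices)
      have "{x \<in> space M. chi ks x * \<gamma> (N v) x = symbol N x * ind v ks x} \<in> sets M" by measurable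
      then show "{x. chi ks x * \<gamma> (N v) x = symbol N x * ind v ks x} \<in> sets M" by (simp add: space_M)
      fix w assume w: "w \<in> S"
      show "AE x in M. fst x = w \<longrightarrow> chi ks x * \<gamma> (N v) x = symbol N x * ind v ks x"
      proof (cases "w = v")
        case True
        then show ?thesis by (intro AE_I2) (auto simp: symbol_def ind_def mem_Times_iff)
      next
        case False
        have "AE x in M. fst x = w \<longrightarrow> \<gamma> (N v) x = 0"
          by (rule zero_on_slice[OF \<gamma>_sqi w])
            (use R_inner[OF \<gamma>_R V_R[OF V_base[OF w]]] orth[OF v w] False in auto)
        then show ?thesis by eventually_elim (use False in \<open>auto simp: ind_def\<close>)
      qed
    qed
    with 1 show ?thesis by eventually_elim simp
  qed
  have onV: "AE x in M. \<gamma> (N h) x = symbol N x * f x" if "V h f" for h f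
    using that
  proof (induction rule: V.induct)
    case zero
    have "AE x in M. \<gamma> 0 x = 0" by (rule R_unique[OF \<gamma>_R V_R[OF V.zero]])
    then show ?case by (simp add: adjp_zero[OF N])
  next
    case (step h f v a ks)
    from step(3) base[OF step(2), of ks] \<gamma>_linear[of a "N (foldr P ks v)" "N h"] show ?case
      by eventually_elim (simp add: adjp_add[OF N] adjp_sc[OF N] algebra_simps)
  qed
  have "\<forall>n. \<exists>k g. V k g \<and> nm (h - k) < 1 / real (Suc n) \<and> L2_dist M (\<gamma> h) g < 1 / real (Suc n)"
    using \<gamma>_R[of h] unfolding R_def by simp
  then obtain k g where kg: "\<And>n. V (k n) (g n)" "\<And>n. nm (h - k n) < 1 / real (Suc n)"
    "\<And>n. L2_dist M (\<gamma> h) (g n) < 1 / real (Suc n)" by metis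
  have l0: "(\<lambda>n. 1 / real (Suc n)) \<longlonglongrightarrow> 0" by (rule LIMSEQ_Suc[OF lim_1_over_n])
  have hk: "hlim k h"
    by (rule hlim_sandwich[OF _ l0]) (use kg(2) nm_minus_commute[of h] less_imp_le in metis)
  have "(\<lambda>n. L2_dist M (\<gamma> h) (g n)) \<longlonglongrightarrow> 0"
    by (rule tendsto_sandwich[OF _ _ tendsto_const l0]) (auto intro!: always_eventually less_imp_le[OF kg(3)] simp del: of_nat_Suc)
  from L2_AE_subseq[OF sqi_diff[OF \<gamma>_sqi V_sqi[OF kg(1)]] this]
  obtain r :: "nat \<Rightarrow> nat" where r: "strict_mono r" "AE x in M. (\<lambda>n. \<gamma> h x - g (r n) x) \<longlonglongrightarrow> 0" by blast
  have "hlim (\<lambda>n. k (r n)) h"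
    using LIMSEQ_subseq_LIMSEQ[OF hk[unfolded hlim_def] r(1)] by (simp add: hlim_def comp_def)
  then have lim: "hlim (\<lambda>n. N (k (r n))) (N h)" by (rule adjp_hlim[OF N])
  have "AE x in M. \<forall>n. \<gamma> (N (k (r n))) x = symbol N x * g (r n) x"
    unfolding AE_all_countable by (intro allI onV kg)
  with r(2) have "AE x in M. (\<lambda>n. \<gamma> (N (k (r n))) x) \<longlonglongrightarrow> symbol N x * \<gamma> h x"
  proof eventually_elim
    case (elim x)
    have "(\<lambda>n. \<gamma> h x - (\<gamma> h x - g (r n) x)) \<longlonglongrightarrow> \<gamma> h x - 0" by (intro tendsto_diff tendsto_const elim(1))
    then have "(\<lambda>n. g (r n) x) \<longlonglongrightarrow> \<gamma> h x" by simp
    then show ?case unfolding elim(2)[rule_format] by (rule tendsto_mult_left)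
  qed
  from \<gamma>_lim[OF lim this] show ?thesis .
qed

end

section \<open>Symbols of semigroups\<close>

text \<open>Square roots leave a choice of branch at every step. The averages decide it: by the geometric sum,
  \<open>2\<^sup>m (z\<^sub>p\<^sub>+\<^sub>m - 1)\<close> times the \<open>m\<close>-th average is \<open>z\<^sub>p - 1\<close>, so it converges along \<open>s\<close>.\<close>

lemma sequence_of_roots_exponential:
  fixes z :: "nat \<Rightarrow> complex"
  assumes sq: "\<And>m. (z (Suc m))\<^sup>2 = z m" and s: "strict_mono s"
    and lim: "(\<lambda>i. (1/2) ^ s i * (\<Sum>k<2 ^ s i. z (p + s i) ^ k)) \<longlonglongrightarrow> \<alpha>" and \<alpha>: "\<alpha> \<noteq> 0"
  shows "\<exists>g. \<forall>m. z m = exp ((1/2) ^ m * g)"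
proof -
  have pw: "z (m + j) ^ (2 ^ j) = z m" for m j
  proof (induction j)
    case (Suc j)
    have "z (m + Suc j) ^ (2 ^ Suc j) = ((z (Suc (m + j)))\<^sup>2) ^ (2 ^ j)" by (simp add: power_mult)
    with Suc show ?case by (simp add: sq)
  qed simp
  define w where "w i = z (p + s i)" for i
  define a where "a i = (1/2) ^ s i * (\<Sum>k<2 ^ s i. w i ^ k)" for i
  have a: "a \<longlonglongrightarrow> \<alpha>" using lim by (simp add: a_def[abs_def] w_def)
  define c where "c i = 2 ^ s i * (w i - 1)" for i
  have ca: "c i * a i = z p - 1" for i
  proof -
    have "c i * a i = (w i - 1) * (\<Sum>k<2 ^ s i. w i ^ k)"
      by (simp add: c_def a_def power_one_over)
    also have "\<dots> = w i ^ (2 ^ s i) - 1" by (rule power_diff_1_eq[symmetric])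
    finally show ?thesis by (simp add: w_def pw)
  qed
  have "\<forall>\<^sub>F i in sequentially. a i \<noteq> 0" using a \<alpha> by (rule tendsto_imp_eventually_ne)
  then have "\<forall>\<^sub>F i in sequentially. (z p - 1) / a i = c i"
    by eventually_elim (metis ca nonzero_mult_div_cancel_right)
  moreover have "(\<lambda>i. (z p - 1) / a i) \<longlonglongrightarrow> (z p - 1) / \<alpha>" by (intro tendsto_intros a \<alpha>)
  ultimately have c: "c \<longlonglongrightarrow> (z p - 1) / \<alpha>" by (rule Lim_transform_eventually[rotated])
  have "(\<lambda>i. (1/2 :: complex) ^ s i) \<longlonglongrightarrow> 0"
    using LIMSEQ_subseq_LIMSEQ[OF LIMSEQ_power_zero[of "1/2 :: complex"] s] by (simp add: comp_def norm_divide)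
  from tendsto_mult[OF this c] have "(\<lambda>i. w i - 1) \<longlonglongrightarrow> 0" by (simp add: c_def power_one_over)
  then have w: "w \<longlonglongrightarrow> 1" by (rule LIM_zero_cancel)
  \<comment> \<open>In Caratheodory's form the derivative gives \<open>Ln w = G w * (w - 1)\<close>
    also at \<open>w = 1\<close>, so no point has to be excluded.\<close>
  have "DERIV Ln 1 :> 1" using has_field_derivative_Ln[of 1] by simp
  then obtain G where G: "\<And>x. Ln x - Ln 1 = G x * (x - 1)" "isCont G 1" "G 1 = 1" unfolding CARAT_DERIV by blast
  have d: "(\<lambda>i. 2 ^ s i * Ln (w i)) \<longlonglongrightarrow> (z p - 1) / \<alpha>"
  proof -
    have "(\<lambda>i. G (w i) * c i) \<longlonglongrightarrow> G 1 * ((z p - 1) / \<alpha>)"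
      by (intro tendsto_mult c isCont_tendsto_compose[OF G(2) w])
    moreover have "G (w i) * c i = 2 ^ s i * Ln (w i)" for i using G(1)[of "w i"] by (simp add: c_def)
    ultimately show ?thesis by (simp add: G(3))
  qed
  \<comment> \<open>The exponent is \<open>2 ^ p\<close> times the limit of
    \<open>2 ^ s i * Ln (w i)\<close>. For large \<open>i\<close> the number \<open>z m\<close> is
    the power of \<open>w i\<close> with exponent \<open>2 ^ (p + s i - m)\<close>, and natural
    powers of \<open>exp (Ln (w i))\<close> do not depend on the branch of the logarithm.\<close>
  have "z m = exp ((1/2) ^ m * (2 ^ p * ((z p - 1) / \<alpha>)))" for m
  proof (rule LIMSEQ_unique)
    have "\<forall>\<^sub>F i in sequentially. w i \<noteq> 0" using w by (rule tendsto_imp_eventually_ne) simp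
    moreover have "\<forall>\<^sub>F i in sequentially. i \<ge> m" by (rule eventually_ge_at_top)
    ultimately have "\<forall>\<^sub>F i in sequentially. exp ((1/2) ^ m * (2 ^ p * (2 ^ s i * Ln (w i)))) = z m"
    proof eventually_elim
      case (elim i)
      have mi: "m \<le> p + s i" using elim(2) strict_mono_imp_increasing[OF s, of i] by simp
      define j where "j = p + s i - m"
      have "z m = w i ^ (2 ^ j)" using pw[of m j] mi by (simp add: j_def w_def)
      also have "\<dots> = exp (of_nat (2 ^ j) * Ln (w i))" using elim(1) by (simp add: exp_of_nat_mult del: of_nat_power)
      also have "of_nat (2 ^ j) * Ln (w i) = (1/2) ^ m * (2 ^ p * (2 ^ s i * Ln (w i)))"
      proof -
        have "(2::complex) ^ j * 2 ^ m = 2 ^ p * 2 ^ s i" using mi by (simp add: j_def power_add[symmetric])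
        then have "(2::complex) ^ j = 2 ^ p * 2 ^ s i / 2 ^ m" by (simp add: field_simps)
        then show ?thesis by (simp add: power_one_over)
      qed
      finally show ?case by simp
    qed
    then show "(\<lambda>i. exp ((1/2) ^ m * (2 ^ p * (2 ^ s i * Ln (w i))))) \<longlonglongrightarrow> z m"
      by (rule tendsto_eventually)
    show "(\<lambda>i. exp ((1/2) ^ m * (2 ^ p * (2 ^ s i * Ln (w i))))) \<longlonglongrightarrow> exp ((1/2) ^ m * (2 ^ p * ((z p - 1) / \<alpha>)))"
      by (intro tendsto_intros d)
  qed
  then show ?thesis by blast
qed

text \<open>Recovers the exponent as a limit of functions of the \<open>z m\<close>, so that it is
  measurable without any measurable choice of logarithms.\<close>

lemma exp_difference_quotient:
  fixes g :: complex
  shows "(\<lambda>m. 2 ^ m * (exp ((1/2) ^ m * g) - 1)) \<longlonglongrightarrow> g"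
proof -
  have "DERIV exp (0::complex) :> 1" using DERIV_exp[of 0] by simp
  then obtain G :: "complex \<Rightarrow> complex" where G: "\<And>x. exp x - exp 0 = G x * (x - 0)" "isCont G 0" "G 0 = 1"
    unfolding CARAT_DERIV by blast
  have "(\<lambda>m. (1/2 :: complex) ^ m * g) \<longlonglongrightarrow> 0 * g" by (intro tendsto_intros LIMSEQ_power_zero) (simp add: norm_divide)
  then have "(\<lambda>m. G ((1/2) ^ m * g) * g) \<longlonglongrightarrow> G 0 * g"
    by (intro tendsto_intros isCont_tendsto_compose[OF G(2)]) simp
  moreover have "G ((1/2) ^ m * g) * g = 2 ^ m * (exp ((1/2) ^ m * g) - 1)" for m
    using G(1)[of "(1/2) ^ m * g"] by (simp add: power_one_over)
  ultimately show ?thesis by (simp add: G(3))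
qed

section \<open>Averages of a contractive semigroup over short time intervals\<close>

context hilbert_space
begin

lemma nrm_of_contraction:
  assumes A: "contraction sc ip A" and n: "normal_op ip A"
  shows "\<exists>S. nrm A S"
proof -
  obtain S where S: "is_adjoint ip A S" "A \<circ> S = S \<circ> A" using n by (auto simp: normal_op_def)
  have adj: "ip (A x) y = ip x (S y)" for x y using S(1) by (simp add: is_adjoint_def)
  have "adjp A S"
    by (rule adjpI[where c = 1]) (use A adj in \<open>auto simp: contraction_def\<close>)
  then show ?thesis using S(2) by (auto simp: nrm_def fun_eq_iff)
qed

lemma semigroup_continuous:
  assumes T: "contractive_semigroup sc ip T" and e: "e > 0"
  shows "\<exists>q::nat. \<forall>s. 0 \<le> s \<and> s \<le> (1/2) ^ q \<longrightarrow> nm (T s x - x) < e"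
proof -
  have "((\<lambda>t. nm (T t x - x)) \<longlongrightarrow> 0) (at_right 0)" using T by (simp add: contractive_semigroup_def)
  then have "\<forall>\<^sub>F t in at_right 0. nm (T t x - x) < e" using e by (rule order_tendstoD)
  then obtain b where b: "b > 0" "\<And>t. 0 < t \<Longrightarrow> t < b \<Longrightarrow> nm (T t x - x) < e"
    by (auto simp: eventually_at_right_field)
  obtain q where q: "(1/2 :: real) ^ q < b" using real_arch_pow_inv[OF b(1), of "1/2"] by auto
  have "nm (T s x - x) < e" if "0 \<le> s" "s \<le> (1/2) ^ q" for s
  proof (cases "s = 0")
    case True
    then show ?thesis using T e by (simp add: contractive_semigroup_def)
  next
    case False
    then show ?thesis using that q by (intro b(2)) auto
  qed
  then show ?thesis by blast
qed

lemma semigroup_zero: "contractive_semigroup sc ip T \<Longrightarrow> T 0 x = x"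
  and semigroup_add: "contractive_semigroup sc ip T \<Longrightarrow> s \<ge> 0 \<Longrightarrow> t \<ge> 0 \<Longrightarrow> T (s + t) x = T s (T t x)"
  and semigroup_linear: "contractive_semigroup sc ip T \<Longrightarrow> t \<ge> 0 \<Longrightarrow> clinear_op sc (T t)"
  and semigroup_nm: "contractive_semigroup sc ip T \<Longrightarrow> t \<ge> 0 \<Longrightarrow> nm (T t x) \<le> nm x"
  by (auto simp: contractive_semigroup_def contraction_def)

lemma semigroup_diff:
  assumes T: "contractive_semigroup sc ip T" and s: "0 \<le> s" "s \<le> t"
  shows "nm (T t x - T s x) \<le> nm (T (t - s) x - x)"
proof -
  have "T t x - T s x = T s (T (t - s) x - x)"
    using semigroup_add[OF T, of s "t - s" x] s by (simp add: clinear_diff[OF semigroup_linear[OF T s(1)]])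
  then show ?thesis using semigroup_nm[OF T s(1)] by simp
qed

lemma semigroup_funpow:
  assumes T: "contractive_semigroup sc ip T" and s: "0 \<le> s"
  shows "T (real k * s) x = (T s ^^ k) x"
proof (induction k)
  case 0
  show ?case by (simp add: semigroup_zero[OF T])
next
  case (Suc k)
  have "T (real (Suc k) * s) x = T s (T (real k * s) x)"
    using semigroup_add[OF T s, of "real k * s" x] s by (simp add: algebra_simps)
  with Suc show ?case by simp
qed

text \<open>A Riemann sum with \<open>2 ^ m\<close> points for the mean of \<open>T s v\<close> over
  \<open>0 \<le> s \<le> 2^-p\<close>. In the model it becomes the mean of the first
  \<open>2 ^ m\<close> powers of one number. The interval shrinks with \<open>p\<close> because a
  mean over a full period may be 0, which has to be avoided.\<close>

definition average :: "(real \<Rightarrow> 'h \<Rightarrow> 'h) \<Rightarrow> 'h \<Rightarrow> nat \<Rightarrow> nat \<Rightarrow> 'h" where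
  "average T v p m = sc ((1/2) ^ m) (\<Sum>k<2 ^ m. T (real k * (1/2) ^ (p + m)) v)"

text \<open>Every point of the fine grid is compared with the coarse grid point just below it; by
  contractivity the difference is bounded by the displacement of \<open>v\<close> over less than one
  coarse step.\<close>

lemma average_refine:
  assumes T: "contractive_semigroup sc ip T"
    and e: "\<And>s. 0 \<le> s \<Longrightarrow> s \<le> (1/2) ^ (p + m) \<Longrightarrow> nm (T s v - v) \<le> e"
  shows "nm (average T v p (m + d) - average T v p m) \<le> e"
proof -
  define \<delta> :: real where "\<delta> = (1/2) ^ (p + m + d)"
  have d0: "\<delta> > 0" by (simp add: \<delta>_def)
  have dd: "2 ^ d * \<delta> = (1/2) ^ (p + m)" by (simp add: \<delta>_def power_add power_one_over)
  define f where "f i = T (real i * \<delta>) v" for i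
  \<comment> \<open>Each coarse sample is repeated \<open>2 ^ d\<close> times, so both averages
    become sums over the same index set.\<close>
  define g where "g i = T (real (i div 2 ^ d * 2 ^ d) * \<delta>) v" for i
  have "sc ((1/2) ^ (m + d)) (\<Sum>i<2 ^ m * 2 ^ d. f i) = average T v p (m + d)"
    by (simp add: average_def f_def \<delta>_def power_add add.assoc)
  moreover have "sc ((1/2) ^ (m + d)) (\<Sum>i<2 ^ m * 2 ^ d. g i) = average T v p m"
  proof -
    have "(\<Sum>i<2 ^ m * 2 ^ d. g i) = (\<Sum>k<2 ^ m. \<Sum>i\<in>{k * 2 ^ d..<k * 2 ^ d + 2 ^ d}. g i)"
      by (rule sum.nat_group[symmetric])
    also have "\<dots> = (\<Sum>k<2 ^ m. sc (2 ^ d) (T (real k * (1/2) ^ (p + m)) v))"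
    proof (rule sum.cong[OF refl])
      fix k :: nat
      have "g i = T (real k * (1/2) ^ (p + m)) v" if "i \<in> {k * 2 ^ d..<k * 2 ^ d + 2 ^ d}" for i
      proof -
        have "i div 2 ^ d = k" using that by (intro div_nat_eqI) (auto simp: mult.commute)
        then show ?thesis by (simp add: g_def dd[symmetric] mult.assoc)
      qed
      then have "(\<Sum>i\<in>{k * 2 ^ d..<k * 2 ^ d + 2 ^ d}. g i) = (\<Sum>i\<in>{k * 2 ^ d..<k * 2 ^ d + 2 ^ d}. T (real k * (1/2) ^ (p + m)) v)"
        by (rule sum.cong[OF refl])
      also have "\<dots> = sc (of_nat (2 ^ d)) (T (real k * (1/2) ^ (p + m)) v)"
        by (simp add: sum_constant_scale del: of_nat_power)
      finally show "(\<Sum>i\<in>{k * 2 ^ d..<k * 2 ^ d + 2 ^ d}. g i) = sc (2 ^ d) (T (real k * (1/2) ^ (p + m)) v)" by simp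
    qed
    also have "\<dots> = sc (2 ^ d) (\<Sum>k<2 ^ m. T (real k * (1/2) ^ (p + m)) v)" by (rule scale_sum_right[symmetric])
    finally show ?thesis by (simp add: average_def power_add power_one_over)
  qed
  ultimately have "average T v p (m + d) - average T v p m = sc ((1/2) ^ (m + d)) (\<Sum>i<2 ^ m * 2 ^ d. f i - g i)"
    by (simp add: sum_subtractf scale_right_diff_distrib)
  then have "nm (average T v p (m + d) - average T v p m) \<le> (1/2) ^ (m + d) * (\<Sum>i<2 ^ m * 2 ^ d. nm (f i - g i))"
    using nm_sum_le[of "\<lambda>i. f i - g i" "{..<2 ^ m * 2 ^ d}"] by (simp add: nm_sc norm_power norm_divide)
  also have "\<dots> \<le> (1/2) ^ (m + d) * (\<Sum>i<2 ^ m * (2 ^ d :: nat). e)"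
  proof (intro mult_left_mono sum_mono)
    fix i :: nat
    have split: "real i = real (i div 2 ^ d * 2 ^ d) + real (i mod 2 ^ d)"
      by (metis div_mult_mod_eq of_nat_add)
    have "nm (f i - g i) \<le> nm (T (real i * \<delta> - real (i div 2 ^ d * 2 ^ d) * \<delta>) v - v)"
      unfolding f_def g_def using d0 split by (intro semigroup_diff[OF T]) (auto intro!: mult_right_mono)
    also have "real i * \<delta> - real (i div 2 ^ d * 2 ^ d) * \<delta> = real (i mod 2 ^ d) * \<delta>"
      by (subst split) (simp add: algebra_simps)
    also have "nm (T (real (i mod 2 ^ d) * \<delta>) v - v) \<le> e"
    proof (rule e)
      have "real (i mod 2 ^ d) \<le> 2 ^ d"
        by (metis less_imp_le mod_less_divisor of_nat_le_iff of_nat_numeral of_nat_power pos2 zero_less_power)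
      then show "real (i mod 2 ^ d) * \<delta> \<le> (1/2) ^ (p + m)" using d0 unfolding dd[symmetric] by (intro mult_right_mono) auto
    qed (use d0 in simp)
    finally show "nm (f i - g i) \<le> e" .
  qed simp
  also have "\<dots> = e" by (simp add: power_add power_one_over)
  finally show ?thesis .
qed

lemma average_zero: "contractive_semigroup sc ip T \<Longrightarrow> average T v p 0 = v"
  by (simp add: average_def semigroup_zero)

text \<open>Refinement of a fine grid gives the limit for each \<open>p\<close>; refinement of the
  one-point grid, whose average is \<open>v\<close> itself, shows that these limits approach
  \<open>v\<close>.\<close>

lemma average_limits:
  assumes T: "contractive_semigroup sc ip T"
  shows "\<exists>y. (\<forall>p. hlim (average T v p) (y p)) \<and> hlim y v"
proof -
  have "\<exists>L. hlim (average T v p) L" for p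
    unfolding hlim_def
  proof (rule complete)
    fix e :: real assume "e > 0"
    then have e2: "e/4 > 0" by simp
    obtain q where q: "\<And>s. 0 \<le> s \<Longrightarrow> s \<le> (1/2) ^ q \<Longrightarrow> nm (T s v - v) < e/4"
      using semigroup_continuous[OF T e2] by blast
    have near: "nm (average T v p m - average T v p q) \<le> e/4" if "m \<ge> q" for m
    proof -
      have "nm (average T v p (q + (m - q)) - average T v p q) \<le> e/4"
      proof (rule average_refine[OF T])
        fix s :: real assume "0 \<le> s" "s \<le> (1/2) ^ (p + q)"
        moreover have "(1/2 :: real) ^ (p + q) \<le> (1/2) ^ q" by (intro power_decreasing) auto
        ultimately show "nm (T s v - v) \<le> e/4" using q[of s] by linarith
      qed
      then show ?thesis using that by simp
    qed
    have "nm (average T v p m - average T v p k) < e" if "m \<ge> q" "k \<ge> q" for m k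
      using near[OF that(1)] near[OF that(2)] nm_triangle_diff[of "average T v p m" "average T v p k" "average T v p q"]
        nm_minus_commute[of "average T v p q" "average T v p k"] \<open>e > 0\<close>
      by linarith
    then show "\<exists>N. \<forall>m\<ge>N. \<forall>k\<ge>N. nm (average T v p m - average T v p k) < e" by blast
  qed
  then obtain y where y: "\<And>p. hlim (average T v p) (y p)" by metis
  have "hlim y v" unfolding hlim_def
  proof (rule LIMSEQ_I)
    fix e :: real assume "e > 0"
    then have e2: "e/2 > 0" by simp
    obtain q where q: "\<And>s. 0 \<le> s \<Longrightarrow> s \<le> (1/2) ^ q \<Longrightarrow> nm (T s v - v) < e/2"
      using semigroup_continuous[OF T e2] by blast
    have "nm (y p - v) \<le> e/2" if p: "p \<ge> q" for p
    proof (rule LIMSEQ_le_const2[OF hlim_nm[OF hlim_diff[OF y hlim_const]]], intro exI allI impI)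
      fix m
      have "nm (average T v p (0 + m) - average T v p 0) \<le> e/2"
      proof (rule average_refine[OF T])
        fix s :: real assume "0 \<le> s" "s \<le> (1/2) ^ (p + 0)"
        moreover have "(1/2 :: real) ^ p \<le> (1/2) ^ q" using p by (intro power_decreasing) auto
        ultimately show "nm (T s v - v) \<le> e/2" using q[of s] by fastforce
      qed
      then show "nm (average T v p m - v) \<le> e/2" by (simp add: average_zero[OF T])
    qed
    then show "\<exists>no. \<forall>p\<ge>no. norm (nm (y p - v) - 0) < e" using \<open>e > 0\<close> by (intro exI[of _ q]) force
  qed
  with y show ?thesis by blast
qed

end

section \<open>The exponent of a semigroup in the model\<close>

context spectral_model
begin

lemma \<gamma>_slice: "v \<in> S \<Longrightarrow> AE x in M. fst x = v \<longrightarrow> \<gamma> v x = 1"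
proof -
  assume "v \<in> S"
  from \<gamma>_base[OF this, of "[]"] show ?thesis
    by eventually_elim (auto simp: ind_def cyl_Nil mem_Times_iff)
qed

text \<open>The contraction is tested on the indicator of the set where
  \<open>cmod (Z x) > 1\<close> within one slice; finite mass of the slice puts it into L2, hence
  into the range of \<open>\<gamma>\<close>.\<close>

lemma multiplier_le_1:
  assumes Z: "Z \<in> borel_measurable M" and A: "\<And>h. nm (A h) \<le> nm h"
    and m: "\<And>h. AE x in M. \<gamma> (A h) x = Z x * \<gamma> h x"
  shows "AE x in M. cmod (Z x) \<le> 1"
proof (rule AE_slices)
  note [measurable] = Z
  have "{x \<in> space M. cmod (Z x) \<le> 1} \<in> sets M" by measurable
  then show "{x. cmod (Z x) \<le> 1} \<in> sets M" by (simp add: space_M)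
  fix v assume v: "v \<in> S"
  define B where "B = {x \<in> space M. cmod (Z x) > 1} \<inter> {v} \<times> UNIV"
  have B [measurable]: "B \<in> sets M" unfolding B_def by measurable
  define f :: "'h \<times> (nat \<Rightarrow> complex) \<Rightarrow> complex" where "f = indicator B"
  have "cmod (f x) \<le> cmod (ind v [] x)" for x
    by (auto simp: f_def indicator_def ind_def B_def cyl_Nil)
  then have f: "square_integrable M f"
    unfolding f_def[symmetric] by (intro sqi_dominated[OF ind_sqi[OF v, of "[]"]]) (auto simp: f_def)
  obtain h where h: "AE x in M. \<gamma> h x = f x" using \<gamma>_surj[OF f] by blast
  from m[of h] h have Ah: "AE x in M. \<gamma> (A h) x = Z x * f x" by eventually_elim simp
  have Zf: "square_integrable M (\<lambda>x. Z x * f x)"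
  proof (rule sqi_dominated[OF \<gamma>_sqi[of "A h"]])
    show "(\<lambda>x. Z x * f x) \<in> borel_measurable M" unfolding f_def by measurable
    show "AE x in M. cmod (Z x * f x) \<le> cmod (\<gamma> (A h) x)" using Ah by eventually_elim simp
  qed
  have "L2_norm M (\<lambda>x. Z x * f x) = nm (A h)"
    using L2_norm_cong_AE[OF \<gamma>_measurable sqi_measurable[OF Zf] Ah] R_norm[OF \<gamma>_R, of "A h"] by simp
  moreover have "L2_norm M f = nm h"
    using L2_norm_cong_AE[OF \<gamma>_measurable sqi_measurable[OF f] h] R_norm[OF \<gamma>_R, of h] by simp
  ultimately have "(L2_norm M (\<lambda>x. Z x * f x))\<^sup>2 \<le> (L2_norm M f)\<^sup>2" using A[of h] by (simp add: power_mono)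
  then have le: "(LINT x|M. (cmod (Z x * f x))\<^sup>2 - (cmod (f x))\<^sup>2) \<le> 0"
    using sqi_sq[OF Zf] sqi_sq[OF f] by (simp add: L2_norm_sq)
  have nn: "0 \<le> (cmod (Z x * f x))\<^sup>2 - (cmod (f x))\<^sup>2" for x
    by (auto simp: f_def indicator_def B_def norm_mult)
  have int: "integrable M (\<lambda>x. (cmod (Z x * f x))\<^sup>2 - (cmod (f x))\<^sup>2)"
    using sqi_sq[OF Zf] sqi_sq[OF f] by simp
  have "0 \<le> (LINT x|M. (cmod (Z x * f x))\<^sup>2 - (cmod (f x))\<^sup>2)" by (rule Bochner_Integration.integral_nonneg[OF nn])
  then have "AE x in M. (cmod (Z x * f x))\<^sup>2 - (cmod (f x))\<^sup>2 = 0"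
    using le integral_nonneg_eq_0_iff_AE[OF int] nn by simp
  then show "AE x in M. fst x = v \<longrightarrow> cmod (Z x) \<le> 1"
  proof eventually_elim
    case (elim x)
    show ?case
    proof (rule ccontr)
      assume "\<not> (fst x = v \<longrightarrow> cmod (Z x) \<le> 1)"
      then have x: "fst x = v" "cmod (Z x) > 1" by auto
      then have "f x = 1" by (auto simp: f_def B_def space_M mem_Times_iff)
      with elim have "(cmod (Z x))\<^sup>2 = 1\<^sup>2" by simp
      with x(2) show False using one_less_power[of "cmod (Z x)" 2] by simp
    qed
  qed
qed

text \<open>\<open>K\<close> is the closed cyclic subspace of \<open>v\<close>, written as a double
  orthogonal complement. Its projection commutes with all \<open>P k\<close>, so by hypothesis with
  \<open>N\<close>; therefore \<open>N v\<close> stays in \<open>K\<close>, while the cyclic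
  subspace of \<open>w\<close> lies in \<open>W\<close>.\<close>

lemma cyclic_orthogonal:
  assumes N: "\<And>E x. adjp E E \<Longrightarrow> (\<And>x. nm (E x) \<le> nm x) \<Longrightarrow> (\<And>k x. E (P k x) = P k (E x)) \<Longrightarrow> E (N x) = N (E x)"
    and v: "v \<in> S" and w: "w \<in> S" and vw: "v \<noteq> w"
  shows "ip (N v) (foldr P ks w) = 0"
proof -
  define W where "W = {y. \<forall>ks. ip y (foldr P ks v) = 0}"
  define K where "K = {x. \<forall>y\<in>W. ip x y = 0}"
  have K: "csub K" unfolding K_def by (rule csub_orthogonal)
  have PW: "P k y \<in> W" if "y \<in> W" for k y
  proof -
    have "ip (P k y) (foldr P ks v) = ip y (foldr P (k # ks) v)" for ks by (simp add: adjp_ip[OF pfam_adjp[OF P]])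
    moreover have "ip y (foldr P (k # ks) v) = 0" for ks using that unfolding W_def by blast
    ultimately show ?thesis unfolding W_def by simp
  qed
  have PK: "P k x \<in> K" if "x \<in> K" for k x
    using that PW unfolding K_def by (simp add: adjp_ip[OF pfam_adjp[OF P]])
  have vK: "v \<in> K" unfolding K_def
  proof (intro CollectI ballI)
    fix y assume "y \<in> W"
    then have "ip y (foldr P [] v) = 0" unfolding W_def by blast
    then show "ip v y = 0" by (simp add: ip_commute[of v y])
  qed
  have uW: "foldr P ks w \<in> W" unfolding W_def
  proof (intro CollectI allI)
    fix ls
    have "ip (foldr P ks w) (foldr P ls v) = ip (foldr P (ls @ ks) w) v" by (simp add: foldr_selfadjoint)
    then show "ip (foldr P ks w) (foldr P ls v) = 0" using S_orth[OF w v, of "ls @ ks"] vw by simp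
  qed
  have "proj K (N v) = N (proj K v)"
    by (rule N[OF adjp_proj[OF K] proj_nm_le[OF K]]) (rule proj_commute[OF K pfam_adjp[OF P] PK PK])
  then have "N v \<in> K" using proj_self[OF K vK] proj_in[OF K, of "N v"] by simp
  then show ?thesis using uW unfolding K_def by blast
qed

text \<open>On the slice of \<open>v\<close> the function \<open>\<gamma> v\<close> is 1, so
  relations between the vectors \<open>T t v\<close> become relations between the numbers
  \<open>Z m x\<close>. Only countably many of them are used, so at almost every point
  \<open>sequence_of_roots_exponential\<close> applies.\<close>

lemma semigroup_symbol:
  assumes T: "contractive_semigroup sc ip T"
    and Zm [measurable]: "\<And>m. Z m \<in> borel_measurable M"
    and Z: "\<And>m h. AE x in M. \<gamma> (T ((1/2) ^ m) h) x = Z m x * \<gamma> h x"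
  shows "\<exists>g\<in>borel_measurable M. (AE x in M. Re (g x) \<le> 0) \<and>
    (\<forall>t\<ge>0. \<forall>h. AE x in M. \<gamma> (T t h) x = exp (of_real t * g x) * \<gamma> h x)"
proof -
  have Zk: "AE x in M. \<gamma> (T (real k * (1/2) ^ m) h) x = Z m x ^ k * \<gamma> h x" for k m h
  proof (induction k)
    case 0
    show ?case by (simp add: semigroup_zero[OF T])
  next
    case (Suc k)
    have "T (real (Suc k) * (1/2) ^ m) h = T ((1/2) ^ m) (T (real k * (1/2) ^ m) h)"
      using semigroup_add[OF T, of "(1/2) ^ m" "real k * (1/2) ^ m" h] by (simp add: algebra_simps)
    moreover from Suc Z[of m "T (real k * (1/2) ^ m) h"]
    have "AE x in M. \<gamma> (T ((1/2) ^ m) (T (real k * (1/2) ^ m) h)) x = Z m x ^ Suc k * \<gamma> h x"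
      by eventually_elim simp
    ultimately show ?case by (simp only:)
  qed
  define g where "g x = lim (\<lambda>m. 2 ^ m * (Z m x - 1))" for x
  have g [measurable]: "g \<in> borel_measurable M" unfolding g_def[abs_def] by measurable
  have Zg: "AE x in M. \<forall>m. Z m x = exp ((1/2) ^ m * g x)"
  proof (rule AE_slices)
    have "{x \<in> space M. \<forall>m. Z m x = exp ((1/2) ^ m * g x)} \<in> sets M" by measurable
    then show "{x. \<forall>m. Z m x = exp ((1/2) ^ m * g x)} \<in> sets M" by (simp add: space_M)
    fix v assume v: "v \<in> S"
    have sq: "AE x in M. \<forall>m. fst x = v \<longrightarrow> (Z (Suc m) x)\<^sup>2 = Z m x"
      unfolding AE_all_countable
    proof
      fix m
      have "real 2 * (1/2 :: real) ^ Suc m = (1/2) ^ m" by simp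
      then show "AE x in M. fst x = v \<longrightarrow> (Z (Suc m) x)\<^sup>2 = Z m x"
        using Z[of m v] Zk[of 2 "Suc m" v] \<gamma>_slice[OF v] by eventually_elim auto
    qed
    obtain y where y: "\<And>p. hlim (average T v p) (y p)" "hlim y v" using average_limits[OF T] by blast
    have av: "AE x in M. fst x = v \<longrightarrow> \<gamma> (average T v p m) x = (1/2) ^ m * (\<Sum>k<2 ^ m. Z (p + m) x ^ k)" for p m
    proof -
      have sum: "AE x in M. \<gamma> (\<Sum>k<n. T (real k * (1/2) ^ (p + m)) v) x = (\<Sum>k<n. Z (p + m) x ^ k) * \<gamma> v x" for n
      proof (induction n)
        case 0
        have "AE x in M. \<gamma> 0 x = 0" by (rule R_unique[OF \<gamma>_R V_R[OF V.zero]])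
        then show ?case by simp
      next
        case (Suc n)
        from \<gamma>_linear[of 1 "\<Sum>k<n. T (real k * (1/2) ^ (p + m)) v" "T (real n * (1/2) ^ (p + m)) v"]
          Suc Zk[of n "p + m" v] show ?case
          by eventually_elim (simp add: distrib_right)
      qed
      have sc: "AE x in M. \<gamma> (sc c h) x = c * \<gamma> h x" for c h by (rule R_unique[OF \<gamma>_R R_sc[OF \<gamma>_R]])
      from sum[of "2 ^ m"] \<gamma>_slice[OF v] sc[of "(1/2) ^ m" "\<Sum>k<2 ^ m. T (real k * (1/2) ^ (p + m)) v"] show ?thesis
        unfolding average_def by eventually_elim auto
    qed
    have "\<forall>p. \<exists>r::nat \<Rightarrow> nat. strict_mono r \<and> (AE x in M. (\<lambda>n. \<gamma> (average T v p (r n)) x) \<longlonglongrightarrow> \<gamma> (y p) x)"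
      using \<gamma>_AE_subseq[OF y(1)] by blast
    from choice[OF this] obtain r :: "nat \<Rightarrow> nat \<Rightarrow> nat" where r: "\<And>p. strict_mono (r p)"
      "\<And>p. AE x in M. (\<lambda>n. \<gamma> (average T v p (r p n)) x) \<longlonglongrightarrow> \<gamma> (y p) x" by blast
    obtain r' :: "nat \<Rightarrow> nat" where r': "AE x in M. (\<lambda>n. \<gamma> (y (r' n)) x) \<longlonglongrightarrow> \<gamma> v x"
      using \<gamma>_AE_subseq[OF y(2)] by blast
    have r_all: "AE x in M. \<forall>p. (\<lambda>n. \<gamma> (average T v p (r p n)) x) \<longlonglongrightarrow> \<gamma> (y p) x"
      unfolding AE_all_countable using r(2) by blast
    have av_all: "AE x in M. \<forall>p m. fst x = v \<longrightarrow> \<gamma> (average T v p m) x = (1/2) ^ m * (\<Sum>k<2 ^ m. Z (p + m) x ^ k)"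
      unfolding AE_all_countable using av by blast
    from sq r_all r' av_all \<gamma>_slice[OF v]
    show "AE x in M. fst x = v \<longrightarrow> (\<forall>m. Z m x = exp ((1/2) ^ m * g x))"
    proof eventually_elim
      case (elim x)
      show ?case
      proof
        assume x: "fst x = v"
        have "(\<lambda>n. \<gamma> (y (r' n)) x) \<longlonglongrightarrow> 1" using elim(3,5) x by simp
        then have "\<forall>\<^sub>F n in sequentially. \<gamma> (y (r' n)) x \<noteq> 0" by (rule tendsto_imp_eventually_ne) simp
        \<comment> \<open>The level \<open>p\<close> depends on the point: the limits of the
          averages tend to \<open>\<gamma> v x = 1\<close> along a subsequence, so one of them is
          nonzero.\<close>
        then obtain p where p: "\<gamma> (y p) x \<noteq> 0" by (auto simp: eventually_sequentially)
        have "\<exists>G. \<forall>m. Z m x = exp ((1/2) ^ m * G)"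
        proof (rule sequence_of_roots_exponential[OF _ r(1)[of p] _ p])
          show "(Z (Suc m) x)\<^sup>2 = Z m x" for m using elim(1) x by blast
          show "(\<lambda>i. (1/2) ^ r p i * (\<Sum>k<2 ^ r p i. Z (p + r p i) x ^ k)) \<longlonglongrightarrow> \<gamma> (y p) x"
            using elim(2)[rule_format, of p] elim(4) x by simp
        qed
        then obtain G where G: "\<And>m. Z m x = exp ((1/2) ^ m * G)" by blast
        have "g x = G" unfolding g_def G by (rule limI[OF exp_difference_quotient])
        with G show "\<forall>m. Z m x = exp ((1/2) ^ m * g x)" by simp
      qed
    qed
  qed
  have "AE x in M. cmod (Z 0 x) \<le> 1"
    by (rule multiplier_le_1[where A = "T 1"]) (use semigroup_nm[OF T] Z[of 0] in auto)
  with Zg have Re: "AE x in M. Re (g x) \<le> 0"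
  proof eventually_elim
    case (elim x)
    have "Z 0 x = exp (g x)" using elim(1)[rule_format, of 0] by simp
    then have "exp (Re (g x)) \<le> 1" using elim(2) by (simp add: norm_exp_eq_Re)
    then show ?case by simp
  qed
  have "AE x in M. \<gamma> (T t h) x = exp (of_real t * g x) * \<gamma> h x" if t: "t \<ge> 0" for t h
  proof -
    \<comment> \<open>\<open>s i\<close> is \<open>t\<close> rounded down to the grid of mesh
      \<open>2^-i\<close>; rounding down keeps the remaining time nonnegative, as
      \<open>semigroup_diff\<close> requires.\<close>
    define k where "k i = nat \<lfloor>t * 2 ^ i\<rfloor>" for i
    define s where "s i = real (k i) * (1/2) ^ i" for i
    have ki: "real (k i) = of_int \<lfloor>t * 2 ^ i\<rfloor>" for i using t by (simp add: k_def)
    have s_le: "s i \<le> t" and s_ge: "t - s i \<le> (1/2) ^ i" and s0: "0 \<le> s i" for i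
    proof -
      have "real (k i) \<le> t * 2 ^ i" "t * 2 ^ i - 1 \<le> real (k i)" unfolding ki by linarith+
      then have "real (k i) * (1/2) ^ i \<le> t * 2 ^ i * (1/2) ^ i" "(t * 2 ^ i - 1) * (1/2) ^ i \<le> real (k i) * (1/2) ^ i"
        by (auto intro!: mult_right_mono)
      then show "s i \<le> t" "t - s i \<le> (1/2) ^ i" by (simp_all add: s_def power_one_over diff_divide_distrib)
      show "0 \<le> s i" by (simp add: s_def)
    qed
    have half: "(\<lambda>i. (1/2 :: real) ^ i) \<longlonglongrightarrow> 0" by (rule LIMSEQ_power_zero) simp
    have "(\<lambda>i. t - s i) \<longlonglongrightarrow> 0"
      by (rule tendsto_sandwich[OF _ _ tendsto_const half]) (auto simp: s_le s_ge)
    from tendsto_diff[OF tendsto_const[of t] this] have slim: "s \<longlonglongrightarrow> t" by simp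
    have lim: "hlim (\<lambda>i. T (s i) h) (T t h)" unfolding hlim_def
    proof (rule LIMSEQ_I)
      fix e :: real assume "e > 0"
      then obtain q where q: "\<And>s. 0 \<le> s \<Longrightarrow> s \<le> (1/2) ^ q \<Longrightarrow> nm (T s h - h) < e"
        using semigroup_continuous[OF T] by blast
      have "nm (T (s i) h - T t h) < e" if "i \<ge> q" for i
      proof -
        have "(1/2 :: real) ^ i \<le> (1/2) ^ q" using that by (intro power_decreasing) auto
        then have "nm (T (t - s i) h - h) < e" using s_le[of i] s_ge[of i] by (intro q) linarith+
        then show ?thesis using semigroup_diff[OF T s0[of i] s_le[of i], of h] nm_minus_commute[of "T t h" "T (s i) h"] by linarith
      qed
      then show "\<exists>no. \<forall>i\<ge>no. norm (nm (T (s i) h - T t h) - 0) < e" by auto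
    qed
    have "AE x in M. \<forall>i. \<gamma> (T (s i) h) x = Z i x ^ k i * \<gamma> h x"
      unfolding AE_all_countable s_def using Zk by blast
    with Zg have "AE x in M. (\<lambda>i. \<gamma> (T (s i) h) x) \<longlonglongrightarrow> exp (of_real t * g x) * \<gamma> h x"
    proof eventually_elim
      case (elim x)
      have "Z i x ^ k i = exp (of_real (s i) * g x)" for i
      proof -
        have "Z i x ^ k i = exp (of_nat (k i) * ((1/2) ^ i * g x))"
          using elim(1) by (simp add: exp_of_nat_mult)
        then show ?thesis by (simp add: s_def mult.assoc)
      qed
      then have eq: "\<gamma> (T (s i) h) x = exp (of_real (s i) * g x) * \<gamma> h x" for i using elim(2) by simp
      show ?case unfolding eq by (intro tendsto_intros slim)
    qed
    from \<gamma>_lim[OF lim this] show ?thesis .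
  qed
  with g Re show ?thesis by blast
qed

end

section \<open>The spectral model of commuting semigroups\<close>

context hilbert_space
begin

text \<open>Zorn's lemma. A vector orthogonal to all cyclic subspaces of a maximal family could be
  added to it, hence already belongs to it and is orthogonal to itself.\<close>

lemma orthogonal_generators_exist:
  assumes P: "pfam P"
  shows "\<exists>S. (\<forall>v\<in>S. \<forall>w\<in>S. v \<noteq> w \<longrightarrow> (\<forall>ks. ip (foldr P ks v) w = 0)) \<and>
    (\<forall>x. (\<forall>v\<in>S. \<forall>ks. ip x (foldr P ks v) = 0) \<longrightarrow> x = 0)"
proof -
  define \<C> where "\<C> = {S. \<forall>v\<in>S. \<forall>w\<in>S. v \<noteq> w \<longrightarrow> (\<forall>ks. ip (foldr P ks v) w = 0)}"
  have "\<exists>S\<in>\<C>. \<forall>X\<in>\<C>. S \<subseteq> X \<longrightarrow> X = S"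
  proof (rule subset_Zorn_nonempty)
    show "\<C> \<noteq> {}" unfolding \<C>_def by blast
    fix \<K> assume K: "\<K> \<noteq> {}" "subset.chain \<C> \<K>"
    show "\<Union>\<K> \<in> \<C>" unfolding \<C>_def
    proof (intro CollectI ballI impI allI)
      fix v w ks assume "v \<in> \<Union>\<K>" "w \<in> \<Union>\<K>" and ne: "v \<noteq> w"
      then obtain A B where A: "A \<in> \<K>" "v \<in> A" and B: "B \<in> \<K>" "w \<in> B" by blast
      have "A \<subseteq> B \<or> B \<subseteq> A" using K(2) A(1) B(1) unfolding subset_chain_def by blast
      then obtain C where "C \<in> \<K>" "v \<in> C" "w \<in> C" using A B by blast
      moreover have "\<K> \<subseteq> \<C>" using K(2) unfolding subset_chain_def by blast
      ultimately show "ip (foldr P ks v) w = 0" using ne unfolding \<C>_def by blast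
    qed
  qed
  then obtain S where S: "S \<in> \<C>" "\<And>X. X \<in> \<C> \<Longrightarrow> S \<subseteq> X \<Longrightarrow> X = S" by blast
  have "x = 0" if x: "\<And>v ks. v \<in> S \<Longrightarrow> ip x (foldr P ks v) = 0" for x
  proof -
    have "ip (foldr P ks x) v = 0" "ip (foldr P ks v) x = 0" if "v \<in> S" for v ks
      using x[OF that, of ks] by (simp_all add: pfam_foldr_selfadjoint[OF P] ip_commute[of v])
    then have "insert x S \<in> \<C>" using S(1) unfolding \<C>_def by auto
    from S(2)[OF this] have "x \<in> S" by blast
    from x[OF this, of "[]"] show "x = 0" using ip_self_eq_0D by simp
  qed
  then show ?thesis using S(1) unfolding \<C>_def by (intro exI[of _ S]) auto
qed

text \<open>The last conjunct expresses that the projections determine \<open>N i\<close>; it is the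
  form in which \<open>cyclic_orthogonal\<close> consumes
  \<open>commute_of_disc_projections\<close>.\<close>

lemma spectral_model_exists:
  fixes N N' :: "'i \<Rightarrow> 'h \<Rightarrow> 'h" and I :: "'i set"
  assumes I: "countable I" and nr: "\<And>i. i \<in> I \<Longrightarrow> nrm (N i) (N' i)"
    and N1: "\<And>i x. i \<in> I \<Longrightarrow> nm (N i x) \<le> nm x"
    and comm: "\<And>i j x. i \<in> I \<Longrightarrow> j \<in> I \<Longrightarrow> N i (N j x) = N j (N i x)"
  shows "\<exists>P S M. spectral_model sc ip P S M \<and> semifinite M \<and> (\<forall>i\<in>I. \<forall>k x. N i (P k x) = P k (N i x)) \<and>
    (\<forall>i\<in>I. \<forall>E x. adjp E E \<longrightarrow> (\<forall>x. nm (E x) \<le> nm x) \<longrightarrow> (\<forall>k x. E (P k x) = P k (E x)) \<longrightarrow> E (N i x) = N i (E x))"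
proof -
  obtain Dn :: "complex set" where Dn: "countable Dn" "\<And>X. open X \<Longrightarrow> X \<noteq> {} \<Longrightarrow> \<exists>d\<in>Dn. d \<in> X"
    using countable_dense_exists by metis
  have dense: "closure Dn = UNIV"
  proof -
    have "x \<in> closure Dn" for x
      unfolding closure_approachable
    proof (intro allI impI)
      fix e :: real assume "e > 0"
      then obtain d where "d \<in> Dn" "d \<in> ball x e" using Dn(2)[of "ball x e"] by auto
      then show "\<exists>y\<in>Dn. dist y x < e" by (auto simp: dist_commute)
    qed
    then show ?thesis by blast
  qed
  define K where "K i l p = disc_space (shift (N i) l) (1 / real (Suc p))" for i l p
  \<comment> \<open>The identity keeps the family nonempty when \<open>I\<close> is empty, so that
    it can be enumerated by the natural numbers.\<close>
  define Ps where "Ps = insert (\<lambda>x. x) ((\<lambda>(i, l, p). proj (K i l p)) ` (I \<times> Dn \<times> (UNIV :: nat set)))"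
  define P where "P = from_nat_into Ps"
  have cP: "countable Ps" unfolding Ps_def using I Dn(1) by (intro countable_insert countable_image countable_SIGMA) auto
  have rP: "range P = Ps" unfolding P_def by (rule range_from_nat_into[OF _ cP]) (simp add: Ps_def)
  have cases: "P k = (\<lambda>x. x) \<or> (\<exists>i l p. i \<in> I \<and> l \<in> Dn \<and> P k = proj (K i l p))" for k
  proof -
    have "P k \<in> Ps" using rP by blast
    then show ?thesis unfolding Ps_def by auto
  qed
  have Kc: "csub (K i l p)" if "i \<in> I" for i l p
    unfolding K_def by (rule csub_disc_space[OF nrm_shift[OF nr[OF that]]]) simp
  have Kcomm: "proj (K i l p) (D x) = D (proj (K i l p) x)"
    if "i \<in> I" "adjp D D'" "\<And>x. D (N i x) = N i (D x)" for i l p D D' x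
    unfolding K_def
  proof (rule proj_disc_space_commute[OF nrm_shift[OF nr[OF that(1)]] _ that(2)])
    show "D (shift (N i) l x) = shift (N i) l (D x)" for x by (rule commute_shift[OF that(2)]) (rule that(3))
  qed simp
  have KN: "proj (K i l p) (N j x) = N j (proj (K i l p) x)" if "i \<in> I" "j \<in> I" for i j l p x
    by (rule Kcomm[OF that(1) nrm_adjp[OF nr[OF that(2)]]]) (rule comm[OF that(2,1)])
  have KK: "proj (K i l p) (proj (K j l' p') x) = proj (K j l' p') (proj (K i l p) x)"
    if "i \<in> I" "j \<in> I" for i j l p l' p' x
    by (rule Kcomm[OF that(1) adjp_proj[OF Kc[OF that(2)]]]) (rule KN[OF that(2,1)])
  have pf: "pfam P" unfolding pfam_def
  proof (intro conjI allI)
    show "adjp (P k) (P k)" for k using cases[of k] adjp_id adjp_proj[OF Kc] by fastforce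
    show "P k (P k x) = P k x" for k x
      using cases[of k] proj_self[OF Kc proj_in[OF Kc]] by fastforce
    show "P k (P l x) = P l (P k x)" for k l x
      using cases[of k] cases[of l] KK by fastforce
  qed
  obtain S where S0: "(\<forall>v\<in>S. \<forall>w\<in>S. v \<noteq> w \<longrightarrow> (\<forall>ks. ip (foldr P ks v) w = 0)) \<and>
    (\<forall>x. (\<forall>v\<in>S. \<forall>ks. ip x (foldr P ks v) = 0) \<longrightarrow> x = 0)"
    using orthogonal_generators_exist[OF pf] by (rule exE)
  have S: "ip (foldr P ks v) w = 0" if "v \<in> S" "w \<in> S" "v \<noteq> w" for v w ks
    using conjunct1[OF S0] that by simp
  have S': "x = 0" if "\<And>v ks. v \<in> S \<Longrightarrow> ip x (foldr P ks v) = 0" for x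
    using conjunct2[OF S0] that by simp
  obtain M :: "('h \<times> (nat \<Rightarrow> complex)) measure" where M0: "space M = UNIV \<and>
    (\<forall>A. A \<in> sets M \<longleftrightarrow> (\<forall>v. {w. (v, w) \<in> A} \<in> cyl_sets)) \<and>
    (\<forall>v\<in>S. \<forall>ks. emeasure M ({v} \<times> cyl ks) = ennreal (sqn (foldr P ks v))) \<and>
    (\<forall>A\<in>sets M. (\<forall>v\<in>S. emeasure M (A \<inter> {v} \<times> UNIV) = 0) \<longrightarrow> emeasure M A = 0) \<and> semifinite M"
    using model_measure_exists[OF pf, of S] by (rule exE)
  have "spectral_model sc ip P S M"
  proof unfold_locales
    show "pfam P" by (rule pf)
    show "ip (foldr P ks v) w = 0" if "v \<in> S" "w \<in> S" "v \<noteq> w" for v w ks using S[OF that] .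
    show "x = 0" if "\<And>v ks. v \<in> S \<Longrightarrow> ip x (foldr P ks v) = 0" for x using S'[OF that] .
  qed (use M0 in simp_all)
  moreover have "N i (P k x) = P k (N i x)" if "i \<in> I" for i k x
    using cases[of k] KN[OF _ that] by fastforce
  moreover have "E (N i x) = N i (E x)"
    if i: "i \<in> I" and E: "adjp E E" "\<And>x. nm (E x) \<le> nm x" "\<And>k x. E (P k x) = P k (E x)" for i E x
  proof (rule commute_of_disc_projections[OF nr[OF i] N1[OF i] dense E(1,2)])
    fix l p x assume l: "l \<in> Dn"
    have "proj (K i l p) \<in> Ps" unfolding Ps_def using i l by force
    then obtain k where "P k = proj (K i l p)" using rP by (metis rangeE)
    then show "E (proj (disc_space (shift (N i) l) (1 / real (Suc p))) x) =
        proj (disc_space (shift (N i) l) (1 / real (Suc p))) (E x)"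
      using E(3)[of k x] unfolding K_def by simp
  qed
  moreover have "semifinite M" using M0 by simp
  ultimately show ?thesis by (intro exI[of _ P] exI[of _ S] exI[of _ M]) simp
qed

end

theorem mainTheorem9:
  fixes sc :: "complex \<Rightarrow> 'h::ab_group_add \<Rightarrow> 'h"
    and ip :: "'h \<Rightarrow> 'h \<Rightarrow> complex"
    and n :: nat
    and T :: "nat \<Rightarrow> real \<Rightarrow> 'h \<Rightarrow> 'h"
  assumes "complex_hilbert_space sc ip"
    and "\<And>j. j \<in> {1..n} \<Longrightarrow> normal_contractive_semigroup sc ip (T j)"
    and "\<And>i j t. i \<in> {1..n} \<Longrightarrow> j \<in> {1..n} \<Longrightarrow> t \<ge> 0 \<Longrightarrow> T i t \<circ> T j t = T j t \<circ> T i t"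
  shows "\<exists>(M :: ('h \<times> (nat \<Rightarrow> complex)) measure) (\<psi> :: nat \<Rightarrow> 'h \<times> (nat \<Rightarrow> complex) \<Rightarrow> complex) \<gamma>.
           semifinite M \<and>
           (\<forall>j\<in>{1..n}. \<psi> j \<in> borel_measurable M \<and> (AE x in M. cmod (\<psi> j x) \<le> 1) \<and>
                        emeasure M {x \<in> space M. \<psi> j x = 1} = 0) \<and>
           unitary_to_L2 ip M \<gamma> \<and>
           (\<forall>j\<in>{1..n}. \<forall>t\<ge>0. \<forall>h. AE x in M. \<gamma> (T j t h) x = phi t (\<psi> j x) * \<gamma> h x)"
proof -
  interpret hilbert_space sc ip by unfold_locales (rule assms(1))
  have cs: "contractive_semigroup sc ip (T j)" if "j \<in> {1..n}" for j
    using assms(2)[OF that] by (simp add: normal_contractive_semigroup_def)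
  \<comment> \<open>The pair \<open>(j, m)\<close> stands for the \<open>j\<close>-th semigroup at
    time \<open>2^-m\<close>, which gives a countable family.\<close>
  define N where "N a = T (fst a) ((1/2) ^ snd a)" for a :: "nat \<times> nat"
  define I where "I = {1..n} \<times> (UNIV :: nat set)"
  have "\<exists>S. nrm (N a) S" if "a \<in> I" for a
  proof (rule nrm_of_contraction)
    have j: "fst a \<in> {1..n}" using that by (auto simp: I_def)
    show "contraction sc ip (N a)" using cs[OF j] by (simp add: N_def contractive_semigroup_def)
    show "normal_op ip (N a)" using assms(2)[OF j] by (simp add: N_def normal_contractive_semigroup_def)
  qed
  then obtain N' where nr: "\<And>a. a \<in> I \<Longrightarrow> nrm (N a) (N' a)" by metis
  have N1: "nm (N a x) \<le> nm x" if "a \<in> I" for a x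
    using that unfolding N_def I_def by (intro semigroup_nm cs) auto
  have comm: "N a (N b x) = N b (N a x)" if ab: "a \<in> I" "b \<in> I" for a b x
  proof -
    obtain i m where a: "a = (i, m)" "i \<in> {1..n}" using ab(1) by (auto simp: I_def)
    obtain j k where b: "b = (j, k)" "j \<in> {1..n}" using ab(2) by (auto simp: I_def)
    \<comment> \<open>Commutation is given at equal times only; both dyadic times are multiples of
      this common finer time, and powers of commuting operators commute.\<close>
    define s :: real where "s = (1/2) ^ (m + k)"
    have s0: "0 \<le> s" by (simp add: s_def)
    have "T i s (T j s x) = T j s (T i s x)" for x
      using fun_cong[OF assms(3)[OF a(2) b(2) s0], of x] by simp
    then have "T i s ((T j s ^^ 2 ^ m) x) = (T j s ^^ 2 ^ m) (T i s x)" for x by (rule funpow_commute)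
    then have "(T j s ^^ 2 ^ m) ((T i s ^^ 2 ^ k) x) = (T i s ^^ 2 ^ k) ((T j s ^^ 2 ^ m) x)" for x
      by (intro funpow_commute) simp
    moreover have "N a x = (T i s ^^ 2 ^ k) x" "N b x = (T j s ^^ 2 ^ m) x" for x
    proof -
      have "real (2 ^ k) * s = (1/2) ^ m" "real (2 ^ m) * s = (1/2) ^ k"
        by (simp_all add: s_def power_add power_one_over)
      then show "N a x = (T i s ^^ 2 ^ k) x" "N b x = (T j s ^^ 2 ^ m) x"
        using semigroup_funpow[OF cs[OF a(2)] s0, of "2 ^ k" x] semigroup_funpow[OF cs[OF b(2)] s0, of "2 ^ m" x]
        by (simp_all add: N_def a b)
    qed
    ultimately show ?thesis by simp
  qed
  have "countable I" by (simp add: I_def countable_SIGMA)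
  then have "\<exists>P S M. spectral_model sc ip P S M \<and> semifinite M \<and> (\<forall>a\<in>I. \<forall>k x. N a (P k x) = P k (N a x)) \<and>
    (\<forall>a\<in>I. \<forall>E x. adjp E E \<longrightarrow> (\<forall>x. nm (E x) \<le> nm x) \<longrightarrow> (\<forall>k x. E (P k x) = P k (E x)) \<longrightarrow> E (N a x) = N a (E x))"
    using nr N1 comm by (rule spectral_model_exists)
  then obtain P S M where model: "spectral_model sc ip P S M" and sf: "semifinite M"
    and NP0: "\<forall>a\<in>I. \<forall>k x. N a (P k x) = P k (N a x)"
    and NE0: "\<forall>a\<in>I. \<forall>E x. adjp E E \<longrightarrow> (\<forall>x. nm (E x) \<le> nm x) \<longrightarrow> (\<forall>k x. E (P k x) = P k (E x)) \<longrightarrow>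
      E (N a x) = N a (E x)"
    by (elim exE conjE)
  have NP: "N a (P k x) = P k (N a x)" if "a \<in> I" for a k x
    using NP0 that by simp
  have NE: "E (N a x) = N a (E x)"
    if "a \<in> I" "adjp E E" "\<And>x. nm (E x) \<le> nm x" "\<And>k x. E (P k x) = P k (E x)" for a E x
    using NE0 that by simp
  interpret spectral_model sc ip P S M by (rule model)
  have mult: "AE x in M. \<gamma> (N a h) x = symbol (N a) x * \<gamma> h x" if a: "a \<in> I" for a h
  proof (rule symbol_multiplication[OF nrm_adjp[OF nr[OF a]] NP[OF a]])
    fix v w ks assume "v \<in> S" "w \<in> S" "v \<noteq> w"
    then show "ip (N a v) (foldr P ks w) = 0" by (intro cyclic_orthogonal NE[OF a]) auto
  qed
  have sym: "\<exists>g\<in>borel_measurable M. (AE x in M. Re (g x) \<le> 0) \<and>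
      (\<forall>t\<ge>0. \<forall>h. AE x in M. \<gamma> (T j t h) x = exp (of_real t * g x) * \<gamma> h x)" if j: "j \<in> {1..n}" for j
  proof (rule semigroup_symbol[OF cs[OF j], where Z = "\<lambda>m. symbol (N (j, m))"])
    fix m h
    have "(j, m) \<in> I" using j by (simp add: I_def)
    from mult[OF this, of h] show "AE x in M. \<gamma> (T j ((1/2) ^ m) h) x = symbol (N (j, m)) x * \<gamma> h x"
      by (simp add: N_def)
  qed measurable
  have "\<forall>j\<in>{1..n}. \<exists>g. g \<in> borel_measurable M \<and> (AE x in M. Re (g x) \<le> 0) \<and>
      (\<forall>t\<ge>0. \<forall>h. AE x in M. \<gamma> (T j t h) x = exp (of_real t * g x) * \<gamma> h x)"
    using sym unfolding Bex_def by (rule ballI)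
  from bchoice[OF this] obtain g where g0: "\<forall>j\<in>{1..n}. g j \<in> borel_measurable M \<and> (AE x in M. Re (g j x) \<le> 0) \<and>
      (\<forall>t\<ge>0. \<forall>h. AE x in M. \<gamma> (T j t h) x = exp (of_real t * g j x) * \<gamma> h x)" ..
  have g: "g j \<in> borel_measurable M" "AE x in M. Re (g j x) \<le> 0"
    "t \<ge> 0 \<Longrightarrow> AE x in M. \<gamma> (T j t h) x = exp (of_real t * g j x) * \<gamma> h x" if "j \<in> {1..n}" for j t h
    using bspec[OF g0 that] by simp_all
  \<comment> \<open>The involution turns \<open>phi t (\<psi> j x)\<close> into
    \<open>exp (t * g j x)\<close>, and \<open>Re (g j x) \<le> 0\<close> means that
    \<open>g j x\<close> is at least as close to -1 as to 1, which is the bound on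
    \<open>cmod (\<psi> j x)\<close>.\<close>
  define \<psi> where "\<psi> j x = (g j x + 1) / (g j x - 1)" for j x
  have "\<psi> j \<in> borel_measurable M" if "j \<in> {1..n}" for j
    using g(1)[OF that] unfolding \<psi>_def by measurable
  moreover have "AE x in M. cmod (\<psi> j x) \<le> 1" if "j \<in> {1..n}" for j
    using g(2)[OF that]
  proof eventually_elim
    case (elim x)
    have "cmod (g j x + 1) \<le> cmod (g j x - 1)"
      using elim by (simp add: cmod_def power2_eq_square algebra_simps)
    then show ?case by (simp add: \<psi>_def norm_divide divide_le_eq_1)
  qed
  \<comment> \<open>The value 1 is not taken at any point: numerator and denominator differ by 2,
    and where the denominator vanishes the quotient is 0 by convention.\<close>
  moreover have "emeasure M {x \<in> space M. \<psi> j x = 1} = 0" for j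
  proof -
    have "{x \<in> space M. \<psi> j x = 1} = {}" by (auto simp: \<psi>_def divide_eq_1_iff)
    then show ?thesis by (simp only: emeasure_empty)
  qed
  moreover have "AE x in M. \<gamma> (T j t h) x = phi t (\<psi> j x) * \<gamma> h x" if "j \<in> {1..n}" "t \<ge> 0" for j t h
    using g(2)[OF that(1)] g(3)[OF that, of h]
  proof eventually_elim
    case (elim x)
    have "g j x \<noteq> 1" using elim(1) by auto
    then have "(\<psi> j x + 1) / (\<psi> j x - 1) = g j x" by (simp add: \<psi>_def field_simps)
    then show ?case using elim(2) by (simp add: phi_def)
  qed
  ultimately show ?thesis
    using sf \<gamma>_unitary by (intro exI[of _ M] exI[of _ \<psi>] exI[of _ \<gamma>] conjI ballI allI impI) auto
qed

end
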